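(* Let $n\ge3$ and $2<p\le2^*=\frac{2n}{n-2}$. There exists $0<\alpha_n<e$, depending only on $n$, such that for all $0<\alpha\le\alpha_n$ and all $v\in C_c^\infty(\mathbb{H}^n)$ there holds $$\int_{\mathbb{H}^n}|\nabla_{\mathbb{H}^n}v|^2dV\ \ge\ \Big(\frac{n-1}{2}\Big)^2\int_{\mathbb{H}^n}v^2dV+\Big(\frac{n-2}{2}\Big)^2\int_{\mathbb{H}^n}\frac{v^2}{\sinh^2\rho}dV+(n-2)^{-\frac{p+2}{p}}\,\overline{S}_{n,p}\Big(\int_{\mathbb{H}^n}(\sinh\rho)^{\frac{p(n-2)}{2}-n}X^{\frac{p+2}{2}}\big(\alpha\tanh(\rho/2)\big)|v|^p\,dV\Big)^{2/p}.$$
   Context: $\mathbb{H}^n$ is the $n$-dimensional hyperbolic space (curvature $-1$) with Riemannian gradient $\nabla_{\mathbb{H}^n}$ and volume element $dV$; $\rho=\rho(x)$ is the hyperbolic distance from $x$ to a fixed point $x_0\in\mathbb{H}^n$. Functions are real-valued. $X(t)=\frac{1}{1-\ln t}$ for $t\in(0,e)$, and $X^{q}(t)=(X(t))^q$. $\overline{S}_{n,p}$ denotes the best (largest) constant in the inequality $$\int_{\mathbb{H}^n}|\nabla_{\mathbb{H}^n}v|^2dV\ge\Big(\frac{n-1}{2}\Big)^2\int_{\mathbb{H}^n}v^2dV+\overline{S}_{n,p}\Big(\int_{\mathbb{H}^n}(\sinh\rho)^{\frac{p(n-2)}{2}-n}|v|^pdV\Big)^{2/p},\qquad v\in C_c^\infty(\mathbb{H}^n).$$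 *)

theory Defs
  imports "HOL-Analysis.Analysis"
begin

text \<open>
  Hyperbolic space of dimension \<open>n = CARD('n)\<close> is taken in the Poincare ball model: the points are
  those of \<open>ball 0 1\<close> in \<open>real ^ 'n\<close>, with Riemannian metric
  \<open>(2 / (1 - |x|^2))^2 |dx|^2\<close> (curvature -1).
\<close>

abbreviation hyp_space :: "(real ^ 'n) set"
  where "hyp_space \<equiv> ball 0 1"

definition conf_factor :: "real ^ 'n \<Rightarrow> real"
  where "conf_factor x = 2 / (1 - (norm x)\<^sup>2)"

definition hyp_metric :: "real ^ 'n \<Rightarrow> real ^ 'n \<Rightarrow> real ^ 'n \<Rightarrow> real"
  where "hyp_metric x u w = (conf_factor x)\<^sup>2 * (u \<bullet> w)"

text \<open>The volume element is \<open>sqrt (det g) dx = conf_factor x ^ n dx\<close>.\<close>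

definition hyp_volume :: "(real ^ 'n) measure"
  where "hyp_volume =
    density lborel (\<lambda>x. ennreal (indicator hyp_space x * conf_factor x ^ CARD('n)))"

text \<open>Distance between points of \<open>hyp_space\<close>; outside the ball the formula has no meaning.\<close>

definition hyp_dist :: "real ^ 'n \<Rightarrow> real ^ 'n \<Rightarrow> real"
  where "hyp_dist x y =
    arcosh (1 + 2 * (norm (x - y))\<^sup>2 / ((1 - (norm x)\<^sup>2) * (1 - (norm y)\<^sup>2)))"

lemma hyp_dist_origin:
  assumes "x \<in> hyp_space"
  shows "hyp_dist 0 x = ln ((1 + norm x) / (1 - norm x))"
proof -
  have x: "0 \<le> norm x" "norm x < 1"
    using assms by auto
  then have a: "(1 + norm x) / (1 - norm x) \<ge> 1"
    by simp
  have "(norm x)\<^sup>2 < 1"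
    using x by (simp add: abs_square_less_1)
  then have "1 + 2 * (norm x)\<^sup>2 / (1 - (norm x)\<^sup>2) = (1 + (norm x)\<^sup>2) / (1 - (norm x)\<^sup>2)"
    by (simp add: field_simps)
  also have "\<dots> = ((1 + norm x)\<^sup>2 + (1 - norm x)\<^sup>2) / (2 * ((1 - norm x) * (1 + norm x)))"
  proof -
    have "(1 + norm x)\<^sup>2 + (1 - norm x)\<^sup>2 = 2 * (1 + (norm x)\<^sup>2)"
      "2 * ((1 - norm x) * (1 + norm x)) = 2 * (1 - (norm x)\<^sup>2)"
      by (simp_all add: power2_eq_square algebra_simps)
    then show ?thesis
      by (simp only: mult_divide_mult_cancel_left[OF zero_neq_numeral[symmetric]])
  qed
  also have "\<dots> = ((1 + norm x) / (1 - norm x) + inverse ((1 + norm x) / (1 - norm x))) / 2"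
    using x by (simp add: divide_simps power2_eq_square) (simp add: algebra_simps)
  also have "\<dots> = cosh (ln ((1 + norm x) / (1 - norm x)))"
    using a by (simp add: cosh_ln_real)
  finally show ?thesis
    using a by (simp add: hyp_dist_def arcosh_cosh_real)
qed

definition partial :: "(real ^ 'n \<Rightarrow> real) \<Rightarrow> 'n \<Rightarrow> real ^ 'n \<Rightarrow> real"
  where "partial f i x = frechet_derivative f (at x) (axis i 1)"

definition hyp_grad :: "(real ^ 'n \<Rightarrow> real) \<Rightarrow> real ^ 'n \<Rightarrow> real ^ 'n"
  where "hyp_grad v x = (1 / (conf_factor x)\<^sup>2) *\<^sub>R (\<chi> i. partial v i x)"

text \<open>\<open>hyp_grad\<close> is the Riemannian gradient: it represents the differential with respect to the
  metric.\<close>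

lemma hyp_metric_hyp_grad:
  fixes v :: "real ^ 'n \<Rightarrow> real"
  assumes "x \<in> hyp_space" and "v differentiable (at x)"
  shows "hyp_metric x (hyp_grad v x) w = frechet_derivative v (at x) w"
proof -
  have lin: "linear (frechet_derivative v (at x))"
    using assms(2) by (rule linear_frechet_derivative)
  have "(norm x)\<^sup>2 < 1"
    using assms(1) by (simp add: abs_square_less_1)
  then have c: "conf_factor x \<noteq> 0"
    by (simp add: conf_factor_def)
  have "frechet_derivative v (at x) w
      = frechet_derivative v (at x) (\<Sum>i\<in>UNIV. (w $ i) *\<^sub>R axis i 1)"
    using basis_expansion[of w] by (simp add: scalar_mult_eq_scaleR)
  also have "\<dots> = (\<Sum>i\<in>UNIV. (w $ i) * partial v i x)"
    using lin by (simp add: linear_sum linear_cmul partial_def)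
  also have "\<dots> = (\<chi> i. partial v i x) \<bullet> w"
    by (simp add: inner_vec_def mult.commute)
  finally show ?thesis
    using c by (simp add: hyp_metric_def hyp_grad_def)
qed

definition hyp_grad_norm :: "(real ^ 'n \<Rightarrow> real) \<Rightarrow> real ^ 'n \<Rightarrow> real"
  where "hyp_grad_norm v x = sqrt (hyp_metric x (hyp_grad v x) (hyp_grad v x))"

primrec C_k :: "nat \<Rightarrow> (real ^ 'n \<Rightarrow> real) \<Rightarrow> bool"
  where
    "C_k 0 f \<longleftrightarrow> continuous_on UNIV f"
  | "C_k (Suc k) f \<longleftrightarrow> (\<forall>x. f differentiable (at x)) \<and> (\<forall>i. C_k k (partial f i))"

text \<open>Smooth functions with compact support in hyperbolic space, identified with their extension by
  zero to \<open>real ^ 'n\<close>.\<close>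

definition test_functions :: "(real ^ 'n \<Rightarrow> real) set"
  where "test_functions =
    {v. (\<forall>k. C_k k v) \<and> compact (closure {x. v x \<noteq> 0}) \<and> closure {x. v x \<noteq> 0} \<subseteq> hyp_space}"

definition X :: "real \<Rightarrow> real"
  where "X t = 1 / (1 - ln t)"

text \<open>The best constant. The set of admissible constants is closed, contains 0 and is bounded above
  for the exponents considered, so its supremum is its largest element.\<close>

definition best_const :: "real ^ 'n \<Rightarrow> real \<Rightarrow> real"
  where "best_const x0 p =
    Sup {S. \<forall>v \<in> (test_functions :: (real ^ 'n \<Rightarrow> real) set).
      (LINT x|hyp_volume. (hyp_grad_norm v x)\<^sup>2)
        \<ge> ((real CARD('n) - 1) / 2)\<^sup>2 * (LINT x|hyp_volume. (v x)\<^sup>2)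
          + S * (LINT x|hyp_volume.
                   sinh (hyp_dist x0 x) powr (p * (real CARD('n) - 2) / 2 - real CARD('n))
                   * \<bar>v x\<bar> powr p) powr (2 / p)}"

end

theory Submission
  imports Defs
begin

text \<open>
  Put \<open>m = n - 2\<close>. An inversion moves the base point to the origin of the ball. In the coordinate
  \<open>t = - ln \<bar>x\<bar>\<close>, which satisfies \<open>sinh \<rho> * sinh t = 1\<close>, and after division by \<open>sinh t powr (m / 2)\<close>, the
  energy minus its Poincare and Hardy parts is that of \<open>-\<partial>\<^sub>t^2 - \<Delta>\<^sub>\<theta> - 1 / (4 sinh^2 t)\<close> on
  a cylinder, while the energy behind the best constant has the additional term \<open>m^2 / 4\<close>. A change of variable
  \<open>t = T s\<close>, with amplitude \<open>T'^(-1/2)\<close>, turns the first form into a form that dominates the second one as soon as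
  \<open>T' \<ge> 1\<close> and \<open>{T, s} / 2 + m^2 / 4 + T'^2 / (4 sinh^2 T) \<le> 1 / (4 sinh^2 s)\<close>. The weighted norms compare
  with the factor \<open>m powr ((p + 2) / 2)\<close> if \<open>T' \<le> m (T + L)\<close> with \<open>L = 1 - ln \<alpha>\<close>. A function \<open>T\<close> close to
  \<open>100 exp (m s)\<close> has these properties with \<open>L \<ge> 200\<close>. Test functions that do not vanish near the base point are
  reached by a cut-off.
\<close>

section \<open>The radial profile\<close>

text \<open>The choice of \<open>T\<close> is shaped from two ends. For
  \<open>T = A exp (m s)\<close> the Schwarzian is \<open>- m^2 / 2\<close>, so
  \<open>{T, s} / 2 + m^2 / 4\<close> vanishes identically, and \<open>T' = m T\<close> is just the
  growth that the logarithmic weight can absorb. But this \<open>T\<close> does not start at 0, and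
  \<open>A (exp (m s) - 1)\<close> has \<open>T' / T\<close> larger than \<open>1 / s\<close> by
  about \<open>m / 2\<close>. Near 0 the potential \<open>1 / (4 sinh^2 s)\<close> is the critical
  Hardy potential, and the second-order gain of \<open>T^2 / sinh^2 T\<close> cannot make up for a
  first-order excess. So \<open>T\<close> is made concave near 0; this leaves a bounded positive
  \<open>{T, s} / 2 + m^2 / 4\<close>, and a large prefactor makes the second-order gain exceed it.
  The price is the size of \<open>L\<close>: for \<open>T = 100 tau\<close>, the bound
  \<open>tau' <= tau + 2\<close> gives \<open>T' <= m (T + 200)\<close>, hence
  \<open>L >= 200\<close>, that is \<alpha> at most \<open>exp (- 199)\<close>, in every dimension.
  The condition \<open>T' >= 1\<close> comes from the angular part of the gradient, which the
  substitution does not stretch. The best constant is only tested on one function built from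
  \<open>v\<close>, so its value never has to be known.\<close>

lemma sinh_ge_self:
  fixes x :: real assumes "0 \<le> x" shows "x \<le> sinh x"
proof -
  have "(\<lambda>x::real. sinh x - x) 0 \<le> sinh x - x"
  proof (rule DERIV_nonneg_imp_nondecreasing[OF assms])
    fix t :: real assume t: "0 \<le> t" "t \<le> x"
    have "((\<lambda>x. sinh x - x) has_real_derivative (cosh t - 1)) (at t)"
      by (auto intro!: derivative_eq_intros)
    then show "\<exists>y. ((\<lambda>x. sinh x - x) has_real_derivative y) (at t) \<and> 0 \<le> y"
      using cosh_real_ge_1[of t] by force
  qed
  then show ?thesis by simp
qed

text \<open>The cubic term is the source of the gain: it yields
  \<open>z^2 (1 + z^2 / 3) <= sinh^2 z\<close>, needed for small arguments, and outgrows the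
  quadratic terms met for large ones.\<close>

lemma sinh_ge_cubic:
  fixes x :: real assumes "0 \<le> x" shows "x + x ^ 3 / 6 \<le> sinh x"
proof -
  have c: "1 + x\<^sup>2 / 2 \<le> cosh x" if "0 \<le> x" for x :: real
  proof -
    have "(\<lambda>x::real. cosh x - (1 + x\<^sup>2 / 2)) 0 \<le> cosh x - (1 + x\<^sup>2 / 2)"
    proof (rule DERIV_nonneg_imp_nondecreasing[OF that])
      fix t :: real assume t: "0 \<le> t" "t \<le> x"
      have "((\<lambda>x. cosh x - (1 + x\<^sup>2 / 2)) has_real_derivative (sinh t - t)) (at t)"
        by (auto intro!: derivative_eq_intros)
      moreover have "sinh t - t \<ge> 0"
        using sinh_ge_self[of t] t by simp
      ultimately show "\<exists>y. ((\<lambda>x. cosh x - (1 + x\<^sup>2 / 2)) has_real_derivative y) (at t) \<and> 0 \<le> y"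
        by blast
    qed
    then show ?thesis by simp
  qed
  have "(\<lambda>x::real. sinh x - (x + x ^ 3 / 6)) 0 \<le> sinh x - (x + x ^ 3 / 6)"
  proof (rule DERIV_nonneg_imp_nondecreasing[OF assms])
    fix t :: real assume t: "0 \<le> t" "t \<le> x"
    have "((\<lambda>x. sinh x - (x + x ^ 3 / 6)) has_real_derivative (cosh t - (1 + t\<^sup>2 / 2))) (at t)"
      by (auto intro!: derivative_eq_intros)
    then show "\<exists>y. ((\<lambda>x. sinh x - (x + x ^ 3 / 6)) has_real_derivative y) (at t) \<and> 0 \<le> y"
      using c[OF t(1)] by force
  qed
  then show ?thesis by simp
qed

text \<open>\<open>cosh\<close> increases, so the difference has a nonnegative derivative. Through
  this bound a single inequality without parameter, \<open>tau_ineq\<close>, serves all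
  \<open>m >= 1\<close>.\<close>

lemma mult_sinh_le:
  fixes m s :: real assumes "1 \<le> m" "0 \<le> s" shows "m * sinh s \<le> sinh (m * s)"
proof -
  have "(\<lambda>s. sinh (m * s) - m * sinh s) 0 \<le> sinh (m * s) - m * sinh s"
  proof (rule DERIV_nonneg_imp_nondecreasing[OF assms(2)])
    fix t :: real assume t: "0 \<le> t" "t \<le> s"
    have "((\<lambda>s. sinh (m * s) - m * sinh s) has_real_derivative (m * (cosh (m * t) - cosh t))) (at t)"
      by (auto intro!: derivative_eq_intros simp: algebra_simps)
    moreover have "cosh t \<le> cosh (m * t)"
      using t assms(1) mult_right_mono[of 1 m t] by (simp add: cosh_real_nonneg_le_iff)
    then have "0 \<le> m * (cosh (m * t) - cosh t)"
      using assms by simp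
    ultimately show "\<exists>y. ((\<lambda>s. sinh (m * s) - m * sinh s) has_real_derivative y) (at t) \<and> 0 \<le> y"
      by blast
  qed
  then show ?thesis by simp
qed

text \<open>Equivalent to \<open>1 / (4 x^2) - 1 <= 1 / (4 sinh^2 x)\<close>: the loss in replacing
  \<open>sinh x\<close> by \<open>x\<close> in the critical potential is bounded. It follows from
  \<open>sinh x <= x cosh x\<close> and \<open>cosh x <= 1 + x^2\<close>.\<close>

lemma sinh_sq_le:
  fixes x :: real assumes "0 \<le> x" "x < 1 / 2"
  shows "(sinh x)\<^sup>2 * (1 - 4 * x\<^sup>2) \<le> x\<^sup>2"
proof -
  have "(\<lambda>x. x * cosh x - sinh x) 0 \<le> x * cosh x - sinh x"
  proof (rule DERIV_nonneg_imp_nondecreasing[OF assms(1)])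
    fix t :: real assume t: "0 \<le> t" "t \<le> x"
    have "((\<lambda>x. x * cosh x - sinh x) has_real_derivative (t * sinh t)) (at t)"
      by (auto intro!: derivative_eq_intros)
    then show "\<exists>y. ((\<lambda>x. x * cosh x - sinh x) has_real_derivative y) (at t) \<and> 0 \<le> y"
      using t by force
  qed
  then have 1: "sinh x \<le> x * cosh x" by simp
  have "(\<lambda>x. 1 + x\<^sup>2 - cosh x) 0 \<le> 1 + x\<^sup>2 - cosh x"
  proof (rule DERIV_nonneg_imp_nondecreasing[OF assms(1)])
    fix t :: real assume t: "0 \<le> t" "t \<le> x"
    have d: "((\<lambda>x. 1 + x\<^sup>2 - cosh x) has_real_derivative (2 * t - sinh t)) (at t)"
      by (auto intro!: derivative_eq_intros)
    have "exp t \<le> 1 + t + t\<^sup>2"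
      using exp_bound[of t] t assms by simp
    moreover have "1 - t \<le> exp (- t)"
      using exp_ge_add_one_self[of "- t"] by simp
    moreover have "t\<^sup>2 \<le> t"
      using t assms by (simp add: power2_eq_square mult_left_le_one_le)
    ultimately have "sinh t \<le> 2 * t"
      using t unfolding sinh_field_def by simp
    then show "\<exists>y. ((\<lambda>x. 1 + x\<^sup>2 - cosh x) has_real_derivative y) (at t) \<and> 0 \<le> y"
      using d by force
  qed
  then have 2: "cosh x \<le> 1 + x\<^sup>2" by simp
  have "sinh x \<le> x * (1 + x\<^sup>2)"
    using 1 2 assms mult_left_mono[of "cosh x" "1 + x\<^sup>2" x] by simp
  then have "(sinh x)\<^sup>2 \<le> (x * (1 + x\<^sup>2))\<^sup>2"
    using assms by (intro power_mono) auto
  moreover have "0 \<le> 1 - 4 * x\<^sup>2"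
    using assms power_strict_mono[of x "1/2" 2] by (simp add: power_divide)
  ultimately have "(sinh x)\<^sup>2 * (1 - 4 * x\<^sup>2) \<le> (x * (1 + x\<^sup>2))\<^sup>2 * (1 - 4 * x\<^sup>2)"
    by (intro mult_right_mono)
  also have "\<dots> = x\<^sup>2 * (1 - 2 * x ^ 2 - 7 * x ^ 4 - 4 * x ^ 6)"
    by (simp add: field_simps power2_eq_square power_numeral_reduce)
  also have "\<dots> \<le> x\<^sup>2 * 1"
  proof (intro mult_left_mono)
    have "0 \<le> x ^ 4" "0 \<le> x ^ 6" "0 \<le> x\<^sup>2" by simp_all
    then show "1 - 2 * x ^ 2 - 7 * x ^ 4 - 4 * x ^ 6 \<le> 1" by linarith
  qed simp
  finally show ?thesis by simp
qed

section \<open>The profile, its primitive, and the inequality between potentials\<close>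

text \<open>
  The stretching \<open>T\<close> has \<open>T' = 100 m / profile (m s)^2\<close>, so that its Schwarzian derivative is
  \<open>-2 f''/f\<close> for \<open>f s = profile (m s)\<close>. The term \<open>exp (-4 x) / 5\<close> makes \<open>tau\<close> concave near 0; this
  compensates the critical potential \<open>1 / (4 sinh^2)\<close> there, whereas \<open>exp (- x / 2)\<close> alone fails.
\<close>
definition profile :: "real \<Rightarrow> real"
  where "profile x = exp (- x / 2) * (1 - exp (- 4 * x) / 5)"

definition tau :: "real \<Rightarrow> real"
  where "tau x = integral {0..x} (\<lambda>s. 1 / (profile s)\<^sup>2)"

lemma one_minus_bounds:
  fixes x :: real
  assumes "0 \<le> x"
  shows "4 / 5 \<le> 1 - exp (- 4 * x) / 5" "1 - exp (- 4 * x) / 5 < 1"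
proof -
  have "exp (- 4 * x) \<le> 1" using assms by simp
  then show "4 / 5 \<le> 1 - exp (- 4 * x) / 5" by linarith
qed simp

lemma profile_pos: assumes "0 \<le> x" shows "0 < profile x"
  unfolding profile_def using one_minus_bounds(1)[OF assms] by (intro mult_pos_pos exp_gt_zero) linarith

lemma inv_profile_sq: "1 / (profile x)\<^sup>2 = exp x / (1 - exp (- 4 * x) / 5)\<^sup>2"
proof -
  have "(exp (- x / 2))\<^sup>2 = exp (- x)"
    by (simp add: power2_eq_square flip: exp_add)
  then show ?thesis
    unfolding profile_def by (simp add: power_mult_distrib exp_minus field_simps)
qed

lemma continuous_on_inv_profile: "continuous_on {0..b} (\<lambda>s. 1 / (profile s)\<^sup>2)"
  unfolding inv_profile_sq
proof (intro continuous_intros ballI)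
  fix x assume "x \<in> {0..b}"
  then have "0 \<le> x" by simp
  then have "0 < 1 - exp (- 4 * x) / 5" using one_minus_bounds(1)[of x] by linarith
  then show "(1 - exp (- 4 * x) / 5)\<^sup>2 \<noteq> 0" by (metis less_irrefl zero_eq_power2)
qed auto

lemma tau_0 [simp]: "tau 0 = 0"
  by (simp add: tau_def)

lemma DERIV_tau: assumes "0 < x" shows "(tau has_real_derivative 1 / (profile x)\<^sup>2) (at x)"
proof -
  have "(tau has_real_derivative 1 / (profile x)\<^sup>2) (at x within {0..x+1})"
    unfolding tau_def by (rule integral_has_real_derivative[OF continuous_on_inv_profile]) (use assms in auto)
  moreover have "at x within {0..x+1} = at x"
    using assms by (intro at_within_interior) auto
  ultimately show ?thesis by simp
qed

lemma continuous_on_tau: "continuous_on {0..b} tau"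
  unfolding tau_def by (intro indefinite_integral_continuous_1 integrable_continuous_interval continuous_on_inv_profile)


lemma inv_profile_ge: assumes "0 \<le> x" shows "exp x \<le> 1 / (profile x)\<^sup>2"
proof -
  have b: "0 < 1 - exp (- 4 * x) / 5" "1 - exp (- 4 * x) / 5 \<le> 1"
    using one_minus_bounds[OF assms] by linarith+
  then have "0 < (1 - exp (- 4 * x) / 5)\<^sup>2" "(1 - exp (- 4 * x) / 5)\<^sup>2 \<le> 1"
    by (metis zero_less_power) (use b in \<open>metis less_imp_le power_le_one\<close>)
  then show ?thesis unfolding inv_profile_sq by (simp add: le_divide_eq)
qed

lemma tau_ge: assumes "0 \<le> x" shows "exp x - 1 \<le> tau x"
proof -
  have "(exp has_integral (exp x - exp 0)) {0..x}"
    using assms by (intro fundamental_theorem_of_calculus)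
      (auto intro!: derivative_eq_intros simp flip: has_real_derivative_iff_has_vector_derivative)
  moreover have "((\<lambda>s. 1 / (profile s)\<^sup>2) has_integral tau x) {0..x}"
    unfolding tau_def by (intro integrable_integral integrable_continuous_interval continuous_on_inv_profile)
  ultimately show ?thesis
    using has_integral_le[of exp "exp x - exp 0" "{0..x}" "\<lambda>s. 1 / (profile s)\<^sup>2" "tau x"] inv_profile_ge by auto
qed

lemma tau_pos: assumes "0 < x" shows "0 < tau x"
  using tau_ge[of x] assms exp_gt_one[of x] by linarith

lemma tau_strict_mono: assumes "0 \<le> x" "x < y" shows "tau x < tau y"
proof (rule DERIV_pos_imp_increasing_open[OF assms(2)])
  fix t assume "x < t" "t < y"
  then have "0 < t" using assms by simp
  then show "\<exists>z. (tau has_real_derivative z) (at t) \<and> 0 < z"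
    using DERIV_tau[of t] profile_pos[of t] by (intro exI[of _ "1 / (profile t)\<^sup>2"]) auto
next
  show "continuous_on {x..y} tau"
    by (rule continuous_on_subset[OF continuous_on_tau[of y]]) (use assms in auto)
qed

text \<open>The correction \<open>1 / (1 - z)^2 <= 1 + 5 z\<close> costs
  \<open>5 z exp x = exp (- 3 x) <= 1\<close>, and \<open>tau_ge\<close> costs another 1. The
  resulting 2, multiplied by the prefactor 100, is the 200 that bounds \<open>L\<close> from
  below.\<close>

lemma inv_profile_le: assumes "0 \<le> x" shows "1 / (profile x)\<^sup>2 \<le> tau x + 2"
proof -
  define z where "z = exp (- 4 * x) / 5"
  have z: "0 < z" "z \<le> 1 / 5" using assms by (auto simp: z_def)
  have zE: "exp x * (5 * z) \<le> 1"
  proof -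
    have "exp x * (5 * z) = exp (- 3 * x)"
      by (simp add: z_def flip: exp_add)
    then show ?thesis using assms by simp
  qed
  have "1 / (profile x)\<^sup>2 = exp x / (1 - z)\<^sup>2" by (simp add: inv_profile_sq z_def)
  also have "\<dots> \<le> exp x * (1 + 5 * z)"
  proof -
    have "1 \<le> (1 + 5 * z) * (1 - z)\<^sup>2"
    proof -
      have "(1 + 5 * z) * (1 - z)\<^sup>2 - 1 = z * (3 - 9 * z + 5 * z\<^sup>2)"
        by (simp add: power2_eq_square algebra_simps)
      moreover have "0 \<le> 3 - 9 * z + 5 * z\<^sup>2" using z by (simp add: add_nonneg_nonneg)
      ultimately show ?thesis using z by (smt (verit) mult_nonneg_nonneg)
    qed
    then have "1 / (1 - z)\<^sup>2 \<le> 1 + 5 * z" using z by (simp add: divide_le_eq)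
    then have "exp x * (1 / (1 - z)\<^sup>2) \<le> exp x * (1 + 5 * z)" by (intro mult_left_mono) auto
    then show ?thesis by simp
  qed
  also have "\<dots> \<le> exp x + 1" using zE by (simp add: algebra_simps)
  finally show ?thesis using tau_ge[OF assms] by simp
qed

lemma DERIV_profile:
  "(profile has_real_derivative profile x * (- 1 / 2 + (4 / 5) * exp (- 4 * x) / (1 - exp (- 4 * x) / 5))) (at x)"
  if "0 \<le> x"
proof -
  have nz: "1 - exp (- 4 * x) / 5 \<noteq> 0" using one_minus_bounds(1)[OF that] by linarith
  have "(profile has_real_derivative
      (- 1 / 2) * exp (- x / 2) * (1 - exp (- 4 * x) / 5) + exp (- x / 2) * ((4 / 5) * exp (- 4 * x))) (at x)"
    unfolding profile_def by (auto intro!: derivative_eq_intros)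
  also have "(- 1 / 2) * exp (- x / 2) * (1 - exp (- 4 * x) / 5) + exp (- x / 2) * ((4 / 5) * exp (- 4 * x))
    = profile x * (- 1 / 2 + (4 / 5) * exp (- 4 * x) / (1 - exp (- 4 * x) / 5))"
    using nz unfolding profile_def by (simp add: field_simps)
  finally show ?thesis .
qed

text \<open>As long as \<open>profile\<close> increases, the integrand of \<open>tau\<close>
  decreases, so the integral is at least the length times the value at the end. The logarithmic
  derivative of \<open>profile\<close> is nonnegative exactly while
  \<open>exp (- 4 t) >= 5 / 9\<close>, and \<open>23 / 20\<close> is chosen so that its fourth power
  stays below \<open>9 / 5\<close>.\<close>

lemma tau_ge_mult:
  assumes "0 \<le> x" "exp x \<le> 23 / 20" shows "x * (1 / (profile x)\<^sup>2) \<le> tau x"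
proof -
  have mono: "profile s \<le> profile x" if "0 \<le> s" "s \<le> x" for s
  proof (rule DERIV_nonneg_imp_nondecreasing[OF that(2)])
    fix t assume t: "s \<le> t" "t \<le> x"
    define q where "q = exp (- 4 * t)"
    have "exp (4 * t) \<le> (23 / 20) ^ 4"
    proof -
      have "exp (4 * t) = exp t ^ 4"
        using exp_of_nat_mult[of 4 t] by simp
      also have "\<dots> \<le> exp x ^ 4" using t by (intro power_mono) auto
      also have "\<dots> \<le> (23 / 20) ^ 4" using assms by (intro power_mono) auto
      finally show ?thesis .
    qed
    also have "\<dots> \<le> 9 / 5" by (simp add: power_divide)
    finally have "5 / 9 \<le> q" unfolding q_def by (simp add: exp_minus field_simps)
    moreover have "q \<le> 1" using t that unfolding q_def by simp
    ultimately have "0 \<le> - 1 / 2 + (4 / 5) * q / (1 - q / 5)" by (simp add: field_simps)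
    then have "0 \<le> profile t * (- 1 / 2 + (4 / 5) * exp (- 4 * t) / (1 - exp (- 4 * t) / 5))"
      using profile_pos[of t] t that unfolding q_def by (intro mult_nonneg_nonneg) auto
    then show "\<exists>y. (profile has_real_derivative y) (at t) \<and> 0 \<le> y"
      using DERIV_profile[of t] t that by (meson order_trans)
  qed
  have "((\<lambda>_. 1 / (profile x)\<^sup>2) has_integral (x * (1 / (profile x)\<^sup>2))) {0..x}"
    using has_integral_const_real[of "1 / (profile x)\<^sup>2" 0 x] assms by simp
  moreover have "((\<lambda>s. 1 / (profile s)\<^sup>2) has_integral tau x) {0..x}"
    unfolding tau_def by (intro integrable_integral integrable_continuous_interval continuous_on_inv_profile)
  moreover have "1 / (profile x)\<^sup>2 \<le> 1 / (profile s)\<^sup>2" if "s \<in> {0..x}" for s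
    using mono[of s] profile_pos[of s] that by (intro divide_left_mono power_mono) auto
  ultimately show ?thesis by (rule has_integral_le)
qed

text \<open>
  Near 0 the concavity of \<open>tau\<close> gives \<open>tau' / tau \<le> 1 / x\<close>, and the factor \<open>100\<close> makes the gain
  \<open>z^2 / sinh^2 z \<le> 1 / (1 + z^2 / 3)\<close> large enough to absorb the bounded terms. Away from 0 the first
  summand is at most three quarters of the right-hand side and the second is exponentially small.
\<close>
lemma tau_ineq:
  assumes x: "0 < x"
  shows "4 * exp (- 4 * x) / (1 - exp (- 4 * x) / 5) + (100 / (profile x)\<^sup>2)\<^sup>2 / (4 * (sinh (100 * tau x))\<^sup>2)
    \<le> 1 / (4 * (sinh x)\<^sup>2)"
proof (cases "exp x \<le> 23 / 20")
  case True
  define q where "q = exp (- 4 * x)"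
  define D where "D = 1 / (profile x)\<^sup>2"
  define z where "z = 100 * tau x"
  have xb: "x \<le> 3 / 20" using exp_ge_add_one_self[of x] True by linarith
  have q: "0 < q" "q \<le> 1" using x by (auto simp: q_def)
  have E: "4 * q / (1 - q / 5) \<le> 5" using q by (simp add: field_simps)
  have Dx: "x * D \<le> tau x" unfolding D_def using tau_ge_mult True x by simp
  have D1: "1 \<le> D" unfolding D_def using inv_profile_ge[of x] x one_le_exp_iff[of x] by linarith
  have zx: "100 * x \<le> z" using Dx D1 x mult_left_mono[of 1 D x] unfolding z_def by linarith
  have z0: "0 < z" using zx x by simp
  have "z + z ^ 3 / 6 \<le> sinh z" using sinh_ge_cubic z0 by simp
  then have "(z + z ^ 3 / 6)\<^sup>2 \<le> (sinh z)\<^sup>2" using z0 by (intro power_mono) auto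
  moreover have "z\<^sup>2 * (1 + z\<^sup>2 / 3) \<le> (z + z ^ 3 / 6)\<^sup>2"
    using z0 by (simp add: power2_eq_square power_numeral_reduce field_simps)
  ultimately have s: "z\<^sup>2 * (1 + z\<^sup>2 / 3) \<le> (sinh z)\<^sup>2" by simp
  have "(100 * D)\<^sup>2 / (4 * (sinh z)\<^sup>2) \<le> (z / x)\<^sup>2 / (4 * (z\<^sup>2 * (1 + z\<^sup>2 / 3)))"
  proof (rule frac_le)
    show "(100 * D)\<^sup>2 \<le> (z / x)\<^sup>2"
      using Dx x D1 unfolding z_def by (intro power_mono) (auto simp: field_simps)
    show "0 < 4 * (z\<^sup>2 * (1 + z\<^sup>2 / 3))" using z0 by (simp add: add_pos_nonneg)
  qed (use s in auto)
  also have "\<dots> = 1 / (4 * x\<^sup>2 * (1 + z\<^sup>2 / 3))"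
    using z0 x by (simp add: power_divide)
  also have "\<dots> \<le> 1 / (4 * x\<^sup>2 * (1 + (100 * x)\<^sup>2 / 3))"
  proof (intro divide_left_mono mult_left_mono add_left_mono divide_right_mono)
    show "(100 * x)\<^sup>2 \<le> z\<^sup>2" using zx x by (intro power_mono) auto
  qed (use x in \<open>auto simp: add_pos_nonneg\<close>)
  \<comment> \<open>The number 6 is 5 + 1: 5 bounds the first summand (fact \<open>E\<close>), and 1
    is the loss from \<open>x\<close> to \<open>sinh x\<close> in \<open>sinh_sq_le\<close>.\<close>
  also have "\<dots> \<le> 1 / (4 * x\<^sup>2) - 6"
  proof -
    define w where "w = x\<^sup>2"
    have w: "0 < w" "w \<le> 9 / 400"
      using x power_mono[OF xb, of 2] by (auto simp: w_def power_divide)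
    have "1 / (4 * w * (1 + 10000 * w / 3)) + 6 \<le> 1 / (4 * w)"
    proof -
      have "1 + 24 * w * (1 + 10000 * w / 3) \<le> 1 + 10000 * w / 3"
      proof -
        have "w * w \<le> 9 / 400 * w" using w by (intro mult_right_mono) auto
        then show ?thesis using w by (simp add: algebra_simps)
      qed
      moreover have "0 < 1 + 10000 * w / 3" using w by simp
      moreover define A where "A = 1 + 10000 * w / 3"
      ultimately have A: "1 + 24 * w * A \<le> A" "0 < A" by simp_all
      have "1 / (4 * w * A) + 6 = (1 + 24 * w * A) / (4 * w * A)"
        using w A by (simp add: field_simps)
      also have "\<dots> \<le> A / (4 * w * A)"
        using w A by (intro divide_right_mono) auto
      finally show ?thesis using w A unfolding A_def[symmetric] by simp
    qed
    then show ?thesis by (simp add: w_def power_mult_distrib)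
  qed
  finally have F: "(100 * D)\<^sup>2 / (4 * (sinh z)\<^sup>2) \<le> 1 / (4 * x\<^sup>2) - 6" .
  have "1 / (4 * x\<^sup>2) - 1 \<le> 1 / (4 * (sinh x)\<^sup>2)"
  proof -
    have "(sinh x)\<^sup>2 * (1 - 4 * x\<^sup>2) \<le> x\<^sup>2" using sinh_sq_le[of x] x xb by simp
    moreover have "0 < (sinh x)\<^sup>2" using x by simp
    ultimately show ?thesis using x by (simp add: field_simps)
  qed
  with E F show ?thesis unfolding q_def D_def z_def by simp
next
  case False
  define y where "y = exp (2 * x)"
  define p where "p = exp x - 1"
  have p: "3 / 20 < p" using False by (simp add: p_def)
  have y1: "1 < y" using x by (simp add: y_def)
  have ysq: "y\<^sup>2 = exp (4 * x)" by (simp add: y_def power2_eq_square flip: exp_add)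
  have q: "exp (- 4 * x) = 1 / y\<^sup>2" by (simp add: ysq exp_minus field_simps)
  have sh: "(sinh x)\<^sup>2 = (y - 1)\<^sup>2 / (4 * y)"
  proof -
    have "y = (exp x)\<^sup>2" by (simp add: y_def power2_eq_square flip: exp_add)
    then show ?thesis
      by (simp add: sinh_field_def exp_minus power2_eq_square field_simps)
  qed
  have y2: "1 < y\<^sup>2" using y1 by simp
  have "4 * exp (- 4 * x) / (1 - exp (- 4 * x) / 5) = 20 / (5 * y\<^sup>2 - 1)"
    using y2 y1 unfolding q by (simp add: field_simps)
  also have "\<dots> \<le> 3 * y / (4 * (y - 1)\<^sup>2)"
  proof -
    \<comment> \<open>This is the claim with the denominators cleared. Expanding about
      \<open>y = 1\<close> and completing the square in \<open>y - 1\<close> shows positivity for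
      all \<open>y > 1\<close>.\<close>
    have "0 \<le> 15 * y ^ 3 - 80 * y\<^sup>2 + 157 * y - 80"
    proof -
      have "15 * y ^ 3 - 80 * y\<^sup>2 + 157 * y - 80
          = (y - 1) * (15 * (y - 1 - 7 / 6)\<^sup>2 + 259 / 12) + 12"
        by (simp add: power2_eq_square power3_eq_cube field_simps)
      also have "\<dots> \<ge> 0"
        using y1 by (intro add_nonneg_nonneg mult_nonneg_nonneg) auto
      finally show ?thesis .
    qed
    then have "20 * (4 * (y - 1)\<^sup>2) \<le> 3 * y * (5 * y\<^sup>2 - 1)"
      by (simp add: power2_eq_square power3_eq_cube algebra_simps)
    moreover have "20 / A \<le> N / B" if "20 * B \<le> N * A" "0 < A" "0 < B" for A B N :: real
      using that by (simp add: field_simps)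
    moreover have "0 < 5 * y\<^sup>2 - 1" using y2 by linarith
    moreover have "0 < 4 * (y - 1)\<^sup>2" using y1 by simp
    ultimately show ?thesis by blast
  qed
  also have "\<dots> = (3 / 4) * (1 / (4 * (sinh x)\<^sup>2))"
    using y1 unfolding sh by (simp add: field_simps)
  finally have E: "4 * exp (- 4 * x) / (1 - exp (- 4 * x) / 5) \<le> (3 / 4) * (1 / (4 * (sinh x)\<^sup>2))" .
  have sx: "0 < sinh x" using x by simp
  \<comment> \<open>The factor 2 becomes 4 after squaring, so the second summand uses at most the
    quarter of the right-hand side that \<open>E\<close> has left over.\<close>
  have key: "2 * (100 / (profile x)\<^sup>2) * sinh x \<le> sinh (100 * tau x)"
  proof -
    have D: "1 / (profile x)\<^sup>2 \<le> (25 / 16) * exp x"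
    proof -
      have "(4 / 5)\<^sup>2 \<le> (1 - exp (- 4 * x) / 5)\<^sup>2"
        using one_minus_bounds[of x] x by (intro power_mono) auto
      moreover have "0 < (4 / 5 :: real)\<^sup>2" by simp
      ultimately have "exp x / (1 - exp (- 4 * x) / 5)\<^sup>2 \<le> exp x / (4 / 5)\<^sup>2"
        by (intro divide_left_mono mult_pos_pos) (auto simp del: zero_less_power2)
      then show ?thesis unfolding inv_profile_sq by (simp add: power_divide)
    qed
    have e: "2 * sinh x \<le> exp x" by (simp add: sinh_field_def)
    have "2 * (100 / (profile x)\<^sup>2) * sinh x = 100 * ((1 / (profile x)\<^sup>2) * (2 * sinh x))" by simp
    also have "\<dots> \<le> 100 * ((25 / 16) * exp x * exp x)"
      using D e sx by (intro mult_left_mono mult_mono) auto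
    also have "\<dots> = (625 / 4) * (1 + p)\<^sup>2" by (simp add: p_def power2_eq_square)
    \<comment> \<open>From \<open>p > 3 / 20\<close> one gets \<open>1 + p <= (23 / 3) p\<close>.
      The expression is then quadratic in \<open>p\<close> and is beaten by the cubic term of
      \<open>sinh (100 p)\<close>.\<close>
    also have "\<dots> \<le> (625 / 4) * (23 / 3 * p)\<^sup>2"
      using p by (intro mult_left_mono power_mono) auto
    also have "\<dots> \<le> 1000000 * p ^ 3 / 6"
    proof -
      have "p\<^sup>2 * (3 / 20) \<le> p\<^sup>2 * p" using p by (intro mult_left_mono) auto
      then have "p\<^sup>2 * (3 / 20) \<le> p ^ 3" by (simp add: power2_eq_square power3_eq_cube)
      moreover have "(625 / 4) * (23 / 3 * p)\<^sup>2 = (330625 / 36) * p\<^sup>2"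
        by (simp add: power_mult_distrib power_divide)
      moreover have "0 \<le> p\<^sup>2" by simp
      ultimately show ?thesis by linarith
    qed
    also have "\<dots> = (100 * p) ^ 3 / 6" by (simp add: power_mult_distrib)
    also have "\<dots> \<le> sinh (100 * p)" using sinh_ge_cubic[of "100 * p"] p by simp
    also have "\<dots> \<le> sinh (100 * tau x)" using tau_ge[of x] x by (simp add: p_def)
    finally show ?thesis .
  qed
  have "(2 * (100 / (profile x)\<^sup>2) * sinh x)\<^sup>2 \<le> (sinh (100 * tau x))\<^sup>2"
    using key sx profile_pos[of x] x by (intro power_mono) auto
  moreover have "0 < sinh (100 * tau x)" using tau_pos x by simp
  moreover have "A\<^sup>2 / (4 * Z\<^sup>2) \<le> (1 / 4) * (1 / (4 * B\<^sup>2))"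
    if "(2 * A * B)\<^sup>2 \<le> Z\<^sup>2" "0 < Z" "0 < B" for A B Z :: real
    using that by (simp add: field_simps power_mult_distrib)
  ultimately have "(100 / (profile x)\<^sup>2)\<^sup>2 / (4 * (sinh (100 * tau x))\<^sup>2) \<le> (1 / 4) * (1 / (4 * (sinh x)\<^sup>2))"
    using sx by blast
  with E show ?thesis by simp
qed

section \<open>The stretching, its amplitude, and the Riccati inequality\<close>

definition profile_ld :: "real \<Rightarrow> real"
  where "profile_ld x = - 1 / 2 + (4 / 5) * exp (- 4 * x) / (1 - exp (- 4 * x) / 5)"

text \<open>This is \<open>(f' / f)' = f'' / f - (f' / f)^2\<close>. As \<open>profile\<close>
  combines the exponentials with rates \<open>- 1 / 2\<close> and \<open>- 9 / 2\<close>, its second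
  derivative is \<open>1 / 4\<close> times itself minus a multiple of the second exponential, with
  factor \<open>(81 / 4 - 1 / 4) / 5 = 4\<close>.\<close>

lemma DERIV_profile_ld:
  assumes "0 \<le> x"
  shows "(profile_ld has_real_derivative 1 / 4 - 4 * exp (- 4 * x) / (1 - exp (- 4 * x) / 5) - (profile_ld x)\<^sup>2) (at x)"
proof -
  define q where "q = exp (- 4 * x)"
  have nz: "1 - exp (- 4 * x) / 5 \<noteq> 0" using one_minus_bounds(1)[OF assms] by linarith
  then have nz': "5 - q \<noteq> 0" by (simp add: q_def)
  have 1: "((\<lambda>x. (4 / 5) * exp (- 4 * x)) has_real_derivative - (16 / 5) * q) (at x)"
    unfolding q_def by (auto intro!: derivative_eq_intros)
  have 2: "((\<lambda>x. 1 - exp (- 4 * x) / 5) has_real_derivative 4 / 5 * q) (at x)"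
    unfolding q_def by (auto intro!: derivative_eq_intros)
  have "(profile_ld has_real_derivative (- (16 / 5) * q * (1 - q / 5) - (4 / 5) * q * (4 / 5 * q)) / ((1 - q / 5) * (1 - q / 5))) (at x)"
    unfolding profile_ld_def[abs_def]
    by (rule DERIV_cong, rule DERIV_add[OF DERIV_const DERIV_divide[OF 1 2 nz]]) (simp add: q_def)
  also have "(- (16 / 5) * q * (1 - q / 5) - (4 / 5) * q * (4 / 5 * q)) / ((1 - q / 5) * (1 - q / 5))
    = 1 / 4 - 4 * q / (1 - q / 5) - (- 1 / 2 + (4 / 5) * q / (1 - q / 5))\<^sup>2"
  proof -
    have "(1 - q / 5) = (5 - q) / 5" by simp
    then show ?thesis using nz'
      by (simp add: power2_eq_square divide_simps) (simp add: algebra_simps)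
  qed
  finally show ?thesis unfolding q_def profile_ld_def .
qed

text \<open>
  With \<open>a t = sinh t powr (- m / 2)\<close> and \<open>T = stretch m\<close>, the amplitude is \<open>a (T s) / (a s * sqrt (T' s))\<close> and
  the mass is its square times \<open>(a s)^2\<close>; \<open>amp_ld\<close> is the logarithmic derivative of the amplitude
  and \<open>dflux\<close> the derivative of \<open>mass * amp_ld\<close>.
\<close>
definition stretch :: "real \<Rightarrow> real \<Rightarrow> real"
  where "stretch m s = 100 * tau (m * s)"

definition dstretch :: "real \<Rightarrow> real \<Rightarrow> real"
  where "dstretch m s = 100 * m / (profile (m * s))\<^sup>2"

definition amp_ld :: "real \<Rightarrow> real \<Rightarrow> real"
  where "amp_ld m s = m / 2 * (cosh s / sinh s - dstretch m s * (cosh (stretch m s) / sinh (stretch m s))) + m * profile_ld (m * s)"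

definition amp :: "real \<Rightarrow> real \<Rightarrow> real"
  where "amp m s = (sinh s / sinh (stretch m s)) powr (m / 2) / sqrt (dstretch m s)"

definition mass :: "real \<Rightarrow> real \<Rightarrow> real"
  where "mass m s = sinh (stretch m s) powr (- m) / dstretch m s"

definition dflux :: "real \<Rightarrow> real \<Rightarrow> real"
  where "dflux m s = mass m s * (2 * amp_ld m s - m * (cosh s / sinh s)) * amp_ld m s
    + mass m s * (m / 2 * (- 1 / (sinh s)\<^sup>2 + 2 * (m * profile_ld (m * s)) * dstretch m s * (cosh (stretch m s) / sinh (stretch m s))
      + (dstretch m s)\<^sup>2 / (sinh (stretch m s))\<^sup>2)
      + m\<^sup>2 * (1 / 4 - 4 * exp (- 4 * (m * s)) / (1 - exp (- 4 * (m * s)) / 5) - (profile_ld (m * s))\<^sup>2))"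

context
  fixes m s :: real assumes m: "1 \<le> m" and s: "0 < s"
begin

lemma ms: "0 < m * s" using m s by simp

lemma stretch_pos: "0 < stretch m s" unfolding stretch_def using tau_pos[OF ms] by simp

lemma dstretch_pos: "0 < dstretch m s" unfolding dstretch_def using profile_pos[of "m * s"] ms m by simp

lemma dstretch_ge_1: "1 \<le> dstretch m s"
proof -
  have "1 \<le> exp (m * s)" using ms by simp
  also have "\<dots> \<le> 1 / (profile (m * s))\<^sup>2" using inv_profile_ge ms by simp
  finally have "1 * 1 \<le> (100 * m) * (1 / (profile (m * s))\<^sup>2)" using m by (intro mult_mono) auto
  then show ?thesis by (simp add: dstretch_def)
qed

lemma dstretch_le: "dstretch m s \<le> m * (stretch m s + 200)"
  using inv_profile_le[of "m * s"] ms m mult_left_mono[of "1 / (profile (m * s))\<^sup>2" "tau (m * s) + 2" "100 * m"]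
  by (simp add: dstretch_def stretch_def algebra_simps)

lemma DERIV_stretch: "(stretch m has_real_derivative dstretch m s) (at s)"
proof -
  have "(tau has_real_derivative 1 / (profile (m * s))\<^sup>2) (at (m * s))" by (rule DERIV_tau[OF ms])
  then have "((\<lambda>s. tau (m * s)) has_real_derivative 1 / (profile (m * s))\<^sup>2 * m) (at s)"
    by (rule DERIV_chain2) (auto intro!: derivative_eq_intros)
  from DERIV_cmult[OF this, of 100] show ?thesis
    by (simp add: stretch_def[abs_def] dstretch_def mult_ac)
qed

lemma DERIV_dstretch: "(dstretch m has_real_derivative - 2 * (m * profile_ld (m * s)) * dstretch m s) (at s)"
proof -
  have "(profile has_real_derivative profile (m * s) * profile_ld (m * s)) (at (m * s))"
    using DERIV_profile[of "m * s"] ms unfolding profile_ld_def by simp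
  then have l: "((\<lambda>s. profile (m * s)) has_real_derivative profile (m * s) * profile_ld (m * s) * m) (at s)"
    by (rule DERIV_chain2) (auto intro!: derivative_eq_intros)
  have nz: "(profile (m * s))\<^sup>2 \<noteq> 0" using profile_pos[of "m * s"] ms by simp
  have l2: "((\<lambda>s. (profile (m * s))\<^sup>2) has_real_derivative 2 * m * profile_ld (m * s) * (profile (m * s))\<^sup>2) (at s)"
    by (rule DERIV_cong, rule DERIV_power[OF l]) (simp add: power2_eq_square)
  show ?thesis
    unfolding dstretch_def[abs_def]
    by (rule DERIV_cong, rule DERIV_divide[OF DERIV_const l2 nz]) (use nz in \<open>simp add: field_simps\<close>)
qed

lemma sinh_nz: "0 < sinh s" "0 < sinh (stretch m s)" using s stretch_pos by auto

lemma DERIV_coth: "((\<lambda>s. cosh s / sinh s) has_real_derivative - 1 / (sinh s)\<^sup>2) (at s)"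
proof -
  have "((\<lambda>s. cosh s / sinh s) has_real_derivative (sinh s * sinh s - cosh s * cosh s) / (sinh s * sinh s)) (at s)"
    using sinh_nz by (auto intro!: derivative_eq_intros)
  then show ?thesis using cosh_square_eq[of s] by (simp add: power2_eq_square)
qed

lemma DERIV_amp: "(amp m has_real_derivative amp_ld m s * amp m s) (at s)"
proof -
  define r where "r = (\<lambda>s. sinh s / sinh (stretch m s))"
  have r: "(r has_real_derivative r s * (cosh s / sinh s - dstretch m s * (cosh (stretch m s) / sinh (stretch m s)))) (at s)"
  proof -
    have "sinh (stretch m s) \<noteq> 0" using sinh_nz by simp
    moreover have "(sinh has_real_derivative cosh s) (at s)"
      by (auto intro!: derivative_eq_intros)
    moreover have "((\<lambda>s. sinh (stretch m s)) has_real_derivative cosh (stretch m s) * dstretch m s) (at s)"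
      by (rule DERIV_chain2[OF _ DERIV_stretch]) (auto intro!: derivative_eq_intros)
    ultimately have "(r has_real_derivative (cosh s * sinh (stretch m s) - sinh s * (cosh (stretch m s) * dstretch m s)) /
        (sinh (stretch m s) * sinh (stretch m s))) (at s)"
      unfolding r_def by (intro DERIV_divide)
    then show ?thesis
      by (rule DERIV_cong) (use sinh_nz in \<open>simp add: r_def diff_divide_distrib right_diff_distrib\<close>)
  qed
  have rp: "0 < r s" using sinh_nz by (simp add: r_def)
  have p: "((\<lambda>s. r s powr (m / 2)) has_real_derivative
      r s powr (m / 2) * (m / 2 * (cosh s / sinh s - dstretch m s * (cosh (stretch m s) / sinh (stretch m s))))) (at s)"
  proof -
    have "((\<lambda>s. r s powr (m / 2)) has_real_derivative
      m / 2 * r s powr (m / 2 - 1) * (r s * (cosh s / sinh s - dstretch m s * (cosh (stretch m s) / sinh (stretch m s))))) (at s)"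
      using rp by (auto intro!: derivative_eq_intros r)
    moreover have "r s powr (m / 2 - 1) * r s = r s powr (m / 2)"
      using rp by (simp add: powr_diff)
    then have "m / 2 * r s powr (m / 2 - 1) * (r s * w) = r s powr (m / 2) * (m / 2 * w)" for w
      by (metis (no_types, opaque_lifting) mult.assoc mult.commute)
    ultimately show ?thesis by metis
  qed
  have "((\<lambda>s. r s powr (m / 2) / sqrt (dstretch m s)) has_real_derivative
     amp_ld m s * (r s powr (m / 2) / sqrt (dstretch m s))) (at s)"
  proof -
    have q: "((\<lambda>s. sqrt (dstretch m s)) has_real_derivative - (m * profile_ld (m * s)) * sqrt (dstretch m s)) (at s)"
    proof -
      have "((\<lambda>s. sqrt (dstretch m s)) has_real_derivative (inverse (sqrt (dstretch m s)) / 2) * (- 2 * (m * profile_ld (m * s)) * dstretch m s)) (at s)"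
        by (rule DERIV_chain2[OF DERIV_real_sqrt[OF dstretch_pos] DERIV_dstretch])
      moreover have "inverse (sqrt (dstretch m s)) * dstretch m s = sqrt (dstretch m s)"
        using dstretch_pos by (simp add: field_simps)
      then have "inverse (sqrt (dstretch m s)) / 2 * (- 2 * w * dstretch m s) = - w * sqrt (dstretch m s)" for w
        by simp
      ultimately show ?thesis by metis
    qed
    have "sqrt (dstretch m s) \<noteq> 0" using dstretch_pos by simp
    moreover have "(P * A * Q - P * (- B * Q)) / (Q * Q) = (A + B) * (P / Q)" if "Q \<noteq> 0" for P Q A B :: real
      using that by (simp add: field_simps)
    ultimately show ?thesis
      unfolding amp_ld_def by (intro DERIV_cong[OF DERIV_divide[OF p q]])
  qed
  then show ?thesis by (simp add: amp_def[abs_def] r_def)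
qed

lemma mass_pos: "0 < mass m s" using dstretch_pos sinh_nz by (simp add: mass_def)

lemma amp_pos: "0 < amp m s" using dstretch_pos sinh_nz by (simp add: amp_def)

lemma DERIV_mass: "(mass m has_real_derivative mass m s * (2 * amp_ld m s - m * (cosh s / sinh s))) (at s)"
proof -
  have sh: "((\<lambda>s. sinh (stretch m s)) has_real_derivative cosh (stretch m s) * dstretch m s) (at s)"
    by (rule DERIV_chain2[OF _ DERIV_stretch]) (auto intro!: derivative_eq_intros)
  have p: "((\<lambda>s. sinh (stretch m s) powr (- m)) has_real_derivative
      sinh (stretch m s) powr (- m) * (- m * (dstretch m s * (cosh (stretch m s) / sinh (stretch m s))))) (at s)"
  proof -
    have "((\<lambda>s. sinh (stretch m s) powr (- m)) has_real_derivative
      (- m) * sinh (stretch m s) powr (- m - 1) * (cosh (stretch m s) * dstretch m s)) (at s)"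
      by (rule DERIV_chain2[OF has_real_derivative_powr[OF sinh_nz(2)] sh])
    moreover have "sinh (stretch m s) powr (- m - 1) = sinh (stretch m s) powr (- m) / sinh (stretch m s)"
      using sinh_nz by (simp add: powr_diff)
    ultimately show ?thesis by (simp add: mult_ac)
  qed
  have "dstretch m s \<noteq> 0" using dstretch_pos by simp
  moreover have "(P * (- m * B) * Q - P * (- 2 * A * Q)) / (Q * Q) =
      P / Q * (2 * (m / 2 * (C - B) + A) - m * C)" if "Q \<noteq> 0" for P Q A B C :: real
    using that by (simp add: field_simps)
  ultimately show ?thesis
    unfolding mass_def[abs_def] amp_ld_def by (intro DERIV_cong[OF DERIV_divide[OF p DERIV_dstretch]])
qed

lemma DERIV_flux: "((\<lambda>s. mass m s * amp_ld m s) has_real_derivative dflux m s) (at s)"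
proof -
  have cT: "((\<lambda>s. cosh (stretch m s) / sinh (stretch m s)) has_real_derivative - 1 / (sinh (stretch m s))\<^sup>2 * dstretch m s) (at s)"
  proof -
    have "((\<lambda>s. cosh s / sinh s) has_real_derivative - 1 / (sinh (stretch m s))\<^sup>2) (at (stretch m s))"
    proof -
      have "((\<lambda>s. cosh s / sinh s) has_real_derivative
         (sinh (stretch m s) * sinh (stretch m s) - cosh (stretch m s) * cosh (stretch m s)) / (sinh (stretch m s) * sinh (stretch m s))) (at (stretch m s))"
        using sinh_nz by (auto intro!: derivative_eq_intros)
      then show ?thesis using cosh_square_eq[of "stretch m s"] by (simp add: power2_eq_square)
    qed
    then show ?thesis by (rule DERIV_chain2[OF _ DERIV_stretch])
  qed
  have l: "((\<lambda>s. profile_ld (m * s)) has_real_derivative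
    (1 / 4 - 4 * exp (- 4 * (m * s)) / (1 - exp (- 4 * (m * s)) / 5) - (profile_ld (m * s))\<^sup>2) * m) (at s)"
    using DERIV_profile_ld[of "m * s"] ms
    by (intro DERIV_chain2[where f = profile_ld]) (auto intro!: derivative_eq_intros)
  have k: "(amp_ld m has_real_derivative (m / 2 * (- 1 / (sinh s)\<^sup>2 + 2 * (m * profile_ld (m * s)) * dstretch m s * (cosh (stretch m s) / sinh (stretch m s))
      + (dstretch m s)\<^sup>2 / (sinh (stretch m s))\<^sup>2)
      + m\<^sup>2 * (1 / 4 - 4 * exp (- 4 * (m * s)) / (1 - exp (- 4 * (m * s)) / 5) - (profile_ld (m * s))\<^sup>2))) (at s)"
    unfolding amp_ld_def[abs_def]
    by (rule DERIV_cong, rule DERIV_add[OF DERIV_cmult[OF DERIV_diff[OF DERIV_coth DERIV_mult[OF DERIV_dstretch cT]]] DERIV_cmult[OF l]])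
      (simp add: power2_eq_square algebra_simps)
  show ?thesis
    by (rule DERIV_cong, rule DERIV_mult[OF DERIV_mass k]) (simp add: dflux_def algebra_simps)
qed

text \<open>This is equivalent to \<open>{T, s} / 2 + m^2 / 4 + T'^2 / (4 sinh^2 T) \<le> 1 / (4 sinh^2 s)\<close>,
  which follows from \<open>tau_ineq\<close> at \<open>m s\<close> because \<open>m sinh s \<le> sinh (m s)\<close>.\<close>
lemma riccati_ineq:
  "mass m s * (amp_ld m s)\<^sup>2 - dflux m s - ((m + 1) / 2)\<^sup>2 * mass m s / (sinh s)\<^sup>2
    \<le> - (mass m s * (dstretch m s)\<^sup>2 * (((m + 1) / 2)\<^sup>2 / (sinh (stretch m s))\<^sup>2 + (m / 2)\<^sup>2))"
proof -
  define c d D \<phi> E where "c = cosh s / sinh s" and "d = cosh (stretch m s) / sinh (stretch m s)"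
    and "D = dstretch m s" and "\<phi> = m * profile_ld (m * s)"
    and "E = 4 * exp (- 4 * (m * s)) / (1 - exp (- 4 * (m * s)) / 5)"
  have c: "1 / (sinh s)\<^sup>2 = c\<^sup>2 - 1"
    using sinh_nz cosh_square_eq[of s] by (simp add: c_def power_divide field_simps)
  have d: "1 / (sinh (stretch m s))\<^sup>2 = d\<^sup>2 - 1"
    using sinh_nz cosh_square_eq[of "stretch m s"] by (simp add: d_def power_divide field_simps)
  \<comment> \<open>Here \<open>m^2 * E\<close> is the term \<open>{T, s} / 2 + m^2 / 4\<close>,
    because \<open>f'' / f = m^2 (1 / 4 - E)\<close> for \<open>f s = profile (m s)\<close>.\<close>
  have key: "m\<^sup>2 * E + D\<^sup>2 * (d\<^sup>2 - 1) / 4 \<le> (c\<^sup>2 - 1) / 4"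
  proof -
    have "E + (100 / (profile (m * s))\<^sup>2)\<^sup>2 / (4 * (sinh (stretch m s))\<^sup>2) \<le> 1 / (4 * (sinh (m * s))\<^sup>2)"
      using tau_ineq[OF ms] by (simp add: E_def stretch_def)
    then have "m\<^sup>2 * (E + (100 / (profile (m * s))\<^sup>2)\<^sup>2 / (4 * (sinh (stretch m s))\<^sup>2)) \<le> m\<^sup>2 * (1 / (4 * (sinh (m * s))\<^sup>2))"
      by (intro mult_left_mono) auto
    moreover have "m\<^sup>2 * (100 / (profile (m * s))\<^sup>2)\<^sup>2 = D\<^sup>2"
      by (simp add: D_def dstretch_def power_mult_distrib power_divide)
    then have "m\<^sup>2 * (E + (100 / (profile (m * s))\<^sup>2)\<^sup>2 / (4 * (sinh (stretch m s))\<^sup>2)) = m\<^sup>2 * E + D\<^sup>2 * (d\<^sup>2 - 1) / 4"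
      unfolding d[symmetric] by (simp add: distrib_left)
    moreover have "m\<^sup>2 * (1 / (4 * (sinh (m * s))\<^sup>2)) \<le> 1 / (4 * (sinh s)\<^sup>2)"
    proof -
      have "(m * sinh s)\<^sup>2 \<le> (sinh (m * s))\<^sup>2"
        using mult_sinh_le[of m s] m s by (intro power_mono) auto
      then have "m\<^sup>2 * (4 * (sinh s)\<^sup>2) \<le> 4 * (sinh (m * s))\<^sup>2"
        by (simp add: power_mult_distrib)
      moreover have "m\<^sup>2 * (1 / A) \<le> 1 / B" if "m\<^sup>2 * B \<le> A" "0 < A" "0 < B" for A B
        using that by (simp add: field_simps)
      ultimately show ?thesis using ms sinh_nz by (metis mult_pos_pos sinh_real_pos_iff zero_less_numeral zero_less_power)
    qed
    ultimately show ?thesis using c by simp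
  qed
  have amp_ld: "amp_ld m s = m / 2 * (c - D * d) + \<phi>" by (simp add: amp_ld_def c_def D_def d_def \<phi>_def)
  have k': "(m / 2 * (- 1 / (sinh s)\<^sup>2 + 2 * (m * profile_ld (m * s)) * dstretch m s * (cosh (stretch m s) / sinh (stretch m s))
      + (dstretch m s)\<^sup>2 / (sinh (stretch m s))\<^sup>2)
      + m\<^sup>2 * (1 / 4 - 4 * exp (- 4 * (m * s)) / (1 - exp (- 4 * (m * s)) / 5) - (profile_ld (m * s))\<^sup>2))
    = m / 2 * (- (c\<^sup>2 - 1) + 2 * \<phi> * D * d + D\<^sup>2 * (d\<^sup>2 - 1)) + (m\<^sup>2 / 4 - m\<^sup>2 * E - \<phi>\<^sup>2)"
    unfolding c[symmetric] d[symmetric]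
    by (simp add: c_def D_def d_def \<phi>_def E_def power_mult_distrib algebra_simps)
  have "mass m s * (amp_ld m s)\<^sup>2 - dflux m s - ((m + 1) / 2)\<^sup>2 * mass m s / (sinh s)\<^sup>2
    + mass m s * (dstretch m s)\<^sup>2 * (((m + 1) / 2)\<^sup>2 / (sinh (stretch m s))\<^sup>2 + (m / 2)\<^sup>2)
    = mass m s * ((amp_ld m s)\<^sup>2 - (2 * amp_ld m s - m * c) * amp_ld m s
      - (m / 2 * (- (c\<^sup>2 - 1) + 2 * \<phi> * D * d + D\<^sup>2 * (d\<^sup>2 - 1)) + (m\<^sup>2 / 4 - m\<^sup>2 * E - \<phi>\<^sup>2))
      - ((m + 1) / 2)\<^sup>2 * (c\<^sup>2 - 1) + D\<^sup>2 * (((m + 1) / 2)\<^sup>2 * (d\<^sup>2 - 1) + (m / 2)\<^sup>2))"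
  proof -
    have "w / (sinh s)\<^sup>2 = w * (c\<^sup>2 - 1)" "w / (sinh (stretch m s))\<^sup>2 = w * (d\<^sup>2 - 1)" for w
      using arg_cong[OF c, of "times w"] arg_cong[OF d, of "times w"] by simp_all
    moreover have "H * k\<^sup>2 - (H * (2 * k - m * c) * k + H * P) - M * H * C + H * B * (M * A + N)
      = H * (k\<^sup>2 - (2 * k - m * c) * k - P - M * C + B * (M * A + N))" for H k P M C B A N
      by (simp add: algebra_simps)
    ultimately show ?thesis
      unfolding dflux_def k' unfolding c_def[symmetric] D_def[symmetric] by simp
  qed
  \<comment> \<open>All terms containing \<open>\<phi>\<close> cancel, and so does the constant
    \<open>m^2 / 4\<close> with and without \<open>D^2\<close>. The coefficients left on
    \<open>c^2 - 1\<close> and \<open>D^2 * (d^2 - 1)\<close> are \<open>- 1 / 4\<close> and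
    \<open>1 / 4\<close>, since \<open>((m + 1) / 2)^2 - m^2 / 4 - m / 2 = 1 / 4\<close>; this is
    how the Poincare constant produces the critical potential.\<close>
  also have "\<dots> = mass m s * (m\<^sup>2 * E + D\<^sup>2 * (d\<^sup>2 - 1) / 4 - (c\<^sup>2 - 1) / 4)"
    unfolding amp_ld by (simp add: power2_eq_square field_simps)
  also have "\<dots> \<le> 0" using key mass_pos by (intro mult_nonneg_nonpos) auto
  finally show ?thesis by simp
qed

end

lemma stretch_strict_mono: assumes "1 \<le> m" "0 < s" "s < t" shows "stretch m s < stretch m t"
  unfolding stretch_def using assms by (auto intro!: tau_strict_mono)

text \<open>Since \<open>stretch m t >= t\<close>, a preimage of \<open>t\<close> is found in
  \<open>{0..t}\<close> by the intermediate value theorem.\<close>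

lemma stretch_surj: assumes m: "1 \<le> m" and t: "0 < t" obtains s where "0 < s" "stretch m s = t"
proof -
  have "t \<le> stretch m t"
  proof -
    have "t \<le> m * t" using mult_right_mono[of 1 m t] m t by simp
    also have "\<dots> \<le> exp (m * t) - 1" using exp_ge_add_one_self[of "m * t"] by linarith
    also have "\<dots> \<le> tau (m * t)" using tau_ge[of "m * t"] m t by simp
    finally show ?thesis using t by (simp add: stretch_def)
  qed
  moreover have "continuous_on {0..t} (stretch m)"
    unfolding stretch_def
    by (intro continuous_intros continuous_on_compose2[OF continuous_on_tau[of "m * t"]])
      (use m in auto)
  moreover have "stretch m 0 = 0" by (simp add: stretch_def)
  ultimately obtain s where "0 \<le> s" "s \<le> t" "stretch m s = t"
    using IVT'[of "stretch m" 0 t t] t by auto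
  moreover have "s \<noteq> 0" using calculation t \<open>stretch m 0 = 0\<close> by auto
  ultimately have "0 < s" "stretch m s = t" by simp_all
  then show ?thesis by (rule that)
qed

section \<open>Smooth functions and the cut-off profile\<close>

text \<open>A form of \<open>C_k\<close> relative to a set, meant for open sets: the transplanted
  functions are known to be smooth only on the punctured ball and become globally smooth by gluing
  with zero. Derivatives are taken at \<open>x\<close> in the full space, so restriction and union
  of domains are immediate.\<close>

primrec Ck_on :: "nat \<Rightarrow> (real ^ 'n) set \<Rightarrow> (real ^ 'n \<Rightarrow> real) \<Rightarrow> bool"
  where
    "Ck_on 0 U f \<longleftrightarrow> continuous_on U f"
  | "Ck_on (Suc k) U f \<longleftrightarrow> (\<forall>x\<in>U. f differentiable (at x)) \<and> (\<forall>i. Ck_on k U (partial f i))"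

definition egrad :: "(real ^ 'n \<Rightarrow> real) \<Rightarrow> real ^ 'n \<Rightarrow> real ^ 'n"
  where "egrad f x = (\<chi> i. partial f i x)"

lemma C_k_iff: "C_k k f \<longleftrightarrow> Ck_on k UNIV f"
  by (induction k arbitrary: f) auto

lemma egrad_nth [simp]: "egrad f x $ i = partial f i x"
  by (simp add: egrad_def)

lemma has_derivative_egrad:
  fixes f :: "real ^ 'n \<Rightarrow> real"
  assumes "f differentiable (at x)"
  shows "(f has_derivative (\<lambda>h. egrad f x \<bullet> h)) (at x)"
proof -
  have lin: "linear (frechet_derivative f (at x))"
    using assms by (rule linear_frechet_derivative)
  have "frechet_derivative f (at x) h = egrad f x \<bullet> h" for h
  proof -
    have "frechet_derivative f (at x) h
        = frechet_derivative f (at x) (\<Sum>i\<in>UNIV. (h $ i) *\<^sub>R axis i 1)"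
      using basis_expansion[of h] by (simp add: scalar_mult_eq_scaleR)
    also have "\<dots> = (\<Sum>i\<in>UNIV. (h $ i) * partial f i x)"
      using lin by (simp add: linear_sum linear_cmul partial_def)
    also have "\<dots> = egrad f x \<bullet> h"
      by (simp add: inner_vec_def mult.commute)
    finally show ?thesis .
  qed
  then have "frechet_derivative f (at x) = (\<lambda>h. egrad f x \<bullet> h)" by blast
  then show ?thesis using assms by (simp add: frechet_derivative_works)
qed

lemma partial_eq:
  assumes "(f has_derivative D) (at x)" shows "partial f i x = D (axis i 1)"
  using frechet_derivative_at[OF assms] by (simp add: partial_def)

lemma egrad_eq:
  assumes "(f has_derivative (\<lambda>h. g \<bullet> h)) (at x)" shows "egrad f x = g"
  by (simp add: vec_eq_iff partial_eq[OF assms] inner_axis)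

lemma Ck_on_cong_imp:
  assumes "open U" "\<And>x. x \<in> U \<Longrightarrow> f x = g x" "Ck_on k U f" shows "Ck_on k U g"
  using assms(2,3)
proof (induction k arbitrary: f g)
  case 0
  then show ?case by (simp cong: continuous_on_cong)
next
  case (Suc k)
  have d: "(g has_derivative (\<lambda>h. egrad f x \<bullet> h)) (at x)" if "x \<in> U" for x
  proof (rule has_derivative_transform_within_open[OF _ assms(1) that])
    show "(f has_derivative (\<lambda>h. egrad f x \<bullet> h)) (at x)"
      using Suc.prems that by (intro has_derivative_egrad) auto
  qed (use Suc.prems in blast)
  then have "partial f i x = partial g i x" if "x \<in> U" for x i
    using egrad_eq[OF d[OF that]] egrad_nth by metis
  then have "Ck_on k U (partial g i)" for i
    using Suc.IH[of "partial f i" "partial g i"] Suc.prems by simp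
  then show ?case using d by (auto simp: differentiable_def)
qed

lemma Ck_onI:
  assumes "open U" "\<And>x. x \<in> U \<Longrightarrow> (f has_derivative (\<lambda>h. g x \<bullet> h)) (at x)"
    "\<And>i. Ck_on k U (\<lambda>x. g x $ i)"
  shows "Ck_on (Suc k) U f"
proof -
  have "partial f i x = g x $ i" if "x \<in> U" for x i
    using egrad_eq[OF assms(2)[OF that]] egrad_nth by metis
  then have "Ck_on k U (partial f i)" for i
    using Ck_on_cong_imp[OF assms(1) _ assms(3)[of i], of "partial f i"] by simp
  then show ?thesis using assms(2) by (auto simp: differentiable_def)
qed

lemma Ck_on_Suc_D:
  assumes "Ck_on (Suc k) U f" shows "Ck_on k U f"
  using assms
proof (induction k arbitrary: f)
  case 0
  then show ?case
    by (auto intro!: continuous_at_imp_continuous_on differentiable_imp_continuous_within)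
next
  case (Suc k)
  then show ?case by (metis Ck_on.simps(2))
qed

lemma Ck_on_le: assumes "Ck_on k U f" "j \<le> k" shows "Ck_on j U f"
  using assms(2,1) by (induction k rule: dec_induct) (auto dest: Ck_on_Suc_D simp del: Ck_on.simps)

lemma Ck_on_subset: assumes "Ck_on k U f" "V \<subseteq> U" shows "Ck_on k V f"
  using assms by (induction k arbitrary: f) (auto intro: continuous_on_subset)

lemma Ck_on_Un:
  assumes "open U" "open V" "Ck_on k U f" "Ck_on k V f" shows "Ck_on k (U \<union> V) f"
  using assms by (induction k arbitrary: f) (auto intro: continuous_on_open_Un)

lemma Ck_on_const: "open U \<Longrightarrow> Ck_on k U (\<lambda>x. c)"
proof (induction k arbitrary: c)
  case (Suc k)
  then show ?case by (intro Ck_onI[where g = "\<lambda>_. 0"]) auto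
qed simp

lemma Ck_on_nth: fixes U :: "(real ^ 'n) set" assumes "open U" shows "Ck_on k U (\<lambda>x. x $ i)"
proof (cases k)
  case (Suc k)
  have "((\<lambda>x. x $ i) has_derivative (\<lambda>h. axis i 1 \<bullet> h)) (at x)" for x :: "real ^ 'n"
    by (rule has_derivative_eq_rhs[OF bounded_linear_imp_has_derivative[OF bounded_linear_vec_nth]])
      (simp add: inner_axis')
  then show ?thesis unfolding Suc
    by (intro Ck_onI[where g = "\<lambda>_. axis i 1"] Ck_on_const assms) auto
qed (auto intro!: continuous_intros)

lemma Ck_on_add:
  assumes "open U" "Ck_on k U f" "Ck_on k U g" shows "Ck_on k U (\<lambda>x. f x + g x)"
  using assms(2,3)
proof (induction k arbitrary: f g)
  case (Suc k)
  then show ?case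
    by (intro Ck_onI[where g = "\<lambda>x. egrad f x + egrad g x"] assms)
      (auto simp: inner_add_left intro!: has_derivative_add has_derivative_egrad)
qed (auto intro: continuous_intros)

lemma Ck_on_mult:
  assumes "open U" "Ck_on k U f" "Ck_on k U g" shows "Ck_on k U (\<lambda>x. f x * g x)"
  using assms(2,3)
proof (induction k arbitrary: f g)
  case (Suc k)
  note D = Suc.prems[THEN Ck_on_Suc_D]
  show ?case
  proof (intro Ck_onI[where g = "\<lambda>x. f x *\<^sub>R egrad g x + g x *\<^sub>R egrad f x"] assms)
    fix x assume "x \<in> U"
    then have "((\<lambda>x. f x * g x) has_derivative (\<lambda>h. f x * (egrad g x \<bullet> h) + (egrad f x \<bullet> h) * g x)) (at x)"
      using Suc.prems by (intro has_derivative_mult has_derivative_egrad) auto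
    then show "((\<lambda>x. f x * g x) has_derivative (\<lambda>h. (f x *\<^sub>R egrad g x + g x *\<^sub>R egrad f x) \<bullet> h)) (at x)"
      by (simp add: inner_add_left mult.commute)
  next
    fix i
    have "Ck_on k U (\<lambda>x. f x * partial g i x + g x * partial f i x)"
      using Suc.prems D by (intro Ck_on_add Suc.IH assms) auto
    then show "Ck_on k U (\<lambda>x. (f x *\<^sub>R egrad g x + g x *\<^sub>R egrad f x) $ i)" by simp
  qed
qed (auto intro: continuous_intros)

lemma Ck_on_minus:
  assumes "open U" "Ck_on k U f" shows "Ck_on k U (\<lambda>x. - f x)"
  using Ck_on_mult[OF assms(1) Ck_on_const[OF assms(1), of k "-1"] assms(2)] by simp

lemma Ck_on_diff:
  assumes "open U" "Ck_on k U f" "Ck_on k U g" shows "Ck_on k U (\<lambda>x. f x - g x)"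
  using Ck_on_add[OF assms(1,2) Ck_on_minus[OF assms(1,3)]] by simp

lemma Ck_on_sum:
  assumes "open U" "finite I" "\<And>i. i \<in> I \<Longrightarrow> Ck_on k U (f i)" shows "Ck_on k U (\<lambda>x. \<Sum>i\<in>I. f i x)"
  using assms(2,3) by (induction I rule: finite_induct) (auto intro!: Ck_on_const Ck_on_add assms(1))

text \<open>Smoothness of the derivative is required to one order less. Functions whose derivatives
  stay in the same family (\<open>exp\<close>, \<open>inverse\<close>, \<open>flat\<close>) are
  therefore treated by induction on the order, while \<open>ln\<close> and \<open>stretch\<close>
  reduce to the known smoothness of their derivatives. Differentiability is asked only at values of
  \<open>f\<close>, which admits functions singular elsewhere.\<close>

lemma Ck_on_chain:
  assumes U: "open U" and f: "Ck_on k U f"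
    and d: "\<And>x. x \<in> U \<Longrightarrow> (\<phi> has_real_derivative \<phi>' (f x)) (at (f x))"
    and \<phi>': "\<And>j. k = Suc j \<Longrightarrow> Ck_on j U (\<lambda>x. \<phi>' (f x))"
  shows "Ck_on k U (\<lambda>x. \<phi> (f x))"
proof (cases k)
  case 0
  have "isCont (\<lambda>x. \<phi> (f x)) x" if "x \<in> U" for x
  proof (rule isCont_o2[where f = f and g = \<phi>])
    show "isCont f x" using f that U unfolding 0 by (simp add: continuous_on_eq_continuous_at)
    show "isCont \<phi> (f x)" using d[OF that] by (rule DERIV_isCont)
  qed
  then show ?thesis using U unfolding 0 by (simp add: continuous_on_eq_continuous_at)
next
  case (Suc j)
  note fS = f[unfolded Suc]
  show ?thesis unfolding Suc
  proof (intro Ck_onI[where g = "\<lambda>x. \<phi>' (f x) *\<^sub>R egrad f x"] U)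
    fix x assume x: "x \<in> U"
    have "((\<lambda>x. \<phi> (f x)) has_derivative (\<lambda>h. (egrad f x \<bullet> h) * \<phi>' (f x))) (at x)"
      using fS x by (intro DERIV_compose_FDERIV[where g = f, OF d[OF x]] has_derivative_egrad) simp
    then show "((\<lambda>x. \<phi> (f x)) has_derivative (\<lambda>h. (\<phi>' (f x) *\<^sub>R egrad f x) \<bullet> h)) (at x)"
      by (simp add: mult.commute)
  next
    fix i
    have "Ck_on j U (\<lambda>x. \<phi>' (f x) * partial f i x)"
      using fS by (intro Ck_on_mult U \<phi>'[OF Suc]) auto
    then show "Ck_on j U (\<lambda>x. (\<phi>' (f x) *\<^sub>R egrad f x) $ i)" by simp
  qed
qed

lemma Ck_on_exp:
  assumes "open U" "Ck_on k U f" shows "Ck_on k U (\<lambda>x. exp (f x))"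
  using assms(2)
proof (induction k)
  case 0
  then show ?case by (auto intro: continuous_intros)
next
  case (Suc k)
  show ?case
  proof (rule Ck_on_chain[where \<phi> = exp and f = f and \<phi>' = exp, OF assms(1) Suc.prems DERIV_exp])
    fix j assume "Suc k = Suc j"
    then show "Ck_on j U (\<lambda>x. exp (f x))" using Suc.IH[OF Ck_on_Suc_D[OF Suc.prems]] by simp
  qed
qed

lemma Ck_on_inverse:
  assumes "open U" "Ck_on k U f" "\<And>x. x \<in> U \<Longrightarrow> f x \<noteq> 0" shows "Ck_on k U (\<lambda>x. inverse (f x))"
  using assms(2)
proof (induction k)
  case 0
  then show ?case using assms(3) by (auto intro: continuous_intros)
next
  case (Suc k)
  show ?case
  proof (rule Ck_on_chain[where \<phi> = inverse and f = f and \<phi>' = "\<lambda>t. - (inverse t * inverse t)"])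
    show "(inverse has_real_derivative - (inverse (f x) * inverse (f x))) (at (f x))" if "x \<in> U" for x
      using DERIV_inverse[OF assms(3)[OF that]] by (simp add: power2_eq_square)
  next
    fix j assume "Suc k = Suc j"
    then show "Ck_on j U (\<lambda>x. - (inverse (f x) * inverse (f x)))"
      using Ck_on_Suc_D[OF Suc.prems] Suc.IH by (intro Ck_on_minus Ck_on_mult assms) auto
  qed (use assms Suc in auto)
qed

lemma Ck_on_divide:
  assumes "open U" "Ck_on k U f" "Ck_on k U g" "\<And>x. x \<in> U \<Longrightarrow> g x \<noteq> 0"
  shows "Ck_on k U (\<lambda>x. f x / g x)"
  unfolding divide_inverse by (intro Ck_on_mult Ck_on_inverse assms)

lemma Ck_on_ln:
  assumes "open U" "Ck_on k U f" "\<And>x. x \<in> U \<Longrightarrow> 0 < f x" shows "Ck_on k U (\<lambda>x. ln (f x))"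
proof (rule Ck_on_chain[where \<phi> = ln and f = f and \<phi>' = inverse])
  fix j assume "k = Suc j"
  then have "Ck_on j U f" using assms(2) Ck_on_Suc_D by blast
  then show "Ck_on j U (\<lambda>x. inverse (f x))"
    using assms by (intro Ck_on_inverse) force+
qed (use assms in \<open>auto intro: DERIV_ln\<close>)

lemma Ck_on_powr:
  assumes "open U" "Ck_on k U f" "\<And>x. x \<in> U \<Longrightarrow> 0 < f x" shows "Ck_on k U (\<lambda>x. f x powr c)"
proof (rule Ck_on_cong_imp[OF assms(1)])
  show "Ck_on k U (\<lambda>x. exp (c * ln (f x)))"
    by (intro Ck_on_exp Ck_on_mult Ck_on_const Ck_on_ln assms)
  show "exp (c * ln (f x)) = f x powr c" if "x \<in> U" for x
    using assms(3)[OF that] by (simp add: powr_def)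
qed

lemma Ck_on_sqrt:
  assumes "open U" "Ck_on k U f" "\<And>x. x \<in> U \<Longrightarrow> 0 < f x" shows "Ck_on k U (\<lambda>x. sqrt (f x))"
proof (rule Ck_on_cong_imp[OF assms(1) _ Ck_on_powr[OF assms(1,2), of "1/2"]])
  show "f x powr (1/2) = sqrt (f x)" if "x \<in> U" for x
    using assms(3)[OF that] by (simp add: powr_half_sqrt)
qed (rule assms(3))

lemma Ck_on_sinh: assumes "open U" "Ck_on k U f" shows "Ck_on k U (\<lambda>x. sinh (f x))"
proof -
  have "Ck_on k U (\<lambda>x. (exp (f x) - exp (- f x)) / 2)"
    by (intro Ck_on_divide Ck_on_diff Ck_on_exp Ck_on_minus Ck_on_const assms) auto
  then show ?thesis by (simp add: sinh_field_def)
qed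

lemma has_derivative_vecI:
  fixes G :: "'a::real_normed_vector \<Rightarrow> real ^ 'm"
  assumes "\<And>i. ((\<lambda>x. G x $ i) has_derivative (\<lambda>h. D h $ i)) (at x)"
  shows "(G has_derivative D) (at x)"
proof -
  have "\<forall>b\<in>Basis. ((\<lambda>x. G x \<bullet> b) has_derivative (\<lambda>h. D h \<bullet> b)) (at x)"
    using assms by (auto simp: Basis_vec_def inner_axis)
  then show ?thesis using has_derivative_componentwise_within[of G D x UNIV] by simp
qed

text \<open>Induction with \<open>f\<close> varying and \<open>G\<close> fixed: by the chain rule
  the partial derivatives are sums of products of partial derivatives of \<open>f\<close>, composed
  with the same \<open>G\<close>, and partial derivatives of the components of
  \<open>G\<close>.\<close>

lemma Ck_on_compose:
  fixes f :: "real ^ 'm \<Rightarrow> real" and G :: "real ^ 'n \<Rightarrow> real ^ 'm"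
  assumes U: "open U" and V: "open V" and G: "\<And>i. Ck_on k U (\<lambda>x. G x $ i)" "G ` U \<subseteq> V"
    and f: "Ck_on k V f"
  shows "Ck_on k U (\<lambda>x. f (G x))"
  using f G(1)
proof (induction k arbitrary: f)
  case 0
  then have "continuous_on U G" using continuous_on_componentwise[of U G]
    by (auto simp: Basis_vec_def inner_axis)
  then show ?case using 0 G(2) by (auto intro: continuous_on_compose2)
next
  case (Suc k)
  show ?case
  proof (intro Ck_onI[where g = "\<lambda>x. \<Sum>i\<in>UNIV. partial f i (G x) *\<^sub>R egrad (\<lambda>x. G x $ i) x"] U)
    fix x assume x: "x \<in> U"
    have "(G has_derivative (\<lambda>h. \<chi> i. egrad (\<lambda>x. G x $ i) x \<bullet> h)) (at x)"
    proof (rule has_derivative_vecI)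
      fix i
      have "(\<lambda>x. G x $ i) differentiable at x" using Suc.prems x by simp
      then show "((\<lambda>x. G x $ i) has_derivative (\<lambda>h. (\<chi> i. egrad (\<lambda>x. G x $ i) x \<bullet> h) $ i)) (at x)"
        by (simp add: has_derivative_egrad)
    qed
    moreover have "(f has_derivative (\<lambda>h. egrad f (G x) \<bullet> h)) (at (G x))"
      using Suc.prems x G(2) by (intro has_derivative_egrad) auto
    ultimately have "((\<lambda>x. f (G x)) has_derivative (\<lambda>h. egrad f (G x) \<bullet> (\<chi> i. egrad (\<lambda>x. G x $ i) x \<bullet> h))) (at x)"
      by (rule has_derivative_compose)
    then show "((\<lambda>x. f (G x)) has_derivative
        (\<lambda>h. (\<Sum>i\<in>UNIV. partial f i (G x) *\<^sub>R egrad (\<lambda>x. G x $ i) x) \<bullet> h)) (at x)"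
      by (simp add: inner_vec_def[of "egrad f (G x)"] inner_sum_left)
  next
    fix l
    have "Ck_on k U (\<lambda>x. \<Sum>i\<in>UNIV. partial f i (G x) * partial (\<lambda>x. G x $ i) l x)"
    proof (intro Ck_on_sum[OF U finite] Ck_on_mult[OF U])
      fix i
      show "Ck_on k U (\<lambda>x. partial f i (G x))"
        using Suc.IH[of "partial f i"] Suc.prems(1) Ck_on_Suc_D[OF Suc.prems(2)] by simp
      show "Ck_on k U (partial (\<lambda>x. G x $ i) l)" using Suc.prems(2)[of i] by simp
    qed
    then show "Ck_on k U (\<lambda>x. (\<Sum>i\<in>UNIV. partial f i (G x) *\<^sub>R egrad (\<lambda>x. G x $ i) x) $ l)" by simp
  qed
qed

text \<open>The case \<open>j = 0\<close> is the classical smooth function that is flat at 0. With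
  the powers of \<open>z\<close> included, the family is closed under differentiation up to linear
  combinations, so one induction shows smoothness of all members together.\<close>

definition flat :: "nat \<Rightarrow> real \<Rightarrow> real"
  where "flat j z = (if z \<le> 0 then 0 else exp (- 1 / z) / z ^ j)"

text \<open>The single term of order \<open>j + 2\<close> in the exponential series bounds
  \<open>exp (1 / z)\<close> from below. After division by \<open>z ^ j\<close> two powers of
  \<open>z\<close> survive, one more than is needed for the derivative at 0 to exist and
  vanish.\<close>

lemma flat_bound: "\<bar>flat j z\<bar> \<le> fact (j + 2) * z\<^sup>2"
proof (cases "z \<le> 0")
  case False
  then have z: "0 < z" by simp
  have "(1 / z) ^ (j + 2) / fact (j + 2) \<le> exp (1 / z)"
  proof -
    have "sum (\<lambda>n. (1 / z) ^ n /\<^sub>R fact n) {j + 2} \<le> (\<Sum>n. (1 / z) ^ n /\<^sub>R fact n)"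
      using z by (intro sum_le_suminf summable_exp_generic) auto
    then show ?thesis by (simp add: exp_def divide_inverse mult.commute)
  qed
  then have "1 / exp (1 / z) \<le> 1 / ((1 / z) ^ (j + 2) / fact (j + 2))"
    using z by (intro divide_left_mono mult_pos_pos) auto
  also have "\<dots> = fact (j + 2) * z ^ (j + 2)"
    using z by (simp add: power_divide)
  finally have "exp (- 1 / z) / z ^ j \<le> fact (j + 2) * z ^ (j + 2) / z ^ j"
    using z by (intro divide_right_mono) (auto simp: exp_minus field_simps)
  also have "\<dots> = fact (j + 2) * z\<^sup>2"
    using z by (simp add: power_add power2_eq_square)
  finally show ?thesis using z by (simp add: flat_def)
qed (simp add: flat_def)

lemma DERIV_flat: "(flat j has_real_derivative flat (j + 2) z - real j * flat (j + 1) z) (at z)"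
proof -
  consider "z < 0" | "z = 0" | "0 < z" by linarith
  then show ?thesis
  proof cases
    case 1
    have "((\<lambda>_. 0) has_real_derivative 0) (at z)" by simp
    then have "(flat j has_real_derivative 0) (at z)"
      by (rule has_field_derivative_transform_within_open[where S = "{..<0}"]) (use 1 in \<open>auto simp: flat_def\<close>)
    then show ?thesis using 1 by (simp add: flat_def)
  next
    case 2
    have "((\<lambda>h. flat j h / h) \<longlongrightarrow> 0) (at 0)"
    proof (rule Lim_null_comparison)
      show "\<forall>\<^sub>F h in at 0. norm (flat j h / h) \<le> fact (j + 2) * \<bar>h\<bar>"
      proof (intro always_eventually allI)
        fix h :: real
        show "norm (flat j h / h) \<le> fact (j + 2) * \<bar>h\<bar>"
        proof (cases "h = 0")
          case False
          have "\<bar>flat j h\<bar> \<le> fact (j + 2) * \<bar>h\<bar> * \<bar>h\<bar>"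
            using flat_bound[of j h] by (simp only: power2_eq_square abs_mult_self_eq mult.assoc)
          moreover have "0 < \<bar>h\<bar>" using False by simp
          ultimately show ?thesis by (simp only: real_norm_def abs_divide divide_le_eq if_True)
        qed simp
      qed
      show "((\<lambda>h. fact (j + 2) * \<bar>h\<bar>) \<longlongrightarrow> 0) (at (0::real))"
        by (auto intro!: tendsto_eq_intros)
    qed
    then show ?thesis unfolding 2 DERIV_def by (simp add: flat_def)
  next
    case 3
    have "((\<lambda>z. exp (- 1 / z) / z ^ j) has_real_derivative
        (exp (- 1 / z) * (1 / z\<^sup>2) * z ^ j - exp (- 1 / z) * (real j * z ^ (j - 1))) / (z ^ j * z ^ j)) (at z)"
      using 3 by (auto intro!: derivative_eq_intros simp: power2_eq_square)
    also have "(exp (- 1 / z) * (1 / z\<^sup>2) * z ^ j - exp (- 1 / z) * (real j * z ^ (j - 1))) / (z ^ j * z ^ j)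
        = flat (j + 2) z - real j * flat (j + 1) z"
      using 3 by (cases j) (auto simp: flat_def field_simps power2_eq_square power_add)
    finally show ?thesis
      by (rule has_field_derivative_transform_within_open[where S = "{0<..}"]) (use 3 in \<open>auto simp: flat_def\<close>)
  qed
qed

lemma Ck_on_flat: assumes "open U" "Ck_on k U f" shows "Ck_on k U (\<lambda>x. flat j (f x))"
  using assms(2)
proof (induction k arbitrary: j)
  case 0
  have "isCont (flat j) t" for t using DERIV_flat by (rule DERIV_isCont)
  then have "continuous_on UNIV (flat j)" by (simp add: continuous_at_imp_continuous_on)
  with 0 show ?case by (auto intro: continuous_on_compose2)
next
  case (Suc k)
  show ?case
  proof (rule Ck_on_chain[OF assms(1) Suc.prems DERIV_flat])
    fix i assume "Suc k = Suc i"
    then show "Ck_on i U (\<lambda>x. flat (j + 2) (f x) - real j * flat (j + 1) (f x))"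
      using Ck_on_Suc_D[OF Suc.prems] Suc.IH by (intro Ck_on_diff Ck_on_mult Ck_on_const assms) auto
  qed
qed

section \<open>Change of variables\<close>

text \<open>The change of variables theorem of the library needs a well-ordered index type.\<close>
typedef ('n::finite) idx = "{..<CARD('n)}"
  by (rule exI[of _ 0]) simp

instantiation idx :: (finite) linorder
begin
definition less_eq_idx :: "'a idx \<Rightarrow> 'a idx \<Rightarrow> bool" where "less_eq_idx x y \<longleftrightarrow> Rep_idx x \<le> Rep_idx y"
definition less_idx :: "'a idx \<Rightarrow> 'a idx \<Rightarrow> bool" where "less_idx x y \<longleftrightarrow> Rep_idx x < Rep_idx y"
instance
  by standard (auto simp: less_eq_idx_def less_idx_def Rep_idx_inject)
end

instance idx :: (finite) finite
proof
  have "(UNIV :: 'a idx set) = Abs_idx ` {..<CARD('a)}"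
    using Abs_idx_cases by (auto simp: image_iff)
  then show "finite (UNIV :: 'a idx set)" by (metis finite_imageI finite_lessThan)
qed

instance idx :: (finite) wellorder
proof
  fix P :: "'a idx \<Rightarrow> bool" and a
  assume step: "\<And>x. (\<And>y. y < x \<Longrightarrow> P y) \<Longrightarrow> P x"
  show "P a"
  proof (induction a rule: measure_induct_rule[of Rep_idx])
    case (less x)
    then show ?case using step[of x] by (simp add: less_idx_def)
  qed
qed

lemma card_idx: "CARD(('n::finite) idx) = CARD('n)"
  using type_definition.card[OF type_definition_idx] by simp

text \<open>An orthogonal map that carries a coordinate axis to \<open>e\<close> conjugates the map
  to a diagonal one. Both maps whose Jacobian is needed, the radial map and the inversion, have a
  derivative of this form.\<close>

lemma abs_det_scaled_rank_one:
  fixes e :: "real ^ 'n"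
  assumes "norm e = 1"
  shows "\<bar>det (matrix (\<lambda>h. c *\<^sub>R (h + (b * (e \<bullet> h)) *\<^sub>R e)))\<bar> = \<bar>c\<bar> ^ CARD('n) * \<bar>1 + b\<bar>"
proof -
  define k :: 'n where "k = undefined"
  have "norm (axis k (1::real)) = 1" by (rule norm_axis_1)
  then obtain R :: "real ^ 'n \<Rightarrow> real ^ 'n" where R: "orthogonal_transformation R" "R (axis k 1) = e"
    using orthogonal_transformation_exists_1[OF _ assms] by metis
  define L where "L = (\<lambda>h. c *\<^sub>R (h + (b * (e \<bullet> h)) *\<^sub>R e))"
  define D where "D = (\<lambda>h::real ^ 'n. c *\<^sub>R (h + (b * (axis k 1 \<bullet> h)) *\<^sub>R axis k 1))"
  have linR: "linear R" using R(1) by (simp add: orthogonal_transformation_def)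
  have linL: "linear L" unfolding L_def by (auto intro!: linearI simp: algebra_simps inner_add_right)
  have linD: "linear D" unfolding D_def by (auto intro!: linearI simp: algebra_simps inner_add_right)
  have "L (R h) = R (D h)" for h
    using R linR by (simp add: L_def D_def linear_add linear_cmul orthogonal_transformation_def flip: R(2))
  then have "matrix L ** matrix R = matrix R ** matrix D"
    using linL linR linD by (simp add: o_def flip: matrix_compose)
  then have "det (matrix L) * det (matrix R) = det (matrix R) * det (matrix D)"
    by (metis det_mul)
  moreover have "\<bar>det (matrix R)\<bar> = 1"
    using R(1) by (simp add: orthogonal_transformation_det)
  ultimately have LD: "det (matrix L) = det (matrix D)" by (auto simp: mult.commute)
  have mD: "matrix D $ i $ j = c * ((if i = j then 1 else 0) + b * (if j = k \<and> i = k then 1 else 0))" for i j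
  proof -
    have "axis k 1 \<bullet> (axis j 1 :: real ^ 'n) = (if j = k then 1 else 0)"
      by (simp add: inner_axis_axis)
    then show ?thesis by (auto simp: matrix_def D_def) (auto simp: axis_def)
  qed
  have "det (matrix D) = (\<Prod>i\<in>UNIV. matrix D $ i $ i)"
    by (rule det_diagonal) (auto simp: mD)
  also have "\<dots> = (\<Prod>i\<in>UNIV. c * (if i = k then 1 + b else 1))"
    by (rule prod.cong) (auto simp: mD)
  also have "\<dots> = c ^ CARD('n) * (1 + b)"
    by (simp add: prod.distrib)
  finally show ?thesis using LD by (simp add: L_def abs_mult power_abs)
qed

text \<open>Lets a scalar integrand, carried along a fixed axis, be treated as a vector-valued one,
  the form to which the change of variables theorem applies.\<close>

lemma integrable_scaleR_axis_iff:
  fixes f :: "'a \<Rightarrow> real" and k :: "'m::finite"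
  shows "integrable M (\<lambda>x. f x *\<^sub>R (axis k 1 :: real ^ 'm)) \<longleftrightarrow> integrable M f"
proof
  assume "integrable M (\<lambda>x. f x *\<^sub>R (axis k 1 :: real ^ 'm))"
  then have "integrable M (\<lambda>x. (f x *\<^sub>R (axis k 1 :: real ^ 'm)) \<bullet> axis k 1)"
    by (rule integrable_inner_left)
  then show "integrable M f" by (simp add: inner_axis)
qed auto

text \<open>The two integrands are absolutely integrable at the same time. If neither is, both
  Bochner integrals have the default value 0, so equality holds in that case too.\<close>

lemma lebesgue_change_of_variables:
  fixes g :: "real ^ 'm::{finite,wellorder} \<Rightarrow> real ^ 'm::_" and f :: "real ^ 'm::_ \<Rightarrow> real"
  assumes S: "S \<in> sets borel" and gS: "g ` S \<in> sets borel"
    and g: "\<And>x. x \<in> S \<Longrightarrow> (g has_derivative g' x) (at x)" and inj: "inj_on g S"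
    and f: "(\<lambda>x. indicator (g ` S) x * f x) \<in> borel_measurable borel"
    and fg: "(\<lambda>x. indicator S x * (\<bar>det (matrix (g' x))\<bar> * f (g x))) \<in> borel_measurable borel"
  shows "(LINT x|lborel. indicator (g ` S) x * f x)
    = (LINT x|lborel. indicator S x * (\<bar>det (matrix (g' x))\<bar> * f (g x)))"
proof -
  define k :: "'m::{finite,wellorder}" where "k = undefined"
  let ?a = "axis k (1::real)"
  define F where "F = (\<lambda>x. f x *\<^sub>R ?a)"
  let ?J = "\<lambda>x. \<bar>det (matrix (g' x))\<bar>"
  have Sl: "S \<in> sets lebesgue" using S by (simp add: sets_completionI_sets)
  have iff1: "F absolutely_integrable_on (g ` S) \<longleftrightarrow> integrable lborel (\<lambda>x. indicator (g ` S) x * f x)"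
    using f integrable_completion[of "\<lambda>x. indicator (g ` S) x * f x" lborel]
      integrable_scaleR_axis_iff[of lebesgue "\<lambda>x. indicator (g ` S) x * f x" k]
    by (simp add: set_integrable_def F_def)
  have iff2: "(\<lambda>x. ?J x *\<^sub>R F (g x)) absolutely_integrable_on S
      \<longleftrightarrow> integrable lborel (\<lambda>x. indicator S x * (?J x * f (g x)))"
    using fg integrable_completion[of "\<lambda>x. indicator S x * (?J x * f (g x))" lborel]
      integrable_scaleR_axis_iff[of lebesgue "\<lambda>x. indicator S x * (?J x * f (g x))" k]
    by (simp add: set_integrable_def F_def)
  note cv = has_absolute_integral_change_of_variables[OF Sl has_derivative_at_withinI[OF g] inj, of F]
  show ?thesis
  proof (cases "integrable lborel (\<lambda>x. indicator (g ` S) x * f x)")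
    case True
    then have A: "F absolutely_integrable_on (g ` S)" using iff1 by simp
    then have B: "(\<lambda>x. ?J x *\<^sub>R F (g x)) absolutely_integrable_on S"
      and eq: "integral S (\<lambda>x. ?J x *\<^sub>R F (g x)) = integral (g ` S) F"
      using cv[of "integral (g ` S) F"] by auto
    have B': "integrable lborel (\<lambda>x. indicator S x * (?J x * f (g x)))" using B iff2 by simp
    have "(LINT x|lborel. indicator (g ` S) x * f x) = integral (g ` S) F \<bullet> ?a"
    proof -
      have "integral (g ` S) F = (LINT x:(g ` S)|lebesgue. F x)"
        using A by (rule set_lebesgue_integral_eq_integral(2)[symmetric])
      also have "\<dots> = (LINT x|lebesgue. (indicator (g ` S) x * f x) *\<^sub>R ?a)"
        by (simp add: set_lebesgue_integral_def F_def)
      also have "\<dots> = (LINT x|lebesgue. indicator (g ` S) x * f x) *\<^sub>R ?a"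
        using True f by (intro integral_scaleR_left) (simp add: integrable_completion)
      finally show ?thesis using f by (simp add: integral_completion inner_axis)
    qed
    moreover have "(LINT x|lborel. indicator S x * (?J x * f (g x))) = integral S (\<lambda>x. ?J x *\<^sub>R F (g x)) \<bullet> ?a"
    proof -
      have "integral S (\<lambda>x. ?J x *\<^sub>R F (g x)) = (LINT x:S|lebesgue. ?J x *\<^sub>R F (g x))"
        using B by (rule set_lebesgue_integral_eq_integral(2)[symmetric])
      also have "\<dots> = (LINT x|lebesgue. (indicator S x * (?J x * f (g x))) *\<^sub>R ?a)"
        by (simp add: set_lebesgue_integral_def F_def)
      also have "\<dots> = (LINT x|lebesgue. indicator S x * (?J x * f (g x))) *\<^sub>R ?a"
        using B' fg by (intro integral_scaleR_left) (simp add: integrable_completion)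
      finally show ?thesis using fg by (simp add: integral_completion inner_axis)
    qed
    ultimately show ?thesis using eq by simp
  next
    case False
    then have "\<not> integrable lborel (\<lambda>x. indicator S x * (?J x * f (g x)))"
      using iff1 iff2 cv by blast
    with False show ?thesis by (simp add: not_integrable_integral_eq)
  qed
qed

text \<open>A bijection of the index types, acting on coordinates, is a linear isometry; it maps
  boxes to boxes of equal volume, which determines Lebesgue measure.\<close>

lemma relabel_coordinates:
  obtains P :: "real ^ 'n \<Rightarrow> real ^ ('n::finite) idx" and Q
  where "linear P" "linear Q" "\<And>x. Q (P x) = x" "\<And>y. P (Q y) = y"
    "\<And>x y. P x \<bullet> P y = x \<bullet> y" "distr lborel lborel P = lborel"
proof -
  obtain \<beta> :: "'n idx \<Rightarrow> 'n" where \<beta>: "bij \<beta>"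
    using finite_same_card_bij[of "UNIV :: 'n idx set" "UNIV :: 'n set"] card_idx[where 'n = 'n] by auto
  define P :: "real ^ 'n \<Rightarrow> real ^ 'n idx" where "P x = (\<chi> j. x $ \<beta> j)" for x
  define Q :: "real ^ 'n idx \<Rightarrow> real ^ 'n" where "Q y = (\<chi> i. y $ inv \<beta> i)" for y
  have lin: "linear P" "linear Q"
    by (auto intro!: linearI simp: P_def Q_def vec_eq_iff)
  have QP: "Q (P x) = x" "P (Q y) = y" for x y
    using \<beta> by (auto simp: P_def Q_def vec_eq_iff bij_is_surj surj_f_inv_f bij_is_inj)
  have inner: "P x \<bullet> P y = x \<bullet> y" for x y
    using sum.reindex_bij_betw[OF \<beta>, of "\<lambda>i. x $ i * y $ i"] by (simp add: inner_vec_def P_def)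
  have mP: "P \<in> borel_measurable borel"
    using lin(1) by (intro borel_measurable_continuous_onI linear_continuous_on)
      (simp add: linear_conv_bounded_linear)
  have "lborel = distr lborel lborel P"
  proof (rule lborel_eqI)
    fix l u :: "real ^ 'n idx" assume lu: "\<And>b. b \<in> Basis \<Longrightarrow> l \<bullet> b \<le> u \<bullet> b"
    have lu': "l $ j \<le> u $ j" for j using lu[of "axis j 1"] by (simp add: inner_axis axis_in_Basis_iff)
    have "P -` box l u = box (Q l) (Q u)"
    proof -
      have "(\<forall>j. l $ j < x $ \<beta> j \<and> x $ \<beta> j < u $ j) \<longleftrightarrow> (\<forall>i. l $ inv \<beta> i < x $ i \<and> x $ i < u $ inv \<beta> i)" for x
        using \<beta> by (metis bij_inv_eq_iff)
      then show ?thesis by (auto simp: mem_box_cart P_def Q_def)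
    qed
    then have "emeasure (distr lborel lborel P) (box l u) = emeasure lborel (box (Q l) (Q u))"
      using mP by (simp add: emeasure_distr)
    also have "\<dots> = (\<Prod>b\<in>Basis. (Q u - Q l) \<bullet> b)"
      using lu' by (intro emeasure_lborel_box) (auto simp: Basis_vec_def inner_axis Q_def)
    also have "(\<Prod>b\<in>Basis. (Q u - Q l) \<bullet> b) = (\<Prod>i\<in>UNIV. (Q u - Q l) $ i)"
    proof -
      have B: "Basis = range (\<lambda>i::'n. axis i (1::real))" by (auto simp: Basis_vec_def)
      show ?thesis unfolding B by (subst prod.reindex) (auto simp: inj_on_def axis_eq_axis inner_axis)
    qed
    also have "\<dots> = (\<Prod>j\<in>UNIV. (u - l) $ j)"
      using prod.reindex_bij_betw[OF \<beta>, of "\<lambda>i. (Q u - Q l) $ i"] \<beta>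
      by (simp add: Q_def bij_is_inj)
    also have "\<dots> = (\<Prod>b\<in>Basis. (u - l) \<bullet> b)"
    proof -
      have B: "Basis = range (\<lambda>i::'n idx. axis i (1::real))" by (auto simp: Basis_vec_def)
      show ?thesis unfolding B by (subst prod.reindex) (auto simp: inj_on_def axis_eq_axis inner_axis)
    qed
    finally show "emeasure (distr lborel lborel P) (box l u) = (\<Prod>b\<in>Basis. (u - l) \<bullet> b)" .
  qed simp
  then show ?thesis using that[OF lin QP inner] by simp
qed

text \<open>The statement over \<open>idx\<close> is transported by conjugating \<open>g\<close>
  with the isometry \<open>P\<close>. The rank-one shape of the derivative survives, with
  \<open>e\<close> replaced by \<open>P e\<close>, because \<open>P\<close> respects inner
  products.\<close>

theorem change_of_variables_rank_one:
  fixes g :: "real ^ 'n \<Rightarrow> real ^ 'n" and f :: "real ^ 'n \<Rightarrow> real"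
  assumes S: "S \<in> sets borel" and gS: "g ` S \<in> sets borel" and inj: "inj_on g S"
    and g: "\<And>x. x \<in> S \<Longrightarrow> (g has_derivative (\<lambda>h. c x *\<^sub>R (h + (b x * (e x \<bullet> h)) *\<^sub>R e x))) (at x)"
    and e: "\<And>x. x \<in> S \<Longrightarrow> norm (e x) = 1"
    and f: "(\<lambda>x. indicator (g ` S) x * f x) \<in> borel_measurable borel"
    and fg: "(\<lambda>x. indicator S x * ((\<bar>c x\<bar> ^ CARD('n) * \<bar>1 + b x\<bar>) * f (g x))) \<in> borel_measurable borel"
  shows "(LINT x|lborel. indicator (g ` S) x * f x)
    = (LINT x|lborel. indicator S x * ((\<bar>c x\<bar> ^ CARD('n) * \<bar>1 + b x\<bar>) * f (g x)))"
proof -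
  obtain P :: "real ^ 'n \<Rightarrow> real ^ 'n idx" and Q where PQ: "linear P" "linear Q" "\<And>x. Q (P x) = x"
    "\<And>y. P (Q y) = y" "\<And>x y. P x \<bullet> P y = x \<bullet> y" "distr lborel lborel P = lborel"
    using relabel_coordinates[where 'n = 'n] by blast
  have mP [measurable]: "P \<in> borel_measurable borel" and mQ [measurable]: "Q \<in> borel_measurable borel"
    using PQ(1,2) by (auto intro!: borel_measurable_continuous_onI linear_continuous_on
      simp: linear_conv_bounded_linear)
  have QdP: "Q y \<bullet> x = y \<bullet> P x" for x y
    using PQ(4,5) by metis
  have nP: "norm (P x) = norm x" for x by (simp add: norm_eq_sqrt_inner PQ(5))
  have int: "(LINT y|lborel. F (Q y)) = (LINT x|lborel. F x)" if "F \<in> borel_measurable borel" for F :: "real ^ 'n \<Rightarrow> real"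
  proof -
    have "(LINT y|distr lborel lborel P. F (Q y)) = (LINT x|lborel. F (Q (P x)))"
      using that by (intro integral_distr) auto
    then show ?thesis using PQ(3,6) by simp
  qed
  define S' where "S' = Q -` S"
  define g1 where "g1 = (\<lambda>y. P (g (Q y)))"
  define g1' where "g1' = (\<lambda>y h. c (Q y) *\<^sub>R (h + (b (Q y) * (P (e (Q y)) \<bullet> h)) *\<^sub>R P (e (Q y))))"
  have S'b: "S' \<in> sets borel" unfolding S'_def using measurable_sets[OF mQ S] by simp
  have img: "g1 ` S' = Q -` (g ` S)"
  proof -
    have "y \<in> g1 ` S'" if "Q y = g x" "x \<in> S" for x y
      using that PQ(3,4) by (intro image_eqI[of _ _ "P x"]) (auto simp: g1_def S'_def, metis)
    then show ?thesis using PQ(3) by (auto simp: g1_def S'_def)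
  qed
  then have img_b: "g1 ` S' \<in> sets borel" using measurable_sets[OF mQ gS] by simp
  have inj': "inj_on g1 S'"
    using inj PQ(3,4) unfolding inj_on_def g1_def S'_def by (metis vimageE)
  have der: "(g1 has_derivative g1' y) (at y)" if "y \<in> S'" for y
  proof -
    have bl: "bounded_linear P" "bounded_linear Q" using PQ by (simp_all add: linear_conv_bounded_linear)
    have "(g1 has_derivative (\<lambda>h. P (c (Q y) *\<^sub>R (Q h + (b (Q y) * (e (Q y) \<bullet> Q h)) *\<^sub>R e (Q y))))) (at y)"
      unfolding g1_def using that
      by (intro bounded_linear.has_derivative[OF bl(1)]
        has_derivative_compose[OF bounded_linear.has_derivative[OF bl(2) has_derivative_ident] g])
        (auto simp: S'_def)
    also have "(\<lambda>h. P (c (Q y) *\<^sub>R (Q h + (b (Q y) * (e (Q y) \<bullet> Q h)) *\<^sub>R e (Q y)))) = g1' y"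
    proof
      fix h
      have "e (Q y) \<bullet> Q h = P (e (Q y)) \<bullet> h" using QdP[of h "e (Q y)"] by (simp add: inner_commute)
      then show "P (c (Q y) *\<^sub>R (Q h + (b (Q y) * (e (Q y) \<bullet> Q h)) *\<^sub>R e (Q y))) = g1' y h"
        using PQ(1,4) by (simp add: g1'_def linear_add linear_cmul)
    qed
    finally show ?thesis .
  qed
  have det: "\<bar>det (matrix (g1' y))\<bar> = \<bar>c (Q y)\<bar> ^ CARD('n) * \<bar>1 + b (Q y)\<bar>" if "y \<in> S'" for y
    unfolding g1'_def using abs_det_scaled_rank_one[of "P (e (Q y))" "c (Q y)" "b (Q y)"] that e nP
    by (simp add: S'_def card_idx)
  define f1 where "f1 = (\<lambda>y. f (Q y))"
  have e1: "indicator (g1 ` S') y * f1 y = (\<lambda>x. indicator (g ` S) x * f x) (Q y)" for y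
    by (simp add: img f1_def indicator_def)
  have e2: "indicator S' y * (\<bar>det (matrix (g1' y))\<bar> * f1 (g1 y))
      = (\<lambda>x. indicator S x * ((\<bar>c x\<bar> ^ CARD('n) * \<bar>1 + b x\<bar>) * f (g x))) (Q y)" for y
    by (cases "y \<in> S'") (auto simp: det f1_def g1_def PQ(3), simp_all add: S'_def)
  have m1: "(\<lambda>y. indicator (g1 ` S') y * f1 y) \<in> borel_measurable borel"
    unfolding e1 using measurable_compose[OF mQ f] .
  have m2: "(\<lambda>y. indicator S' y * (\<bar>det (matrix (g1' y))\<bar> * f1 (g1 y))) \<in> borel_measurable borel"
    unfolding e2 using measurable_compose[OF mQ fg] .
  show ?thesis
    using lebesgue_change_of_variables[OF S'b img_b der inj' m1 m2] unfolding e1 e2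
    using int[OF f] int[OF fg] by simp
qed

section \<open>Integration by parts\<close>

lemma integrable_continuous_cball:
  fixes f :: "real ^ 'n \<Rightarrow> real"
  assumes "continuous_on UNIV f" "\<And>x. R < norm x \<Longrightarrow> f x = 0"
  shows "integrable lborel f"
proof -
  have "integrable lborel (\<lambda>x. indicator (cball 0 R) x *\<^sub>R f x)"
    by (intro borel_integrable_compact compact_cball continuous_on_subset[OF assms(1)]) auto
  moreover have "(\<lambda>x. indicator (cball 0 R) x *\<^sub>R f x) = f"
    using assms(2) by (auto simp: indicator_def fun_eq_iff not_le)
  ultimately show ?thesis by simp
qed

lemma partial_zero:
  assumes "open U" "x \<in> U" "\<And>y. y \<in> U \<Longrightarrow> f y = 0" shows "partial f i x = 0"
proof -
  have "((\<lambda>_. 0) has_derivative (\<lambda>h. 0 \<bullet> h)) (at x)" by simp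
  then have "(f has_derivative (\<lambda>h. 0 \<bullet> h)) (at x)"
    by (rule has_derivative_transform_within_open[OF _ assms(1,2)]) (simp add: assms(3))
  from partial_eq[OF this] show ?thesis by simp
qed

text \<open>Translation invariance makes the integral of every difference quotient vanish.\<close>
lemma integral_partial_eq_0:
  fixes f :: "real ^ 'n \<Rightarrow> real"
  assumes f: "Ck_on 1 UNIV f" and R: "\<And>x. R < norm x \<Longrightarrow> f x = 0"
  shows "integrable lborel (partial f i)" and "(LINT x|lborel. partial f i x) = 0"
proof -
  let ?e = "axis i 1 :: real ^ 'n"
  have diff: "f differentiable (at x)" for x using f by simp
  have cp: "continuous_on UNIV (partial f i)" using f by simp
  have cf: "continuous_on UNIV f" using Ck_on_le[OF f, of 0] by simp
  have p0: "partial f i x = 0" if "R < norm x" for x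
    by (rule partial_zero[of "{x. R < norm x}"])
      (use that R in \<open>auto intro: open_Collect_less continuous_intros\<close>)
  show int_p: "integrable lborel (partial f i)"
    by (rule integrable_continuous_cball[OF cp p0])
  have int_f: "integrable lborel f" by (rule integrable_continuous_cball[OF cf R])
  obtain M where M: "\<bar>partial f i x\<bar> \<le> M" for x
  proof -
    have "compact (partial f i ` cball 0 R)"
      by (intro compact_continuous_image continuous_on_subset[OF cp]) auto
    then obtain B where "\<forall>x\<in>cball 0 R. \<bar>partial f i x\<bar> \<le> B"
      using compact_imp_bounded bounded_real by (metis image_eqI)
    then have "\<bar>partial f i x\<bar> \<le> max B 0" for x
      using p0[of x] by (cases "R < norm x") (auto simp: not_less le_max_iff_disj)
    then show ?thesis using that by blast
  qed
  have line: "((\<lambda>t. f (x + t *\<^sub>R ?e)) has_real_derivative partial f i (x + t *\<^sub>R ?e)) (at t)" for x t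
  proof -
    have "((\<lambda>t. x + t *\<^sub>R ?e) has_derivative (\<lambda>h. h *\<^sub>R ?e)) (at t)"
      by (auto intro!: derivative_eq_intros)
    from has_derivative_compose[OF this has_derivative_egrad[OF diff]]
    have "((\<lambda>t. f (x + t *\<^sub>R ?e)) has_derivative (\<lambda>h. egrad f (x + t *\<^sub>R ?e) \<bullet> (h *\<^sub>R ?e))) (at t)" .
    then show ?thesis unfolding has_field_derivative_def
      by (rule has_derivative_eq_rhs) (simp add: inner_axis fun_eq_iff)
  qed
  define h where "h j = inverse (real (Suc j))" for j
  have h: "0 < h j" "h j \<le> 1" for j by (auto simp: h_def inverse_le_1_iff)
  define q where "q j x = (f (x + h j *\<^sub>R ?e) - f x) / h j" for j x
  have int_shift: "integrable lborel (\<lambda>x. f (x + a))" "(LINT x|lborel. f (x + a)) = (LINT x|lborel. f x)" for a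
  proof -
    have d: "distr lborel borel (\<lambda>x. a + x) = (lborel :: (real ^ 'n) measure)" by (rule lborel_distr_plus)
    have mf: "f \<in> borel_measurable borel" using cf by (rule borel_measurable_continuous_onI)
    show "integrable lborel (\<lambda>x. f (x + a))"
      using int_f integrable_distr_eq[of "\<lambda>x. a + x" lborel borel f] mf unfolding d by (simp add: add.commute)
    show "(LINT x|lborel. f (x + a)) = (LINT x|lborel. f x)"
      using integral_distr[of "\<lambda>x. a + x" lborel borel f] mf unfolding d by (simp add: add.commute)
  qed
  have q0: "(LINT x|lborel. q j x) = 0" for j
    using int_shift int_f by (simp add: q_def)
  have "(\<lambda>j. LINT x|lborel. q j x) \<longlonglongrightarrow> (LINT x|lborel. partial f i x)"
  \<comment> \<open>The steps \<open>h j\<close> are at most 1, so every difference quotient is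
    supported in the ball of radius \<open>R + 1\<close>; by the mean value theorem it is bounded by
    the bound \<open>M\<close> for the partial derivative.\<close>
  proof (rule integral_dominated_convergence[where w = "\<lambda>x. M * indicator (cball 0 (R + 1)) x"])
    show "partial f i \<in> borel_measurable lborel" using int_p by simp
    show "q j \<in> borel_measurable lborel" for j
      using int_shift(1) int_f unfolding q_def[abs_def] by (intro borel_measurable_integrable) auto
    show "integrable lborel (\<lambda>x. M * indicator (cball 0 (R + 1)) x :: real)"
      by (intro integrable_mult_right integrable_real_indicator emeasure_bounded_finite) auto
    show "AE x in lborel. (\<lambda>j. q j x) \<longlonglongrightarrow> partial f i x"
    proof (rule AE_I2)
      fix x
      have "((\<lambda>t. (f (x + (0 + t) *\<^sub>R ?e) - f (x + 0 *\<^sub>R ?e)) / t) \<longlongrightarrow> partial f i (x + 0 *\<^sub>R ?e)) (at 0)"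
        using line[of x 0] unfolding DERIV_def .
      moreover have "filterlim h (at 0) sequentially"
        unfolding filterlim_at using h LIMSEQ_inverse_real_of_nat
        by (auto simp: h_def[abs_def] intro!: always_eventually)
      ultimately have "((\<lambda>j. (f (x + (0 + h j) *\<^sub>R ?e) - f (x + 0 *\<^sub>R ?e)) / h j) \<longlonglongrightarrow> partial f i (x + 0 *\<^sub>R ?e))"
        by (rule filterlim_compose)
      then show "(\<lambda>j. q j x) \<longlonglongrightarrow> partial f i x" by (simp add: q_def)
    qed
    show "AE x in lborel. norm (q j x) \<le> M * indicator (cball 0 (R + 1)) x" for j
    proof (rule AE_I2)
      fix x
      show "norm (q j x) \<le> M * indicator (cball 0 (R + 1)) x"
      proof (cases "x \<in> cball 0 (R + 1)")
        case True
        obtain z where "0 < z" "z < h j"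
          "f (x + h j *\<^sub>R ?e) - f (x + 0 *\<^sub>R ?e) = (h j - 0) * partial f i (x + z *\<^sub>R ?e)"
          using MVT2[of 0 "h j" "\<lambda>t. f (x + t *\<^sub>R ?e)" "\<lambda>t. partial f i (x + t *\<^sub>R ?e)"] line h by blast
        then have "q j x = partial f i (x + z *\<^sub>R ?e)" using h[of j] by (simp add: q_def)
        then show ?thesis using True M by simp
      next
        case False
        then have x: "R + 1 < norm x" by simp
        have "norm x \<le> norm (x + h j *\<^sub>R ?e) + norm (h j *\<^sub>R ?e)"
          using norm_triangle_ineq4[of "x + h j *\<^sub>R ?e" "h j *\<^sub>R ?e"] by simp
        moreover have "norm (h j *\<^sub>R ?e) \<le> 1" using h[of j] by (simp add: norm_axis_1)
        ultimately have "f (x + h j *\<^sub>R ?e) = 0" "f x = 0" using x by (auto intro!: R)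
        then show ?thesis using False by (simp add: q_def)
      qed
    qed
  qed
  then have "(\<lambda>j. 0) \<longlonglongrightarrow> (LINT x|lborel. partial f i x)" using q0 by simp
  then show "(LINT x|lborel. partial f i x) = 0"
    using LIMSEQ_unique tendsto_const by metis
qed

lemma integral_divergence_eq_0:
  fixes F :: "'n::finite \<Rightarrow> real ^ 'n \<Rightarrow> real"
  assumes "\<And>i. Ck_on 1 UNIV (F i)" "\<And>i x. R < norm x \<Longrightarrow> F i x = 0"
  shows "integrable lborel (\<lambda>x. \<Sum>i\<in>UNIV. partial (F i) i x)"
    "(LINT x|lborel. (\<Sum>i\<in>UNIV. partial (F i) i x)) = 0"
  using integral_partial_eq_0[of "F _" R] assms
  by (auto intro!: Bochner_Integration.integrable_sum simp: Bochner_Integration.integral_sum)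

lemma Ck_on_inner_self: assumes "open U" shows "Ck_on k U (\<lambda>x. x \<bullet> x)"
  unfolding inner_vec_def inner_real_def by (intro Ck_on_sum Ck_on_mult Ck_on_nth assms) auto

lemma Ck_on_UNIV_extend:
  assumes "open U" "Ck_on k U f" "open V" "\<And>x. x \<in> V \<Longrightarrow> f x = 0" "U \<union> V = UNIV"
  shows "Ck_on k UNIV f"
proof -
  have "Ck_on k V f"
    by (rule Ck_on_cong_imp[OF assms(3) _ Ck_on_const[OF assms(3), of k 0]]) (simp add: assms(4))
  from Ck_on_Un[OF assms(1,3,2) this] show ?thesis using assms(5) by simp
qed

lemma has_derivative_norm_powr:
  fixes x :: "real ^ 'n" assumes "x \<noteq> 0"
  shows "((\<lambda>x. norm x powr a) has_derivative (\<lambda>h. (a * norm x powr (a - 2)) *\<^sub>R x \<bullet> h)) (at x)"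
proof -
  have "(norm has_derivative (\<lambda>h. sgn x \<bullet> h)) (at x)"
    using has_derivative_norm[OF assms] by (simp add: inner_commute)
  moreover have "((\<lambda>t. t powr a) has_real_derivative a * norm x powr (a - 1)) (at (norm x))"
    using assms by (intro has_real_derivative_powr) auto
  ultimately have "((\<lambda>x. norm x powr a) has_derivative (\<lambda>h. (sgn x \<bullet> h) * (a * norm x powr (a - 1)))) (at x)"
    by (rule DERIV_compose_FDERIV[rotated])
  moreover have "norm x powr (a - 1) = norm x powr (a - 2) * norm x"
  proof -
    have "norm x powr (a - 2) * norm x powr 1 = norm x powr (a - 2 + 1)"
      by (rule powr_add[symmetric])
    then show ?thesis by simp
  qed
  ultimately show ?thesis using assms by (simp add: sgn_div_norm field_simps)
qed

lemma Ck_on_norm_powr: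
  assumes "open U" "0 \<notin> U" shows "Ck_on k U (\<lambda>x::real^'n. norm x powr a)"
proof (rule Ck_on_cong_imp[OF assms(1)])
  show "Ck_on k U (\<lambda>x. (x \<bullet> x) powr (a / 2))"
    using assms by (intro Ck_on_powr Ck_on_inner_self) auto
  show "(x \<bullet> x) powr (a / 2) = norm x powr a" if "x \<in> U" for x
  proof -
    have "x \<bullet> x = norm x powr 2" using that assms by (auto simp: power2_norm_eq_inner)
    then show ?thesis by (simp only: powr_powr) simp
  qed
qed

text \<open>The field \<open>x / norm x ^ n\<close> is divergence free off the origin, so the
  integrand is the divergence of \<open>f\<close> times this field, and the vanishing of
  \<open>f\<close> near 0 makes the product smooth. In depth and angle it is the integral of a
  derivative along a cylinder.\<close>

lemma radial_integral_eq_0: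
  fixes f :: "real ^ 'n \<Rightarrow> real"
  assumes f: "Ck_on 1 UNIV f" and r: "0 < r" "\<And>x. norm x < r \<Longrightarrow> f x = 0" "\<And>x. R < norm x \<Longrightarrow> f x = 0"
  shows "integrable lborel (\<lambda>x. norm x powr (- real CARD('n)) * (x \<bullet> egrad f x))"
    "(LINT x|lborel. norm x powr (- real CARD('n)) * (x \<bullet> egrad f x)) = 0"
proof -
  let ?n = "real CARD('n)"
  define F where "F i x = norm x powr (- ?n) * (x $ i * f x)" for i x
  have o1: "open {x::real^'n. x \<noteq> 0}" by (intro open_Collect_neq continuous_intros)
  have o2: "open {x::real^'n. norm x < r}" by (intro open_Collect_less continuous_intros)
  have CF: "Ck_on 1 UNIV (F i)" for i
  proof (rule Ck_on_UNIV_extend[OF o1 _ o2])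
    show "Ck_on 1 {x. x \<noteq> 0} (F i)" unfolding F_def
      by (intro Ck_on_mult Ck_on_norm_powr Ck_on_nth o1 Ck_on_subset[OF f]) auto
  qed (use r in \<open>auto simp: F_def\<close>)
  have part: "(\<Sum>i\<in>UNIV. partial (F i) i x) = norm x powr (- ?n) * (x \<bullet> egrad f x)" for x
  proof (cases "x = 0")
    case True
    have "partial (F i) i x = 0" for i
      by (rule partial_zero[OF o2]) (use True r in \<open>auto simp: F_def\<close>)
    then show ?thesis using True by simp
  next
    case False
    have "(F i has_derivative (\<lambda>h. norm x powr (- ?n) * (x $ i * (egrad f x \<bullet> h) + h $ i * f x)
        + ((- ?n * norm x powr (- ?n - 2)) *\<^sub>R x \<bullet> h) * (x $ i * f x))) (at x)" for i
      unfolding F_def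
      by (intro has_derivative_mult has_derivative_norm_powr False has_derivative_egrad
        bounded_linear_imp_has_derivative bounded_linear_vec_nth) (use f in auto)
    from partial_eq[OF this] have p: "partial (F i) i x = norm x powr (- ?n) * (x $ i * partial f i x + f x)
        - ?n * norm x powr (- ?n - 2) * f x * (x $ i * x $ i)" for i
      by (simp add: inner_axis algebra_simps)
    have "(\<Sum>i\<in>UNIV. partial (F i) i x) = norm x powr (- ?n) * ((\<Sum>i\<in>UNIV. x $ i * partial f i x) + ?n * f x)
        - ?n * norm x powr (- ?n - 2) * f x * (\<Sum>i\<in>UNIV. x $ i * x $ i)"
      unfolding p by (simp add: sum_subtractf sum.distrib flip: sum_distrib_left)
    also have "(\<Sum>i\<in>UNIV. x $ i * x $ i) = norm x powr 2"
      using False by (simp add: power2_norm_eq_inner inner_vec_def)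
    also have "?n * norm x powr (- ?n - 2) * f x * norm x powr 2 = norm x powr (- ?n) * (?n * f x)"
      using False by (simp add: powr_diff)
    finally show ?thesis by (simp add: inner_vec_def algebra_simps)
  qed
  show "integrable lborel (\<lambda>x. norm x powr (- ?n) * (x \<bullet> egrad f x))"
    "(LINT x|lborel. norm x powr (- ?n) * (x \<bullet> egrad f x)) = 0"
    using integral_divergence_eq_0[of F R, OF CF] r(3) unfolding part by (auto simp: F_def)
qed

section \<open>The radial map\<close>

definition pball :: "(real ^ 'n) set"
  where "pball = ball 0 1 - {0}"

text \<open>At hyperbolic distance \<open>\<rho>\<close> from the origin, \<open>sinh \<rho> * sinh (depth x) = 1\<close>.\<close>
definition depth :: "real ^ 'n \<Rightarrow> real"
  where "depth x = - ln (norm x)"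

lemma open_pball: "open pball"
  unfolding pball_def by (intro open_Diff) auto

lemma pball_iff: "x \<in> pball \<longleftrightarrow> 0 < norm x \<and> norm x < 1"
  by (auto simp: pball_def)

lemma pball_borel [measurable]: "pball \<in> sets borel"
  by (rule borel_open[OF open_pball])

lemma depth_pos: "x \<in> pball \<Longrightarrow> 0 < depth x"
  by (simp add: pball_iff depth_def)

lemma exp_depth: "x \<in> pball \<Longrightarrow> exp (- depth x) = norm x"
  by (simp add: pball_iff depth_def)

text \<open>For \<open>r = exp (- t)\<close> one has \<open>1 - r^2 = 2 r sinh t\<close>. Thus the
  hyperbolic metric is \<open>1 / sinh^2 t\<close> times \<open>|dx|^2 / |x|^2\<close>, the metric
  of the flat cylinder.\<close>

lemma conf_factor_depth:
  assumes "x \<in> pball" shows "conf_factor x = 1 / (norm x * sinh (depth x))"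
proof -
  have n: "0 < norm x" "norm x < 1" using assms by (auto simp: pball_iff)
  have s: "sinh (depth x) = (1 / norm x - norm x) / 2"
    using n by (simp add: depth_def sinh_field_def exp_minus inverse_eq_divide)
  have e: "norm x * sinh (depth x) = (1 - (norm x)\<^sup>2) / 2"
    unfolding s using n by (simp add: power2_eq_square field_simps)
  show ?thesis unfolding conf_factor_def e by simp
qed

lemma Ck_on_depth:
  assumes "open U" "0 \<notin> U" shows "Ck_on k U (depth :: real ^ 'n \<Rightarrow> real)"
proof (rule Ck_on_cong_imp[OF assms(1)])
  show "Ck_on k U (\<lambda>x. - (ln (x \<bullet> x) / 2))"
    using assms by (intro Ck_on_minus Ck_on_divide Ck_on_ln Ck_on_inner_self Ck_on_const) auto
  show "- (ln (x \<bullet> x) / 2) = depth x" if "x \<in> U" for x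
  proof -
    have "0 < norm x" using that assms by auto
    then show ?thesis by (simp add: depth_def flip: power2_norm_eq_inner) (simp add: ln_realpow)
  qed
qed

lemma has_derivative_depth:
  assumes "x \<noteq> 0" shows "(depth has_derivative (\<lambda>h. - (sgn x \<bullet> h) / norm x)) (at x)"
proof -
  have "(norm has_derivative (\<lambda>h. sgn x \<bullet> h)) (at x)"
    using has_derivative_norm[OF assms] by (simp add: inner_commute)
  moreover have "((\<lambda>t. - ln t) has_real_derivative - (1 / norm x)) (at (norm x))"
    using assms by (auto intro!: derivative_eq_intros)
  ultimately have "(depth has_derivative (\<lambda>h. (sgn x \<bullet> h) * - (1 / norm x))) (at x)"
    unfolding depth_def[abs_def] by (rule DERIV_compose_FDERIV[rotated])
  then show ?thesis by (rule has_derivative_eq_rhs) (simp add: fun_eq_iff)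
qed

section \<open>Smoothness of the stretching and of the functions built from it\<close>

context
  fixes m :: real and U :: "(real ^ 'n) set" and f :: "real ^ 'n \<Rightarrow> real" and k :: nat
  assumes m: "1 \<le> m" and U: "open U" and f: "Ck_on k U f" and pos: "\<And>x. x \<in> U \<Longrightarrow> 0 < f x"
begin

lemma Ck_on_exp_mult: "Ck_on k U (\<lambda>x. exp (c * f x))"
  by (intro Ck_on_exp Ck_on_mult Ck_on_const U f)

lemma one_minus_nz: "x \<in> U \<Longrightarrow> 1 - exp (- 4 * (m * f x)) / 5 \<noteq> 0"
  using one_minus_bounds(1)[of "m * f x"] pos[of x] m by fastforce

lemma Ck_on_profile: "Ck_on k U (\<lambda>x. profile (m * f x))"
proof -
  have "Ck_on k U (\<lambda>x. exp ((- m / 2) * f x) * (1 - exp ((- 4 * m) * f x) / 5))"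
    by (intro Ck_on_mult Ck_on_diff Ck_on_divide Ck_on_const Ck_on_exp_mult U) auto
  then show ?thesis by (simp add: profile_def mult.assoc)
qed

lemma Ck_on_profile_ld: "Ck_on k U (\<lambda>x. profile_ld (m * f x))"
proof -
  have "Ck_on k U (\<lambda>x. - 1 / 2 + (4 / 5) * exp ((- 4 * m) * f x) / (1 - exp ((- 4 * m) * f x) / 5))"
    using one_minus_nz
    by (intro Ck_on_mult Ck_on_diff Ck_on_add Ck_on_divide Ck_on_const Ck_on_exp_mult U) (auto simp: mult.assoc)
  then show ?thesis by (simp add: profile_ld_def mult.assoc)
qed

lemma Ck_on_dstretch: "Ck_on k U (\<lambda>x. dstretch m (f x))"
  unfolding dstretch_def power2_eq_square
proof (intro Ck_on_divide Ck_on_mult Ck_on_const Ck_on_profile U)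
  show "profile (m * f x) * profile (m * f x) \<noteq> 0" if "x \<in> U" for x
    using profile_pos[of "m * f x"] pos[OF that] m by simp
qed

end

lemma Ck_on_stretch:
  assumes m: "1 \<le> m" and U: "open U" and f: "Ck_on k U f" and pos: "\<And>x. x \<in> U \<Longrightarrow> 0 < f x"
  shows "Ck_on k U (\<lambda>x. stretch m (f x))"
proof (rule Ck_on_chain[where \<phi> = "stretch m" and f = f and \<phi>' = "dstretch m", OF U f DERIV_stretch[OF m pos]])
  fix j assume "k = Suc j"
  then have "Ck_on j U f" using f Ck_on_Suc_D by blast
  then show "Ck_on j U (\<lambda>x. dstretch m (f x))" by (rule Ck_on_dstretch[OF m U _ pos])
qed

context
  fixes m :: real and U :: "(real ^ 'n) set" and f :: "real ^ 'n \<Rightarrow> real" and k :: nat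
  assumes m: "1 \<le> m" and U: "open U" and f: "Ck_on k U f" and pos: "\<And>x. x \<in> U \<Longrightarrow> 0 < f x"
begin

lemma Ck_on_sinh_stretch: "Ck_on k U (\<lambda>x. sinh (stretch m (f x)))"
  by (intro Ck_on_sinh Ck_on_stretch m U f pos)

lemma Ck_on_mass: "Ck_on k U (\<lambda>x. mass m (f x))"
  unfolding mass_def using stretch_pos[OF m pos] dstretch_pos[OF m pos]
  by (intro Ck_on_divide Ck_on_powr Ck_on_sinh_stretch Ck_on_dstretch m U f pos) (auto simp: less_imp_neq[symmetric])

lemma Ck_on_amp: "Ck_on k U (\<lambda>x. amp m (f x))"
  unfolding amp_def using stretch_pos[OF m pos] dstretch_pos[OF m pos] pos
  by (intro Ck_on_divide Ck_on_powr Ck_on_sqrt Ck_on_sinh_stretch Ck_on_sinh Ck_on_dstretch m U f pos)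
    (auto simp: less_imp_neq[symmetric])

lemma Ck_on_amp_ld: "Ck_on k U (\<lambda>x. amp_ld m (f x))"
proof -
  have cosh: "Ck_on k U (\<lambda>x. cosh (g x))" if "Ck_on k U g" for g
  proof -
    have "Ck_on k U (\<lambda>x. (exp (g x) + exp (- g x)) / 2)"
      by (intro Ck_on_divide Ck_on_add Ck_on_exp Ck_on_minus Ck_on_const U that) auto
    then show ?thesis by (simp add: cosh_field_def)
  qed
  show ?thesis
    unfolding amp_ld_def using stretch_pos[OF m pos] pos
    by (intro Ck_on_add Ck_on_mult Ck_on_diff Ck_on_divide Ck_on_const cosh Ck_on_sinh Ck_on_stretch Ck_on_dstretch
      Ck_on_profile_ld m U f pos) (auto simp: less_imp_neq[symmetric])
qed

end

text \<open>The substitution \<open>t = T s\<close> carried out in the ball: the direction of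
  \<open>y\<close> is kept, and \<open>stretch m\<close> acts on its depth (see
  \<open>depth_rmap\<close>).\<close>

definition rmap :: "real \<Rightarrow> real ^ 'n \<Rightarrow> real ^ 'n"
  where "rmap m y = (exp (- stretch m (depth y)) / norm y) *\<^sub>R y"

lemma norm_rmap: "y \<noteq> 0 \<Longrightarrow> norm (rmap m y) = exp (- stretch m (depth y))"
  by (simp add: rmap_def)

lemma depth_rmap: "y \<noteq> 0 \<Longrightarrow> depth (rmap m y) = stretch m (depth y)"
  unfolding depth_def by (subst norm_rmap) (auto simp: depth_def)

context
  fixes m :: real assumes m: "1 \<le> m"
begin

lemma rmap_pball: "y \<in> pball \<Longrightarrow> rmap m y \<in> pball"
  using stretch_pos[OF m depth_pos, of y] norm_rmap[of y m] by (auto simp: pball_iff)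

lemma Ck_on_rmap: "Ck_on k pball (\<lambda>y. rmap m y $ i)"
proof -
  have z: "0 \<notin> pball" by (simp add: pball_def)
  have "Ck_on k pball (\<lambda>y. exp (- stretch m (depth y)) * norm y powr (-1) * y $ i)"
    by (intro Ck_on_mult Ck_on_exp Ck_on_minus Ck_on_stretch m Ck_on_depth Ck_on_norm_powr Ck_on_nth open_pball z depth_pos)
  then show ?thesis
    by (rule Ck_on_cong_imp[OF open_pball, rotated]) (simp add: rmap_def powr_minus divide_inverse)
qed

text \<open>Tangentially the map scales by the ratio of the norms. Radially there is an additional
  factor \<open>T'\<close>, because the depth is minus the logarithm of the norm and is stretched by
  \<open>T'\<close>. This gives the rank-one form with \<open>1 + b = T'\<close>.\<close>

lemma has_derivative_rmap:
  assumes "y \<in> pball"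
  shows "(rmap m has_derivative (\<lambda>h. (norm (rmap m y) / norm y) *\<^sub>R
    (h + ((dstretch m (depth y) - 1) * (sgn y \<bullet> h)) *\<^sub>R sgn y))) (at y)"
proof -
  have y0: "y \<noteq> 0" using assms by (auto simp: pball_iff)
  have "(norm has_derivative (\<lambda>h. sgn y \<bullet> h)) (at y)"
    using has_derivative_norm[OF y0] by (simp add: inner_commute)
  moreover have "((\<lambda>y. stretch m (depth y)) has_derivative (\<lambda>h. (- (sgn y \<bullet> h) / norm y) * dstretch m (depth y))) (at y)"
    by (rule DERIV_compose_FDERIV[OF DERIV_stretch[OF m depth_pos[OF assms]] has_derivative_depth[OF y0]])
  ultimately have "(rmap m has_derivative (\<lambda>h. (exp (- stretch m (depth y)) / norm y) *\<^sub>R h +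
    ((exp (- stretch m (depth y)) * (- ((- (sgn y \<bullet> h) / norm y) * dstretch m (depth y))) * norm y
      - exp (- stretch m (depth y)) * (sgn y \<bullet> h)) / (norm y * norm y)) *\<^sub>R y)) (at y)"
    unfolding rmap_def[abs_def] using y0
    by (auto intro!: derivative_eq_intros simp: fun_eq_iff algebra_simps)
  then show ?thesis
  proof (rule has_derivative_eq_rhs, intro ext)
    fix h
    have "(exp (- stretch m (depth y)) * (- ((- (sgn y \<bullet> h) / norm y) * dstretch m (depth y))) * norm y
      - exp (- stretch m (depth y)) * (sgn y \<bullet> h)) / (norm y * norm y)
      = (norm (rmap m y) / norm y) * ((dstretch m (depth y) - 1) * (sgn y \<bullet> h)) * inverse (norm y)"
      using y0 by (simp add: norm_rmap field_simps)
    then show "(exp (- stretch m (depth y)) / norm y) *\<^sub>R h +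
    ((exp (- stretch m (depth y)) * (- ((- (sgn y \<bullet> h) / norm y) * dstretch m (depth y))) * norm y
      - exp (- stretch m (depth y)) * (sgn y \<bullet> h)) / (norm y * norm y)) *\<^sub>R y
     = (norm (rmap m y) / norm y) *\<^sub>R (h + ((dstretch m (depth y) - 1) * (sgn y \<bullet> h)) *\<^sub>R sgn y)"
      using y0 by (simp add: norm_rmap sgn_div_norm scaleR_add_right)
  qed
qed

lemma inj_on_rmap: "inj_on (rmap m) pball"
proof (rule inj_onI)
  fix x y :: "real ^ 'n" assume xy: "x \<in> pball" "y \<in> pball" "rmap m x = rmap m y"
  have nz: "x \<noteq> 0" "y \<noteq> 0" using xy by (auto simp: pball_iff)
  have "stretch m (depth x) = stretch m (depth y)" using depth_rmap nz xy(3) by metis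
  then have s: "depth x = depth y"
    using stretch_strict_mono[OF m, of "depth x" "depth y"] stretch_strict_mono[OF m, of "depth y" "depth x"] depth_pos xy
    by (metis less_irrefl linorder_neqE_linordered_idom)
  then have "norm x = norm y" using exp_depth xy by metis
  then show "x = y" using xy(3) s nz by (simp add: rmap_def)
qed

lemma image_rmap: "rmap m ` pball = (pball :: (real ^ 'n) set)"
proof
  show "rmap m ` pball \<subseteq> (pball :: (real ^ 'n) set)" using rmap_pball by auto
  show "pball \<subseteq> rmap m ` (pball :: (real ^ 'n) set)"
  proof
    fix x :: "real ^ 'n" assume x: "x \<in> pball"
    obtain s where s: "0 < s" "stretch m s = depth x" using stretch_surj[OF m depth_pos[OF x]] by blast
    define y where "y = (exp (- s) / norm x) *\<^sub>R x"
    have x0: "x \<noteq> 0" "0 < norm x" using x by (auto simp: pball_iff)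
    have ny: "norm y = exp (- s)" using x0 by (simp add: y_def)
    then have "y \<in> pball" using s by (simp add: pball_iff)
    moreover have "rmap m y = x"
    proof -
      have "depth y = s" by (simp add: depth_def ny)
      then have "rmap m y = (exp (- depth x) / exp (- s)) *\<^sub>R y" by (simp add: rmap_def ny s)
      then show ?thesis using x0 exp_depth[OF x] by (simp add: y_def)
    qed
    ultimately show "x \<in> rmap m ` pball" by force
  qed
qed

end

lemma integrable_annulus:
  fixes f :: "real ^ 'n \<Rightarrow> real"
  assumes "continuous_on {x. a \<le> norm x \<and> norm x \<le> b} f"
    and "\<And>x. \<not> (a \<le> norm x \<and> norm x \<le> b) \<Longrightarrow> f x = 0"
  shows "integrable lborel f"
proof -
  let ?S = "{x::real^'n. a \<le> norm x \<and> norm x \<le> b}"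
  have "compact ?S"
  proof -
    have "?S = cball 0 b - ball 0 a" by auto
    then show ?thesis by (simp add: compact_diff)
  qed
  then have "integrable lborel (\<lambda>x. indicator ?S x *\<^sub>R f x)"
    using assms(1) by (rule borel_integrable_compact)
  moreover have "(\<lambda>x. indicator ?S x *\<^sub>R f x) = f"
    using assms(2) by (auto simp: indicator_def fun_eq_iff)
  ultimately show ?thesis by simp
qed

section \<open>Transplantation of a function supported in an annulus\<close>

text \<open>The squared gradient contributes the power \<open>- 2\<close> of the conformal factor
  and the volume the power \<open>n\<close>, so this is the density, with respect to Lebesgue
  measure, of the energy that remains after the Poincare term.\<close>

definition energy :: "(real ^ 'n \<Rightarrow> real) \<Rightarrow> real ^ 'n \<Rightarrow> real"
  where "energy v x = conf_factor x ^ (CARD('n) - 2) * (norm (egrad v x))\<^sup>2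
    - ((real CARD('n) - 1) / 2)\<^sup>2 * conf_factor x ^ CARD('n) * (v x)\<^sup>2"

text \<open>Support in a closed annulus makes the transplantation harmless: \<open>depth\<close> is
  smooth there, and the transplanted functions live again in an annulus, away both from the origin
  and from the boundary sphere.\<close>

locale annular =
  fixes v :: "real ^ 'n \<Rightarrow> real" and r1 r2 m :: real
  assumes n3: "3 \<le> CARD('n)" and m_def: "m = real CARD('n) - 2"
    and smooth: "\<And>k. Ck_on k UNIV v"
    and r: "0 < r1" "r1 < 1" "0 < r2" "r2 < 1"
    and supp: "\<And>x. v x \<noteq> 0 \<Longrightarrow> r1 \<le> norm x \<and> norm x \<le> r2"
begin

lemma m1: "1 \<le> m" using n3 by (simp add: m_def)

lemma real_n: "real CARD('n) = m + 2" by (simp add: m_def)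

lemma n_minus_1: "real CARD('n) - 1 = m + 1" by (simp add: m_def)

lemma powr_m: "a powr m = a ^ (CARD('n) - 2)" if "0 < a" for a :: real
proof -
  have "m = real (CARD('n) - 2)" using n3 by (simp add: m_def of_nat_diff)
  then show ?thesis using that by (simp add: powr_realpow)
qed

lemma power_n: "a ^ CARD('n) = a ^ (CARD('n) - 2) * a\<^sup>2" for a :: real
proof -
  have "CARD('n) = (CARD('n) - 2) + 2" using n3 by simp
  then show ?thesis by (metis power_add)
qed

lemma powr_n: "a powr - real CARD('n) = a powr - m / a\<^sup>2" if "0 < a" for a :: real
  using that by (simp add: real_n powr_diff)

definition V :: "real ^ 'n \<Rightarrow> real"
  where "V y = (if y \<in> pball then v (rmap m y) else 0)"

text \<open>This is the function on which the best constant is tested; \<open>V\<close> is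
  \<open>v\<close> in the stretched coordinate, before the amplitude is attached.\<close>

definition u :: "real ^ 'n \<Rightarrow> real"
  where "u y = (if y \<in> pball then amp m (depth y) * v (rmap m y) else 0)"

text \<open>The depths that the stretching sends to those of the radii \<open>r1\<close> and
  \<open>r2\<close>. Depth decreases as the norm grows, so \<open>s1\<close> bounds the depth on the
  support from above and \<open>s2\<close> from below.\<close>

definition s1 :: real where "s1 = (SOME s. 0 < s \<and> stretch m s = - ln r1)"
definition s2 :: real where "s2 = (SOME s. 0 < s \<and> stretch m s = - ln r2)"

lemma s1: "0 < s1" "stretch m s1 = - ln r1"
  using someI_ex[of "\<lambda>s. 0 < s \<and> stretch m s = - ln r1"] stretch_surj[OF m1, of "- ln r1"] r
  unfolding s1_def by (metis ln_less_zero neg_0_less_iff_less)+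

lemma s2: "0 < s2" "stretch m s2 = - ln r2"
  using someI_ex[of "\<lambda>s. 0 < s \<and> stretch m s = - ln r2"] stretch_surj[OF m1, of "- ln r2"] r
  unfolding s2_def by (metis ln_less_zero neg_0_less_iff_less)+

lemma supp_rmap:
  assumes "y \<in> pball" "r1 \<le> norm (rmap m y)" "norm (rmap m y) \<le> r2"
  shows "exp (- s1) \<le> norm y \<and> norm y \<le> exp (- s2)"
proof -
  have y0: "y \<noteq> 0" and sp: "0 < depth y" using assms depth_pos by (auto simp: pball_iff)
  have "r1 \<le> exp (- stretch m (depth y))" "exp (- stretch m (depth y)) \<le> r2"
    using assms(2,3) norm_rmap[OF y0] by auto
  then have "ln r1 \<le> - stretch m (depth y)" "- stretch m (depth y) \<le> ln r2"
    using r ln_le_cancel_iff[of r1 "exp (- stretch m (depth y))"] by (auto simp: ln_ge_iff)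
  then have "stretch m (depth y) \<le> stretch m s1" "stretch m s2 \<le> stretch m (depth y)" using s1 s2 by auto
  then have "depth y \<le> s1" "s2 \<le> depth y"
    using stretch_strict_mono[OF m1 s1(1), of "depth y"] stretch_strict_mono[OF m1 sp, of s2] by force+
  then show ?thesis using exp_depth[OF assms(1)] by (metis exp_le_cancel_iff neg_le_iff_le)
qed

lemma supp_V:
  assumes "y \<in> pball" "v (rmap m y) \<noteq> 0"
  shows "exp (- s1) \<le> norm y \<and> norm y \<le> exp (- s2)"
  using supp_rmap[OF assms(1)] supp[OF assms(2)] by blast

lemma annulus_pball:
  assumes "exp (- s1) \<le> norm y" "norm y \<le> exp (- s2)" shows "y \<in> pball"
proof -
  have "0 < norm y" using assms(1) exp_gt_zero[of "- s1"] by linarith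
  moreover have "exp (- s2) < 1" using s2(1) by simp
  ultimately show ?thesis using assms(2) unfolding pball_iff by linarith
qed

lemma supp_Vu:
  "V y \<noteq> 0 \<Longrightarrow> exp (- s1) \<le> norm y \<and> norm y \<le> exp (- s2)"
  "u y \<noteq> 0 \<Longrightarrow> exp (- s1) \<le> norm y \<and> norm y \<le> exp (- s2)"
  using supp_V[of y] by (auto simp: V_def u_def split: if_splits)

lemma extend_smooth:
  fixes f :: "real ^ 'n \<Rightarrow> real"
  assumes "Ck_on k pball f" "\<And>y. f y \<noteq> 0 \<Longrightarrow> exp (- s1) \<le> norm y \<and> norm y \<le> exp (- s2)"
  shows "Ck_on k UNIV f"
proof (rule Ck_on_UNIV_extend[OF open_pball assms(1)])
  show "open ({y::real^'n. norm y < exp (- s1)} \<union> {y. exp (- s2) < norm y})"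
    by (intro open_Un open_Collect_less continuous_intros)
  show "f y = 0" if "y \<in> {y. norm y < exp (- s1)} \<union> {y. exp (- s2) < norm y}" for y
    using assms(2)[of y] that by (cases "f y = 0") auto
  show "pball \<union> ({y. norm y < exp (- s1)} \<union> {y::real^'n. exp (- s2) < norm y}) = UNIV"
    using annulus_pball by force
qed

lemma Ck_on_v_rmap: "Ck_on k pball (\<lambda>y. v (rmap m y))"
  by (rule Ck_on_compose[OF open_pball open_UNIV Ck_on_rmap[OF m1] _ smooth]) auto

lemma zero_notin: "0 \<notin> pball" by (simp add: pball_def)

lemma smooth_V: "Ck_on k UNIV V"
proof (rule extend_smooth)
  show "Ck_on k pball V"
    by (rule Ck_on_cong_imp[OF open_pball _ Ck_on_v_rmap]) (simp add: V_def)
qed (rule supp_Vu)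

lemma smooth_u: "Ck_on k UNIV u"
proof (rule extend_smooth)
  have "Ck_on k pball (\<lambda>y. amp m (depth y) * v (rmap m y))"
    by (intro Ck_on_mult Ck_on_amp Ck_on_v_rmap Ck_on_depth m1 open_pball depth_pos zero_notin)
  then show "Ck_on k pball u"
    by (rule Ck_on_cong_imp[OF open_pball, rotated]) (simp add: u_def)
qed (rule supp_Vu)

lemma u_test: "u \<in> test_functions"
proof -
  let ?A = "{y::real^'n. exp (- s1) \<le> norm y \<and> norm y \<le> exp (- s2)}"
  have A: "?A = cball 0 (exp (- s2)) - ball 0 (exp (- s1))" by auto
  have cA: "compact ?A" unfolding A by (intro compact_diff) auto
  have "{x. u x \<noteq> 0} \<subseteq> ?A" using supp_Vu(2) by auto
  then have cl: "closure {x. u x \<noteq> 0} \<subseteq> ?A"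
    using cA compact_imp_closed closure_minimal by blast
  then have "compact (closure {x. u x \<noteq> 0})"
    using cA \<open>{x. u x \<noteq> 0} \<subseteq> ?A\<close> by (simp add: bounded_subset[OF compact_imp_bounded])
  moreover have "?A \<subseteq> hyp_space"
  proof
    fix x assume "x \<in> ?A"
    then have "x \<in> pball" by (intro annulus_pball) auto
    then show "x \<in> hyp_space" by (simp add: pball_def)
  qed
  ultimately show ?thesis
    using cl smooth_u by (auto simp: test_functions_def C_k_iff)
qed

lemma egrad_V:
  assumes y: "y \<in> pball"
  shows "egrad V y = (norm (rmap m y) / norm y) *\<^sub>R
    (egrad v (rmap m y) + ((dstretch m (depth y) - 1) * (sgn y \<bullet> egrad v (rmap m y))) *\<^sub>R sgn y)"
proof -
  have "v differentiable (at (rmap m y))" using smooth[of 1] by simp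
  from has_derivative_compose[OF has_derivative_rmap[OF m1 y] has_derivative_egrad[OF this]]
  have "((\<lambda>y. v (rmap m y)) has_derivative (\<lambda>h. ((norm (rmap m y) / norm y) *\<^sub>R
    (egrad v (rmap m y) + ((dstretch m (depth y) - 1) * (sgn y \<bullet> egrad v (rmap m y))) *\<^sub>R sgn y)) \<bullet> h)) (at y)"
    by (rule has_derivative_eq_rhs) (simp add: fun_eq_iff inner_add_left inner_add_right inner_commute)
  then have "(V has_derivative (\<lambda>h. ((norm (rmap m y) / norm y) *\<^sub>R
    (egrad v (rmap m y) + ((dstretch m (depth y) - 1) * (sgn y \<bullet> egrad v (rmap m y))) *\<^sub>R sgn y)) \<bullet> h)) (at y)"
    by (rule has_derivative_transform_within_open[OF _ open_pball y]) (simp add: V_def)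
  then show ?thesis by (rule egrad_eq)
qed

text \<open>The minus sign reflects that the depth decreases outward; it explains the signs of
  \<open>amp_ld\<close> and \<open>dflux\<close> in the gradients of \<open>u\<close> and
  \<open>G\<close>.\<close>

lemma radial_has_derivative:
  assumes y: "y \<in> pball" and d: "(\<phi> has_real_derivative \<phi>') (at (depth y))"
  shows "((\<lambda>y. \<phi> (depth y)) has_derivative (\<lambda>h. (- (\<phi>' / norm y)) *\<^sub>R sgn y \<bullet> h)) (at y)"
proof -
  have "y \<noteq> 0" using y by (auto simp: pball_iff)
  from DERIV_compose_FDERIV[OF d has_derivative_depth[OF this]] show ?thesis
    by (rule has_derivative_eq_rhs) (simp add: fun_eq_iff)
qed

lemma egrad_u:
  assumes y: "y \<in> pball"
  shows "egrad u y = amp m (depth y) *\<^sub>R (egrad V y - (amp_ld m (depth y) * V y / norm y) *\<^sub>R sgn y)"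
proof -
  have dV: "V differentiable (at y)" using smooth_V[of 1] by simp
  have "((\<lambda>y. amp m (depth y) * V y) has_derivative (\<lambda>h. amp m (depth y) * (egrad V y \<bullet> h)
      + ((- (amp_ld m (depth y) * amp m (depth y) / norm y)) *\<^sub>R sgn y \<bullet> h) * V y)) (at y)"
    by (rule has_derivative_mult[OF radial_has_derivative[OF y DERIV_amp[OF m1 depth_pos[OF y]]] has_derivative_egrad[OF dV]])
  then have "(u has_derivative (\<lambda>h. amp m (depth y) * (egrad V y \<bullet> h)
      + ((- (amp_ld m (depth y) * amp m (depth y) / norm y)) *\<^sub>R sgn y \<bullet> h) * V y)) (at y)"
    by (rule has_derivative_transform_within_open[OF _ open_pball y]) (simp add: V_def u_def)
  then have "(u has_derivative (\<lambda>h. (amp m (depth y) *\<^sub>R (egrad V y - (amp_ld m (depth y) * V y / norm y) *\<^sub>R sgn y)) \<bullet> h)) (at y)"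
    by (rule has_derivative_eq_rhs) (simp add: fun_eq_iff inner_diff_left algebra_simps)
  then show ?thesis by (rule egrad_eq)
qed

text \<open>Its derivative in the depth is \<open>2 mass amp_ld V V' + dflux V^2\<close>. Up to this
  exact derivative, the cross term in the squared gradient of \<open>u\<close> is therefore
  \<open>- dflux V^2\<close>.\<close>

definition G :: "real ^ 'n \<Rightarrow> real"
  where "G y = mass m (depth y) * amp_ld m (depth y) * (V y)\<^sup>2"

lemma supp_G: "G y \<noteq> 0 \<Longrightarrow> exp (- s1) \<le> norm y \<and> norm y \<le> exp (- s2)"
  using supp_Vu(1)[of y] by (auto simp: G_def)

lemma smooth_G: "Ck_on k UNIV G"
proof (rule extend_smooth)
  show "Ck_on k pball G"
    unfolding G_def power2_eq_square
    by (intro Ck_on_mult Ck_on_mass Ck_on_amp_ld Ck_on_depth m1 open_pball depth_pos zero_notin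
      Ck_on_subset[OF smooth_V]) auto
qed (rule supp_G)

lemma egrad_G:
  assumes y: "y \<in> pball"
  shows "egrad G y = (2 * mass m (depth y) * amp_ld m (depth y) * V y) *\<^sub>R egrad V y
    - (dflux m (depth y) * (V y)\<^sup>2 / norm y) *\<^sub>R sgn y"
proof -
  have dV: "V differentiable (at y)" using smooth_V[of 1] by simp
  have "(G has_derivative (\<lambda>h. (mass m (depth y) * amp_ld m (depth y)) * (V y * (egrad V y \<bullet> h) + (egrad V y \<bullet> h) * V y)
      + ((- (dflux m (depth y) / norm y)) *\<^sub>R sgn y \<bullet> h) * (V y * V y))) (at y)"
    unfolding G_def[abs_def] power2_eq_square
    by (rule has_derivative_mult[OF radial_has_derivative[OF y DERIV_flux[OF m1 depth_pos[OF y]]]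
      has_derivative_mult[OF has_derivative_egrad[OF dV] has_derivative_egrad[OF dV]]])
  then have "(G has_derivative (\<lambda>h. ((2 * mass m (depth y) * amp_ld m (depth y) * V y) *\<^sub>R egrad V y
    - (dflux m (depth y) * (V y)\<^sup>2 / norm y) *\<^sub>R sgn y) \<bullet> h)) (at y)"
    by (rule has_derivative_eq_rhs) (simp add: fun_eq_iff inner_diff_left algebra_simps power2_eq_square)
  then show ?thesis by (rule egrad_eq)
qed

text \<open>The square of the amplitude contains \<open>sinh s powr m\<close>, which cancels the
  power of \<open>sinh s\<close> in the conformal factor. What is left is
  \<open>norm y powr - m\<close>, the weight of the gradient on the flat cylinder, and
  \<open>mass\<close>.\<close>

lemma conf_pow_amp:
  assumes y: "y \<in> pball"
  shows "conf_factor y ^ (CARD('n) - 2) * (amp m (depth y))\<^sup>2 = norm y powr - m * mass m (depth y)"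
proof -
  have s: "0 < depth y" and ny: "0 < norm y" using y depth_pos by (auto simp: pball_iff)
  have sh: "0 < sinh (depth y)" "0 < sinh (stretch m (depth y))" "0 < dstretch m (depth y)"
    using sinh_nz[OF m1 s] dstretch_pos[OF m1 s] by auto
  have "conf_factor y ^ (CARD('n) - 2) = (1 / (norm y * sinh (depth y))) powr m"
    using ny sh by (subst powr_m) (auto simp: conf_factor_depth[OF y])
  also have "\<dots> = norm y powr - m * sinh (depth y) powr - m"
    using ny sh by (simp add: powr_divide powr_mult powr_minus field_simps)
  finally have c: "conf_factor y ^ (CARD('n) - 2) = norm y powr - m * sinh (depth y) powr - m" .
  have "(amp m (depth y))\<^sup>2 = (sinh (depth y) / sinh (stretch m (depth y))) powr m / dstretch m (depth y)"
    using sh by (simp add: amp_def power_divide powr_power)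
  also have "\<dots> = sinh (depth y) powr m * sinh (stretch m (depth y)) powr - m / dstretch m (depth y)"
    using sh by (simp add: powr_divide powr_minus_divide)
  finally have K: "(amp m (depth y))\<^sup>2 = sinh (depth y) powr m * sinh (stretch m (depth y)) powr - m / dstretch m (depth y)" .
  show ?thesis using sh unfolding c K mass_def by (simp add: powr_minus field_simps)
qed

text \<open>The Jacobian supplies one factor \<open>T'\<close>, and since \<open>mass\<close>
  contains \<open>1 / T'\<close> the weight appears as \<open>mass * T'^2\<close>. In this form it
  matches both the bound for the gradient of \<open>V\<close> and the right-hand side of
  \<open>riccati_ineq\<close>.\<close>

lemma conf_pow_rmap:
  assumes y: "y \<in> pball"
  shows "(norm (rmap m y) / norm y) ^ CARD('n) * dstretch m (depth y) * conf_factor (rmap m y) ^ (CARD('n) - 2)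
    = (norm (rmap m y) / norm y)\<^sup>2 * norm y powr - m * (mass m (depth y) * (dstretch m (depth y))\<^sup>2)"
proof -
  have s: "0 < depth y" and ny: "0 < norm y" "y \<noteq> 0" using y depth_pos by (auto simp: pball_iff)
  have px: "rmap m y \<in> pball" and np: "0 < norm (rmap m y)" using rmap_pball[OF m1 y] by (auto simp: pball_iff)
  have sh: "0 < sinh (stretch m (depth y))" "0 < dstretch m (depth y)"
    using sinh_nz[OF m1 s] dstretch_pos[OF m1 s] by auto
  have c: "conf_factor (rmap m y) ^ (CARD('n) - 2) = norm (rmap m y) powr - m * sinh (stretch m (depth y)) powr - m"
  proof -
    have "conf_factor (rmap m y) ^ (CARD('n) - 2) = (1 / (norm (rmap m y) * sinh (stretch m (depth y)))) powr m"
      using np sh by (subst powr_m) (auto simp: conf_factor_depth[OF px] depth_rmap[OF ny(2)])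
    then show ?thesis using np sh by (simp add: powr_divide powr_mult powr_minus field_simps)
  qed
  have "(norm (rmap m y) / norm y) ^ (CARD('n) - 2) = norm (rmap m y) powr m * norm y powr - m"
    using ny np by (subst powr_m[symmetric]) (auto simp: powr_divide powr_minus_divide)
  then show ?thesis using np sh ny unfolding c power_n mass_def
    by (simp add: powr_minus power2_eq_square field_simps)
qed

text \<open>The radial divergence on the left turns the cross term of the squared gradient into a potential.\<close>
lemma pointwise:
  assumes y: "y \<in> pball"
  shows "energy u y + norm y powr (- real CARD('n)) * (y \<bullet> egrad G y)
    \<le> (\<bar>norm (rmap m y) / norm y\<bar> ^ CARD('n) * \<bar>1 + (dstretch m (depth y) - 1)\<bar>) *
      (energy v (rmap m y) - (m / 2)\<^sup>2 * conf_factor (rmap m y) ^ (CARD('n) - 2) * (v (rmap m y))\<^sup>2 / (norm (rmap m y))\<^sup>2)"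
proof -
  define s H \<kappa> D \<mu> w e N where "s = depth y" and "H = mass m (depth y)" and "\<kappa> = amp_ld m (depth y)" and "D = dstretch m (depth y)"
    and "\<mu> = norm (rmap m y) / norm y" and "w = egrad v (rmap m y)" and "e = sgn y" and "N = norm y powr - m"
  have sp: "0 < depth y" and ny: "0 < norm y" "y \<noteq> 0" using y depth_pos by (auto simp: pball_iff)
  have px: "rmap m y \<in> pball" and np: "0 < norm (rmap m y)" using rmap_pball[OF m1 y] by (auto simp: pball_iff)
  have D1: "1 \<le> D" unfolding D_def by (rule dstretch_ge_1[OF m1 sp])
  have Hp: "0 < H" unfolding H_def by (rule mass_pos[OF m1 sp])
  have Np: "0 < N" using ny by (simp add: N_def)
  have ee: "e \<bullet> e = 1" using ny by (simp add: e_def flip: power2_norm_eq_inner) (simp add: norm_sgn)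
  have ye: "y = norm y *\<^sub>R e" using ny by (simp add: e_def sgn_div_norm)
  have vV: "v (rmap m y) = V y" using y by (simp add: V_def)
  have c2: "(conf_factor y)\<^sup>2 = 1 / ((norm y)\<^sup>2 * (sinh s)\<^sup>2)"
    by (simp add: conf_factor_depth[OF y] s_def power_divide power_mult_distrib)
  have c2': "(conf_factor (rmap m y))\<^sup>2 = 1 / ((norm (rmap m y))\<^sup>2 * (sinh (stretch m s))\<^sup>2)"
    using depth_rmap[OF ny(2), of m] by (simp add: conf_factor_depth[OF px] s_def power_divide power_mult_distrib)
  have gV: "(norm (egrad V y))\<^sup>2 \<le> \<mu>\<^sup>2 * (D\<^sup>2 * (norm w)\<^sup>2)"
  proof -
    have "(norm (egrad V y))\<^sup>2 = \<mu>\<^sup>2 * ((norm w)\<^sup>2 + (D\<^sup>2 - 1) * (e \<bullet> w)\<^sup>2)"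
      unfolding egrad_V[OF y] power2_norm_eq_inner \<mu>_def[symmetric] w_def[symmetric] e_def[symmetric] D_def[symmetric]
      using ee by (simp add: inner_add_left inner_add_right inner_commute power2_eq_square algebra_simps)
    \<comment> \<open>Only the radial part of the gradient carries the factor \<open>D^2\<close>.
      Since \<open>D >= 1\<close>, the angular part may be enlarged by the same factor.\<close>
    also have "\<dots> \<le> \<mu>\<^sup>2 * ((norm w)\<^sup>2 + (D\<^sup>2 - 1) * (norm w)\<^sup>2)"
    proof (intro mult_left_mono add_left_mono)
      have "\<bar>e \<bullet> w\<bar> \<le> norm w" using Cauchy_Schwarz_ineq2[of e w] ee by (simp add: norm_eq_sqrt_inner)
      then show "(e \<bullet> w)\<^sup>2 \<le> (norm w)\<^sup>2" by (simp add: abs_le_square_iff[symmetric])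
      show "0 \<le> D\<^sup>2 - 1" using D1 by simp
    qed simp
    finally show ?thesis by (simp add: algebra_simps)
  qed
  have P: "energy u y = N * H * ((norm (egrad V y))\<^sup>2 - 2 * (\<kappa> * V y / norm y) * (e \<bullet> egrad V y) + (\<kappa> * V y / norm y)\<^sup>2)
     - ((m + 1) / 2)\<^sup>2 * (N * H) * (V y)\<^sup>2 / ((norm y)\<^sup>2 * (sinh s)\<^sup>2)"
  proof -
    have g: "(norm (egrad u y))\<^sup>2 = (amp m (depth y))\<^sup>2 * ((norm (egrad V y))\<^sup>2
        - 2 * (\<kappa> * V y / norm y) * (e \<bullet> egrad V y) + (\<kappa> * V y / norm y)\<^sup>2)"
      unfolding egrad_u[OF y] power2_norm_eq_inner \<kappa>_def[symmetric] e_def[symmetric]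
      using ee by (simp add: inner_diff_left inner_diff_right inner_commute power2_eq_square algebra_simps)
    have uV: "u y = amp m (depth y) * V y" using y by (simp add: u_def V_def)
    have "energy u y = (conf_factor y ^ (CARD('n) - 2) * (amp m (depth y))\<^sup>2) * ((norm (egrad V y))\<^sup>2
        - 2 * (\<kappa> * V y / norm y) * (e \<bullet> egrad V y) + (\<kappa> * V y / norm y)\<^sup>2)
      - ((m + 1) / 2)\<^sup>2 * (conf_factor y ^ (CARD('n) - 2) * (amp m (depth y))\<^sup>2) * ((V y)\<^sup>2 * (conf_factor y)\<^sup>2)"
      unfolding energy_def g uV n_minus_1 power_n by (simp add: power_mult_distrib mult_ac)
    then show ?thesis unfolding conf_pow_amp[OF y] N_def[symmetric] H_def[symmetric] c2 by simp
  qed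
  have R: "norm y powr (- real CARD('n)) * (y \<bullet> egrad G y)
      = N / (norm y)\<^sup>2 * (2 * H * \<kappa> * V y * norm y * (e \<bullet> egrad V y) - dflux m s * (V y)\<^sup>2)"
  proof -
    have "y \<bullet> egrad G y = 2 * H * \<kappa> * V y * norm y * (e \<bullet> egrad V y) - dflux m s * (V y)\<^sup>2"
    proof -
      have yi: "y \<bullet> g = norm y * (e \<bullet> g)" for g using ye by (metis inner_scaleR_left)
      show ?thesis
        unfolding egrad_G[OF y] inner_diff_right inner_scaleR_right yi
        using ny ee by (simp add: H_def \<kappa>_def s_def flip: e_def)
    qed
    then show ?thesis using powr_n[OF ny(1)] by (simp add: N_def)
  qed
  have Q: "(\<bar>norm (rmap m y) / norm y\<bar> ^ CARD('n) * \<bar>1 + (dstretch m (depth y) - 1)\<bar>) *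
      (energy v (rmap m y) - (m / 2)\<^sup>2 * conf_factor (rmap m y) ^ (CARD('n) - 2) * (v (rmap m y))\<^sup>2 / (norm (rmap m y))\<^sup>2)
     = N * (H * D\<^sup>2) * (\<mu>\<^sup>2 * (norm w)\<^sup>2) - N / (norm y)\<^sup>2 * (V y)\<^sup>2 *
        (H * D\<^sup>2 * (((m + 1) / 2)\<^sup>2 / (sinh (stretch m s))\<^sup>2 + (m / 2)\<^sup>2))"
  proof -
    have "(\<bar>norm (rmap m y) / norm y\<bar> ^ CARD('n) * \<bar>1 + (dstretch m (depth y) - 1)\<bar>) *
      (energy v (rmap m y) - (m / 2)\<^sup>2 * conf_factor (rmap m y) ^ (CARD('n) - 2) * (v (rmap m y))\<^sup>2 / (norm (rmap m y))\<^sup>2)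
      = ((norm (rmap m y) / norm y) ^ CARD('n) * dstretch m (depth y) * conf_factor (rmap m y) ^ (CARD('n) - 2)) *
        ((norm w)\<^sup>2 - ((m + 1) / 2)\<^sup>2 * (conf_factor (rmap m y))\<^sup>2 * (V y)\<^sup>2 - (m / 2)\<^sup>2 * (V y)\<^sup>2 / (norm (rmap m y))\<^sup>2)"
      using D1 unfolding energy_def vV n_minus_1 power_n w_def[symmetric] D_def by (simp add: algebra_simps)
    also have "\<dots> = \<mu>\<^sup>2 * N * (H * D\<^sup>2) *
        ((norm w)\<^sup>2 - ((m + 1) / 2)\<^sup>2 * (1 / ((norm (rmap m y))\<^sup>2 * (sinh (stretch m s))\<^sup>2)) * (V y)\<^sup>2
          - (m / 2)\<^sup>2 * (V y)\<^sup>2 / (norm (rmap m y))\<^sup>2)"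
      unfolding conf_pow_rmap[OF y] c2' by (simp add: \<mu>_def N_def H_def D_def)
    also have "\<dots> = N * (H * D\<^sup>2) * (\<mu>\<^sup>2 * (norm w)\<^sup>2) - N * (\<mu>\<^sup>2 / (norm (rmap m y))\<^sup>2) * (V y)\<^sup>2 *
        (H * D\<^sup>2 * (((m + 1) / 2)\<^sup>2 / (sinh (stretch m s))\<^sup>2 + (m / 2)\<^sup>2))"
      by (simp add: algebra_simps)
    also have "\<mu>\<^sup>2 / (norm (rmap m y))\<^sup>2 = 1 / (norm y)\<^sup>2"
      using np by (simp add: \<mu>_def power_divide)
    finally show ?thesis by simp
  qed
  have "energy u y + norm y powr (- real CARD('n)) * (y \<bullet> egrad G y)
    = N * H * (norm (egrad V y))\<^sup>2 + N / (norm y)\<^sup>2 * (V y)\<^sup>2 * (H * \<kappa>\<^sup>2 - dflux m s - ((m + 1) / 2)\<^sup>2 * H / (sinh s)\<^sup>2)"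
  proof -
    have alg: "N * H * (g - 2 * (k * w / n) * d + (k * w / n)\<^sup>2) - M * (N * H) * w\<^sup>2 * T / n\<^sup>2
        + N / n\<^sup>2 * (2 * H * k * w * n * d - G * w\<^sup>2)
      = N * H * g + N / n\<^sup>2 * w\<^sup>2 * (H * k\<^sup>2 - G - M * H * T)"
      if "n \<noteq> 0" for g k w n d M T G :: real
      using that by (simp add: power2_eq_square field_simps)
    show ?thesis
      unfolding P R using alg[of "norm y" "(norm (egrad V y))\<^sup>2" \<kappa> "V y" "e \<bullet> egrad V y" "((m + 1) / 2)\<^sup>2"
        "1 / (sinh s)\<^sup>2" "dflux m s"] ny by (simp add: mult.commute[of "(norm y)\<^sup>2"])
  qed
  also have "\<dots> \<le> N * H * (\<mu>\<^sup>2 * (D\<^sup>2 * (norm w)\<^sup>2)) + N / (norm y)\<^sup>2 * (V y)\<^sup>2 *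
      (- (H * D\<^sup>2 * (((m + 1) / 2)\<^sup>2 / (sinh (stretch m s))\<^sup>2 + (m / 2)\<^sup>2)))"
    using gV Np Hp riccati_ineq[OF m1 sp] ny unfolding H_def \<kappa>_def D_def s_def
    by (intro add_mono mult_left_mono) auto
  also have "\<dots> = N * (H * D\<^sup>2) * (\<mu>\<^sup>2 * (norm w)\<^sup>2) - N / (norm y)\<^sup>2 * (V y)\<^sup>2 *
        (H * D\<^sup>2 * (((m + 1) / 2)\<^sup>2 / (sinh (stretch m s))\<^sup>2 + (m / 2)\<^sup>2))"
    by (simp add: algebra_simps)
  finally show ?thesis unfolding Q .
qed

end

section \<open>Integrating the pointwise comparison over the ball\<close>

lemma egrad_zero_annulus:
  fixes f :: "real ^ 'n \<Rightarrow> real"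
  assumes "\<And>x. f x \<noteq> 0 \<Longrightarrow> a \<le> norm x \<and> norm x \<le> b" "\<not> (a \<le> norm x \<and> norm x \<le> b)"
  shows "egrad f x = 0"
proof -
  have "open ({x::real^'n. norm x < a} \<union> {x. b < norm x})"
    by (intro open_Un open_Collect_less continuous_intros)
  then have "partial f i x = 0" for i
  proof (rule partial_zero)
    show "x \<in> {x. norm x < a} \<union> {x. b < norm x}" using assms(2) by auto
    show "f y = 0" if "y \<in> {x. norm x < a} \<union> {x. b < norm x}" for y
      using assms(1)[of y] that by (cases "f y = 0") auto
  qed
  then show ?thesis by (simp add: vec_eq_iff)
qed

lemma continuous_on_egrad:
  fixes f :: "real ^ 'n \<Rightarrow> real"
  assumes "Ck_on 1 UNIV f" shows "continuous_on S (egrad f)"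
proof -
  have "continuous_on UNIV (\<lambda>x. egrad f x $ i)" for i using assms by simp
  then have "continuous_on UNIV (\<lambda>x. \<chi> i. egrad f x $ i)" by (intro continuous_on_vec_lambda)
  then have "continuous_on UNIV (\<lambda>x. egrad f x)"
    by (rule continuous_on_eq) (simp add: vec_eq_iff)
  then show ?thesis by (rule continuous_on_subset) simp
qed

lemma conf_factor_pos: "norm x < 1 \<Longrightarrow> 0 < conf_factor x"
  by (simp add: conf_factor_def abs_square_less_1)

lemma continuous_on_conf_factor:
  assumes "\<And>x. x \<in> S \<Longrightarrow> norm x < 1" shows "continuous_on S (conf_factor :: real ^ 'n \<Rightarrow> real)"
  unfolding conf_factor_def
proof (intro continuous_intros ballI)
  fix x :: "real ^ 'n" assume "x \<in> S"
  then have "(norm x)\<^sup>2 < 1" using assms by (simp add: abs_square_less_1)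
  then show "1 - (norm x)\<^sup>2 \<noteq> 0" by simp
qed

lemma continuous_on_energy:
  fixes f :: "real ^ 'n \<Rightarrow> real"
  assumes "Ck_on 1 UNIV f" "\<And>x. x \<in> S \<Longrightarrow> norm x < 1"
  shows "continuous_on S (energy f)"
proof -
  have "continuous_on S f"
    using Ck_on_le[OF assms(1), of 0] by (auto intro: continuous_on_subset)
  then show ?thesis unfolding energy_def
    by (intro continuous_intros continuous_on_conf_factor continuous_on_egrad assms)
qed

lemma energy_zero_annulus:
  fixes f :: "real ^ 'n \<Rightarrow> real"
  assumes "\<And>x. f x \<noteq> 0 \<Longrightarrow> a \<le> norm x \<and> norm x \<le> b" "\<not> (a \<le> norm x \<and> norm x \<le> b)"
  shows "energy f x = 0"
proof -
  have "f x = 0" using assms by blast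
  then show ?thesis using egrad_zero_annulus[of f a b x] assms by (simp add: energy_def)
qed

lemma continuous_on_depth: "0 \<notin> S \<Longrightarrow> continuous_on S depth"
  unfolding depth_def by (intro continuous_intros) auto

lemma indicator_continuous_borel:
  fixes f :: "real ^ 'n \<Rightarrow> real"
  assumes "A \<in> sets borel" "continuous_on A f" shows "(\<lambda>x. indicator A x * f x) \<in> borel_measurable borel"
  using borel_measurable_continuous_on_indicator[OF assms] by simp

context annular
begin

lemma annulus_r_pball: "r1 \<le> norm x \<Longrightarrow> norm x \<le> r2 \<Longrightarrow> x \<in> pball"
  using r unfolding pball_iff by linarith

abbreviation jac :: "real ^ 'n \<Rightarrow> real"
  where "jac y \<equiv> \<bar>norm (rmap m y) / norm y\<bar> ^ CARD('n) * \<bar>1 + (dstretch m (depth y) - 1)\<bar>"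

lemma continuous_on_rmap: "continuous_on pball (rmap m)"
  by (rule has_derivative_continuous_on[OF has_derivative_at_withinI[OF has_derivative_rmap[OF m1]]])

lemma continuous_on_jac: "continuous_on pball jac"
proof -
  have "Ck_on 0 pball (\<lambda>y. dstretch m (depth y))"
    by (intro Ck_on_dstretch m1 open_pball Ck_on_depth zero_notin depth_pos)
  then have "continuous_on pball (\<lambda>y. dstretch m (depth y))" by simp
  then show ?thesis
    by (intro continuous_intros continuous_on_rmap) (auto simp: pball_def)
qed

text \<open>The radial map takes the support to a compact annulus, on which the pulled-back
  integrand is continuous. This supplies the integrability needed to compare integrals
  monotonically.\<close>

lemma pull_back:
  assumes q: "continuous_on pball q" "\<And>x. q x \<noteq> 0 \<Longrightarrow> r1 \<le> norm x \<and> norm x \<le> r2"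
  shows "integrable lborel (\<lambda>y. indicator pball y * (jac y * q (rmap m y)))" (is "integrable _ ?I")
    "(LINT y|lborel. indicator pball y * (jac y * q (rmap m y))) = (LINT x|lborel. q x)"
proof -
  have c: "continuous_on pball (\<lambda>y. jac y * q (rmap m y))"
    by (intro continuous_on_mult continuous_on_jac continuous_on_compose2[OF q(1) continuous_on_rmap])
      (use rmap_pball[OF m1] in auto)
  show "integrable lborel ?I"
  proof (rule integrable_annulus)
    let ?A = "{y::real^'n. exp (- s1) \<le> norm y \<and> norm y \<le> exp (- s2)}"
    have "continuous_on ?A (\<lambda>y. jac y * q (rmap m y))"
      by (rule continuous_on_subset[OF c]) (use annulus_pball in auto)
    then show "continuous_on ?A ?I"
    proof (rule continuous_on_eq)
      fix y assume "y \<in> ?A"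
      then have "y \<in> pball" by (intro annulus_pball) auto
      then show "jac y * q (rmap m y) = ?I y" by simp
    qed
    show "?I y = 0" if "\<not> (exp (- s1) \<le> norm y \<and> norm y \<le> exp (- s2))" for y
      using supp_rmap[of y] q(2)[of "rmap m y"] that by (cases "y \<in> pball \<and> q (rmap m y) \<noteq> 0") auto
  qed
  have "(LINT x|lborel. indicator (rmap m ` pball) x * q x) = (LINT y|lborel. ?I y)"
    unfolding mult.assoc[symmetric]
  proof (rule change_of_variables_rank_one[unfolded mult.assoc[symmetric]])
    show "(rmap m has_derivative (\<lambda>h. (norm (rmap m x) / norm x) *\<^sub>R (h + ((dstretch m (depth x) - 1) * (sgn x \<bullet> h)) *\<^sub>R sgn x))) (at x)"
      if "x \<in> pball" for x using has_derivative_rmap[OF m1 that] .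
    show "norm (sgn x) = 1" if "x \<in> pball" for x :: "real ^ 'n" using that by (auto simp: norm_sgn pball_iff)
    show "inj_on (rmap m) pball" by (rule inj_on_rmap[OF m1])
    show "rmap m ` pball \<in> sets borel" unfolding image_rmap[OF m1] by (rule pball_borel)
    show "(\<lambda>x. indicator (rmap m ` pball) x * q x) \<in> borel_measurable borel"
      unfolding image_rmap[OF m1] by (rule indicator_continuous_borel[OF pball_borel q(1)])
    show "(\<lambda>x. indicator pball x * \<bar>norm (rmap m x) / norm x\<bar> ^ CARD('n) * \<bar>1 + (dstretch m (depth x) - 1)\<bar> * q (rmap m x)) \<in> borel_measurable borel"
      using indicator_continuous_borel[OF pball_borel c] by (simp add: mult.assoc)
  qed (rule pball_borel)
  moreover have "indicator (rmap m ` pball) x * q x = q x" for x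
    unfolding image_rmap[OF m1] using q(2)[of x] annulus_r_pball[of x] by (cases "q x = 0") auto
  ultimately show "(LINT y|lborel. ?I y) = (LINT x|lborel. q x)" by simp
qed

lemma integrable_r_annulus:
  fixes q :: "real ^ 'n \<Rightarrow> real"
  assumes "continuous_on pball q" "\<And>x. q x \<noteq> 0 \<Longrightarrow> r1 \<le> norm x \<and> norm x \<le> r2"
  shows "integrable lborel q"
  by (rule integrable_annulus[of r1 r2, OF continuous_on_subset[OF assms(1)]])
    (use assms(2) annulus_r_pball in auto)

text \<open>The Lebesgue density of \<open>v^2 / sinh^2 \<rho>\<close>, because
  \<open>sinh \<rho> = norm x * conf_factor x\<close>.\<close>

definition hardy :: "real ^ 'n \<Rightarrow> real"
  where "hardy x = conf_factor x ^ (CARD('n) - 2) * (v x)\<^sup>2 / (norm x)\<^sup>2"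

lemma continuous_v: "continuous_on S v"
  using smooth[of 0] by (auto intro: continuous_on_subset)

lemma continuous_on_hardy: "continuous_on pball hardy"
  unfolding hardy_def
  by (intro continuous_intros continuous_on_conf_factor continuous_v) (auto simp: pball_iff)

lemma integrable_energy_hardy: "integrable lborel (energy v)" "integrable lborel hardy"
proof -
  show "integrable lborel (energy v)"
    by (rule integrable_r_annulus[OF continuous_on_energy[OF smooth]])
      (use energy_zero_annulus[of v, OF supp] in \<open>auto simp: pball_iff\<close>)
  show "integrable lborel hardy"
    by (rule integrable_r_annulus[OF continuous_on_hardy]) (use supp in \<open>auto simp: hardy_def\<close>)
qed

text \<open>Integrate \<open>pointwise\<close>: the term with \<open>G\<close> is a radial
  divergence and has integral 0, and the right-hand side is the pull-back of the energy of
  \<open>v\<close> minus its Hardy term.\<close>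

lemma energy_u_le: "(LINT x|lborel. energy u x) \<le> (LINT x|lborel. energy v x) - (m / 2)\<^sup>2 * (LINT x|lborel. hardy x)"
proof -
  let ?A = "{y::real^'n. exp (- s1) \<le> norm y \<and> norm y \<le> exp (- s2)}"
  have int_u: "integrable lborel (energy u)"
    by (rule integrable_annulus[OF continuous_on_energy[OF smooth_u] energy_zero_annulus[OF supp_Vu(2)]])
      (use annulus_pball in \<open>auto simp: pball_iff\<close>)
  let ?R = "\<lambda>y. norm y powr (- real CARD('n)) * (y \<bullet> egrad G y)"
  have R: "integrable lborel ?R" "(LINT y|lborel. ?R y) = 0"
    using radial_integral_eq_0[OF smooth_G, of "exp (- s1)" "exp (- s2)"] supp_G by force+
  let ?q = "\<lambda>x. energy v x - (m / 2)\<^sup>2 * hardy x"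
  have q: "continuous_on pball ?q" "\<And>x. ?q x \<noteq> 0 \<Longrightarrow> r1 \<le> norm x \<and> norm x \<le> r2"
  proof -
    show "continuous_on pball ?q"
      by (intro continuous_intros continuous_on_hardy continuous_on_energy[OF smooth]) (auto simp: pball_iff)
    show "r1 \<le> norm x \<and> norm x \<le> r2" if "?q x \<noteq> 0" for x
    proof (rule ccontr)
      assume *: "\<not> (r1 \<le> norm x \<and> norm x \<le> r2)"
      then have "v x = 0" "energy v x = 0" using supp energy_zero_annulus[of v, OF supp] by blast+
      then show False using that by (simp add: hardy_def)
    qed
  qed
  have "(LINT x|lborel. energy u x) = (LINT x|lborel. energy u x + ?R x)"
    using int_u R by simp
  also have "\<dots> \<le> (LINT y|lborel. indicator pball y * (jac y * ?q (rmap m y)))"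
  proof (rule integral_mono)
    show "integrable lborel (\<lambda>x. energy u x + ?R x)" using int_u R by simp
    show "integrable lborel (\<lambda>y. indicator pball y * (jac y * ?q (rmap m y)))" by (rule pull_back(1)[OF q])
    show "energy u y + ?R y \<le> indicator pball y * (jac y * ?q (rmap m y))" for y
    proof (cases "y \<in> pball")
      case True
      then show ?thesis using pointwise[OF True] True by (simp add: hardy_def mult.assoc)
    next
      case False
      then have *: "\<not> (exp (- s1) \<le> norm y \<and> norm y \<le> exp (- s2))" using annulus_pball by blast
      have "energy u y = 0" by (rule energy_zero_annulus[OF supp_Vu(2) *])
      moreover have "egrad G y = 0" by (rule egrad_zero_annulus[OF supp_G *])
      ultimately show ?thesis using False by simp
    qed
  qed
  also have "\<dots> = (LINT x|lborel. ?q x)" by (rule pull_back(2)[OF q])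
  also have "\<dots> = (LINT x|lborel. energy v x) - (m / 2)\<^sup>2 * (LINT x|lborel. hardy x)"
    using integrable_energy_hardy by simp
  finally show "(LINT x|lborel. energy u x) \<le> (LINT x|lborel. energy v x) - (m / 2)\<^sup>2 * (LINT x|lborel. hardy x)" .
qed

text \<open>The Jacobian gives \<open>T'\<close> and the amplitude in \<open>u\<close> gives
  \<open>T' powr (- p / 2)\<close>; their quotient is \<open>T' powr ((p + 2) / 2)\<close>, which
  explains the exponent on the logarithmic weight. As \<open>T' <= m (T + L)\<close>, the factor
  \<open>1 / (L + T)\<close> absorbs it up to the power of \<open>m\<close>.\<close>

lemma weighted_norm_le:
  assumes p: "2 < p" and L: "200 \<le> L"
  shows "(LINT x|lborel. indicator pball x * (norm x powr - real CARD('n) * sinh (depth x) powr - (p * m / 2)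
      * (1 / (L + depth x)) powr ((p + 2) / 2) * \<bar>v x\<bar> powr p))
    \<le> m powr ((p + 2) / 2) * (LINT x|lborel. indicator pball x * (norm x powr - real CARD('n)
      * sinh (depth x) powr - (p * m / 2) * \<bar>u x\<bar> powr p))"
proof -
  let ?q = "\<lambda>x. norm x powr - real CARD('n) * sinh (depth x) powr - (p * m / 2)
      * (1 / (L + depth x)) powr ((p + 2) / 2) * \<bar>v x\<bar> powr p"
  let ?U = "\<lambda>x. indicator pball x * (norm x powr - real CARD('n) * sinh (depth x) powr - (p * m / 2) * \<bar>u x\<bar> powr p)"
  have csinh: "continuous_on S (\<lambda>x. sinh (depth x) powr - (p * m / 2))" if "S \<subseteq> pball" for S :: "(real ^ 'n) set"
  proof (intro continuous_on_powr continuous_intros continuous_on_depth ballI)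
    show "0 \<notin> S" using that zero_notin by blast
    show "sinh (depth x) \<noteq> 0" if "x \<in> S" for x using depth_pos[of x] that \<open>S \<subseteq> pball\<close> by auto
  qed
  have cn: "continuous_on S (\<lambda>x. norm x powr - real CARD('n))" if "S \<subseteq> pball" for S :: "(real ^ 'n) set"
    by (intro continuous_intros) (use that in \<open>auto simp: pball_iff\<close>)
  have q: "continuous_on pball ?q" "\<And>x. ?q x \<noteq> 0 \<Longrightarrow> r1 \<le> norm x \<and> norm x \<le> r2"
  proof -
    have "L + depth x \<noteq> 0" "1 / (L + depth x) \<noteq> 0" if "x \<in> pball" for x :: "real ^ 'n" using depth_pos[OF that] L by auto
    then have "continuous_on pball (\<lambda>x::real^'n. (1 / (L + depth x)) powr ((p + 2) / 2))"
      by (intro continuous_intros continuous_on_depth) (auto simp: pball_iff)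
    moreover have "continuous_on pball (\<lambda>x. \<bar>v x\<bar> powr p)"
      using p by (intro continuous_on_powr' continuous_intros continuous_v) auto
    ultimately show "continuous_on pball ?q"
      by (intro continuous_on_mult csinh cn) auto
  qed (use supp p in auto)
  have key: "indicator pball y * (jac y * ?q (rmap m y)) \<le> m powr ((p + 2) / 2) * ?U y" for y
  proof (cases "y \<in> pball")
    case True
    define s D Th where "s = depth y" and "D = dstretch m (depth y)" and "Th = stretch m (depth y)"
    have sp: "0 < depth y" and ny: "0 < norm y" "y \<noteq> 0" using True depth_pos by (auto simp: pball_iff)
    have np: "0 < norm (rmap m y)" using rmap_pball[OF m1 True] by (auto simp: pball_iff)
    have pos: "0 < sinh s" "0 < sinh Th" "0 < D" "0 < Th"
      using sinh_nz[OF m1 sp] dstretch_pos[OF m1 sp] stretch_pos[OF m1 sp] by (auto simp: s_def D_def Th_def)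
    have sT: "depth (rmap m y) = Th" using depth_rmap[OF ny(2)] by (simp add: Th_def)
    have j: "jac y * norm (rmap m y) powr - real CARD('n) = D * norm y powr - real CARD('n)"
      using ny np pos unfolding D_def
      by (simp add: powr_minus powr_realpow power_divide field_simps)
    have K: "amp m (depth y) powr p = sinh s powr (p * m / 2) * sinh Th powr - (p * m / 2) * D powr - (p / 2)"
    proof -
      have "amp m (depth y) powr p = ((sinh s / sinh Th) powr (m / 2)) powr p / (D powr (1 / 2)) powr p"
      proof -
        have "amp m (depth y) = (sinh s / sinh Th) powr (m / 2) / sqrt D" by (simp add: amp_def s_def Th_def D_def)
        then show ?thesis using pos by (simp add: powr_divide powr_mult powr_half_sqrt)
      qed
      also have "\<dots> = sinh s powr (p * m / 2) / sinh Th powr (p * m / 2) / D powr (p / 2)"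
      proof -
        have e: "m / 2 * p = p * m / 2" "1 / 2 * p = p / 2" by simp_all
        show ?thesis unfolding powr_powr e using pos by (simp add: powr_divide)
      qed
      finally show ?thesis unfolding powr_minus_divide by simp
    qed
    have lhs: "jac y * ?q (rmap m y) = norm y powr - real CARD('n) * sinh Th powr - (p * m / 2) * \<bar>v (rmap m y)\<bar> powr p
        * (D * (1 / (L + Th)) powr ((p + 2) / 2))"
    proof -
      have alg: "A * (N * B * C * E) = n * B * E * (D * C)" if "A * N = D * n" for A N B C E n :: real
      proof -
        have "A * (N * B * C * E) = (A * N) * (B * C * E)" by (simp only: mult_ac)
        then show ?thesis unfolding that by (simp only: mult_ac)
      qed
      show ?thesis unfolding sT by (rule alg[OF j])
    qed
    have sinh1: "sinh s powr - (p * m / 2) * sinh s powr (p * m / 2) = 1"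
      using pos by (simp flip: powr_add)
    have ss: "n * sinh s powr - (p * m / 2) * (sinh s powr (p * m / 2) * T * d * w) = n * T * w * d" for n T d w
    proof -
      have "n * A * (B * T * d * w) = (A * B) * (n * T * w * d)" for A B :: real by (simp only: mult_ac)
      then show ?thesis using sinh1 by simp
    qed
    have "\<bar>u y\<bar> powr p = amp m (depth y) powr p * \<bar>v (rmap m y)\<bar> powr p"
      using True amp_pos[OF m1 sp] by (simp add: u_def abs_mult powr_mult)
    then have rhs: "norm y powr - real CARD('n) * sinh (depth y) powr - (p * m / 2) * \<bar>u y\<bar> powr p
      = norm y powr - real CARD('n) * sinh Th powr - (p * m / 2) * \<bar>v (rmap m y)\<bar> powr p * D powr - (p / 2)"
      unfolding K using ss by (simp only: s_def)
    have "D * (1 / (L + Th)) powr ((p + 2) / 2) = D powr - (p / 2) * (D * (1 / (L + Th))) powr ((p + 2) / 2)"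
    proof -
      have "D powr - (p / 2) * D powr ((p + 2) / 2) = D"
        using pos by (simp add: add_divide_distrib flip: powr_add)
      moreover have "(D * (1 / (L + Th))) powr ((p + 2) / 2) = D powr ((p + 2) / 2) * (1 / (L + Th)) powr ((p + 2) / 2)"
        using pos L by (intro powr_mult)
      ultimately show ?thesis by (simp only: mult.assoc[symmetric])
    qed
    also have "\<dots> \<le> D powr - (p / 2) * m powr ((p + 2) / 2)"
    proof (intro mult_left_mono powr_mono2)
      have "D \<le> m * (Th + 200)" using dstretch_le[OF m1 sp] by (simp add: D_def Th_def)
      also have "\<dots> \<le> m * (L + Th)" using L m1 by (intro mult_left_mono) auto
      finally show "D * (1 / (L + Th)) \<le> m" using L pos by (simp add: divide_le_eq)
    qed (use p pos L in auto)
    finally have "norm y powr - real CARD('n) * sinh Th powr - (p * m / 2) * \<bar>v (rmap m y)\<bar> powr p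
        * (D * (1 / (L + Th)) powr ((p + 2) / 2))
      \<le> norm y powr - real CARD('n) * sinh Th powr - (p * m / 2) * \<bar>v (rmap m y)\<bar> powr p
        * (D powr - (p / 2) * m powr ((p + 2) / 2))"
      by (intro mult_left_mono) auto
    then show ?thesis using True unfolding lhs rhs by (simp add: mult_ac)
  qed simp
  have intU: "integrable lborel ?U"
  proof (rule integrable_annulus)
    let ?A = "{y::real^'n. exp (- s1) \<le> norm y \<and> norm y \<le> exp (- s2)}"
    have A: "?A \<subseteq> pball" using annulus_pball by auto
    have cu: "continuous_on ?A u" using smooth_u[of 0] by (auto intro: continuous_on_subset)
    have "continuous_on ?A (\<lambda>x. norm x powr - real CARD('n) * sinh (depth x) powr - (p * m / 2) * \<bar>u x\<bar> powr p)"
      using p by (intro continuous_on_mult csinh cn A continuous_on_powr' continuous_intros cu) auto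
    then show "continuous_on ?A ?U" by (rule continuous_on_eq) (use A in auto)
    show "?U x = 0" if "\<not> (exp (- s1) \<le> norm x \<and> norm x \<le> exp (- s2))" for x
      using supp_Vu(2)[of x] that p by (cases "u x = 0") auto
  qed
  have "(LINT x|lborel. indicator pball x * ?q x) = (LINT x|lborel. ?q x)"
  proof (rule Bochner_Integration.integral_cong)
    show "indicator pball x * ?q x = ?q x" for x
      using q(2)[of x] annulus_r_pball[of x] by (cases "?q x = 0") auto
  qed simp
  also have "\<dots> = (LINT y|lborel. indicator pball y * (jac y * ?q (rmap m y)))"
    using pull_back(2)[OF q] by simp
  also have "\<dots> \<le> (LINT y|lborel. m powr ((p + 2) / 2) * ?U y)"
    using pull_back(1)[OF q] intU key by (intro integral_mono) auto
  also have "\<dots> = m powr ((p + 2) / 2) * (LINT y|lborel. ?U y)" by simp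
  finally show ?thesis .
qed

end

section \<open>Hyperbolic integrals and the Poincare inequality\<close>

lemma test_functionsE:
  fixes v :: "real ^ 'n \<Rightarrow> real"
  assumes "v \<in> test_functions"
  obtains R where "0 < R" "R < 1" "\<And>x. v x \<noteq> 0 \<Longrightarrow> norm x \<le> R" "\<And>k. Ck_on k UNIV v"
proof -
  let ?S = "closure {x. v x \<noteq> 0}"
  have S: "compact ?S" "?S \<subseteq> ball 0 1" and C: "Ck_on k UNIV v" for k
    using assms by (auto simp: test_functions_def C_k_iff)
  show ?thesis
  proof (cases "?S = {}")
    case True
    then have "v x = 0" for x by auto
    then show ?thesis using that[of "1/2"] C by simp
  next
    case False
    have "continuous_on ?S norm" by (intro continuous_intros)
    then obtain y where y: "y \<in> ?S" "\<And>x. x \<in> ?S \<Longrightarrow> norm x \<le> norm y"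
      using continuous_attains_sup[OF S(1) False] by blast
    have "norm y < 1" using y(1) S(2) by auto
    moreover have "norm x \<le> norm y" if "v x \<noteq> 0" for x
      using y(2) closure_subset[of "{x. v x \<noteq> 0}"] that by blast
    \<comment> \<open>The maximum with \<open>1 / 2\<close> keeps the radius positive whatever
      \<open>norm y\<close> is.\<close>
    ultimately show ?thesis using that[of "max (norm y) (1/2)"] C by fastforce
  qed
qed

lemma test_functionsI:
  fixes v :: "real ^ 'n \<Rightarrow> real"
  assumes "R < 1" "\<And>x. v x \<noteq> 0 \<Longrightarrow> norm x \<le> R" "\<And>k. Ck_on k UNIV v"
  shows "v \<in> test_functions"
proof -
  have "{x. v x \<noteq> 0} \<subseteq> cball 0 R" using assms(2) by auto
  then have cl: "closure {x. v x \<noteq> 0} \<subseteq> cball 0 R" by (intro closure_minimal) auto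
  then have "compact (closure {x. v x \<noteq> 0})"
    by (meson bounded_cball bounded_subset closed_closure compact_eq_bounded_closed)
  moreover have "cball 0 R \<subseteq> (hyp_space :: (real ^ 'n) set)" using assms(1) by auto
  ultimately show ?thesis using cl assms(3) by (auto simp: test_functions_def C_k_iff)
qed

lemma integral_hyp_volume:
  fixes F :: "real ^ 'n \<Rightarrow> real"
  assumes [measurable]: "F \<in> borel_measurable borel"
  shows "(LINT x|hyp_volume. F x) = (LINT x|lborel. indicator hyp_space x * (conf_factor x ^ CARD('n) * F x))"
proof -
  have c: "0 \<le> indicator hyp_space x * conf_factor x ^ CARD('n)" for x :: "real ^ 'n"
    using conf_factor_pos[of x] by (auto simp: indicator_def less_imp_le)
  have [measurable]: "(\<lambda>x::real^'n. indicator hyp_space x * conf_factor x ^ CARD('n)) \<in> borel_measurable borel"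
  proof (intro borel_measurable_times borel_measurable_indicator borel_measurable_power)
    show "(conf_factor :: real ^ 'n \<Rightarrow> real) \<in> borel_measurable borel"
      unfolding conf_factor_def[abs_def] by measurable
  qed simp
  show ?thesis unfolding hyp_volume_def
    by (subst integral_density) (use c in \<open>auto simp: mult.assoc\<close>)
qed

lemma measurable_test:
  fixes v :: "real ^ 'n \<Rightarrow> real"
  assumes "Ck_on 1 UNIV v"
  shows "v \<in> borel_measurable borel" "hyp_grad_norm v \<in> borel_measurable borel"
proof -
  show "v \<in> borel_measurable borel"
    using Ck_on_le[OF assms, of 0] by (auto intro: borel_measurable_continuous_onI)
  have [measurable]: "egrad v \<in> borel_measurable borel"
    by (rule borel_measurable_continuous_onI[OF continuous_on_egrad[OF assms]])
  have "hyp_grad_norm v = (\<lambda>x. sqrt ((2 / (1 - (norm x)\<^sup>2))\<^sup>2 *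
    (((1 / (2 / (1 - (norm x)\<^sup>2))\<^sup>2) *\<^sub>R egrad v x) \<bullet> ((1 / (2 / (1 - (norm x)\<^sup>2))\<^sup>2) *\<^sub>R egrad v x))))"
    unfolding hyp_grad_norm_def[abs_def] hyp_metric_def hyp_grad_def egrad_def conf_factor_def ..
  also have "\<dots> \<in> borel_measurable borel" by measurable
  finally show "hyp_grad_norm v \<in> borel_measurable borel" .
qed

lemma hyp_grad_norm_sq:
  assumes "norm x < 1"
  shows "(hyp_grad_norm v x)\<^sup>2 = (norm (egrad v x))\<^sup>2 / (conf_factor x)\<^sup>2"
proof -
  have c: "0 < conf_factor x" using conf_factor_pos[OF assms] .
  have "hyp_metric x (hyp_grad v x) (hyp_grad v x) = (norm (egrad v x))\<^sup>2 / (conf_factor x)\<^sup>2"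
    using c unfolding hyp_metric_def hyp_grad_def egrad_def[symmetric]
    by (simp add: dot_square_norm power2_eq_square)
  then show ?thesis using c by (simp add: hyp_grad_norm_def)
qed

lemma hyp_dist_measurable [measurable]: "hyp_dist (x0 :: real ^ 'n) \<in> borel_measurable borel"
  unfolding hyp_dist_def[abs_def] arcosh_def by measurable

lemma sinh_measurable [measurable]: "(sinh :: real \<Rightarrow> real) \<in> borel_measurable borel"
  by (intro borel_measurable_continuous_onI continuous_intros)

lemma tanh_measurable [measurable]: "(tanh :: real \<Rightarrow> real) \<in> borel_measurable borel"
  by (intro borel_measurable_continuous_onI continuous_intros) auto

text \<open>All three are read off from \<open>exp \<rho> = (1 + r) / (1 - r)\<close> with
  \<open>r = norm x\<close>. The last one turns the argument of \<open>X\<close> into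
  \<open>\<alpha> * norm x\<close>, whose logarithm is affine in the depth.\<close>

lemma sinh_hyp_dist_origin:
  assumes "x \<in> pball" shows "sinh (hyp_dist 0 x) = 1 / sinh (depth x)"
    and "sinh (hyp_dist 0 x) = norm x * conf_factor x"
    and "tanh (hyp_dist 0 x / 2) = norm x"
proof -
  have r: "0 < norm x" "norm x < 1" using assms by (auto simp: pball_iff)
  have d: "hyp_dist 0 x = ln ((1 + norm x) / (1 - norm x))"
    by (rule hyp_dist_origin) (use r in auto)
  have e: "exp (hyp_dist 0 x) = (1 + norm x) / (1 - norm x)"
  proof -
    have "0 < (1 + norm x) / (1 - norm x)" using r by (intro divide_pos_pos) linarith+
    then show ?thesis unfolding d by (rule exp_ln)
  qed
  have e': "exp (- hyp_dist 0 x) = (1 - norm x) / (1 + norm x)" unfolding exp_minus e by simp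
  have ne: "1 - norm x \<noteq> 0" "1 + norm x \<noteq> 0" using r by linarith+
  have "sinh (hyp_dist 0 x) = 2 * norm x / ((1 - norm x) * (1 + norm x))"
    unfolding sinh_field_def e e' using ne
    by (simp add: divide_simps) (simp add: algebra_simps)
  also have "(1 - norm x) * (1 + norm x) = 1 - (norm x)\<^sup>2" by (simp add: power2_eq_square algebra_simps)
  finally show s: "sinh (hyp_dist 0 x) = norm x * conf_factor x" by (simp add: conf_factor_def)
  show "sinh (hyp_dist 0 x) = 1 / sinh (depth x)" unfolding s conf_factor_depth[OF assms] using r by simp
  have "tanh (hyp_dist 0 x / 2) = (1 - exp (- hyp_dist 0 x)) / (1 + exp (- hyp_dist 0 x))"
    by (simp add: tanh_real_altdef)
  also have "\<dots> = norm x" unfolding e' using ne by (simp add: divide_simps)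
  finally show "tanh (hyp_dist 0 x / 2) = norm x" .
qed

lemma integrable_cball:
  fixes f :: "real ^ 'n \<Rightarrow> real"
  assumes "continuous_on (cball 0 R) f" "\<And>x. R < norm x \<Longrightarrow> f x = 0"
  shows "integrable lborel f"
proof (rule integrable_annulus[of "-1" R])
  have "{x::real^'n. - 1 \<le> norm x \<and> norm x \<le> R} = cball 0 R"
    by (auto intro: order_trans[OF _ norm_ge_zero])
  then show "continuous_on {x. - 1 \<le> norm x \<and> norm x \<le> R} f" using assms(1) by simp
  show "f x = 0" if "\<not> (- 1 \<le> norm x \<and> norm x \<le> R)" for x
    using assms(2) that by (auto intro: order_trans[OF _ norm_ge_zero])
qed

context
  fixes v :: "real ^ 'n \<Rightarrow> real" and R :: real
  assumes n3: "3 \<le> CARD('n)" and R: "0 < R" "R < 1" and supp: "\<And>x. v x \<noteq> 0 \<Longrightarrow> norm x \<le> R"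
    and smooth: "\<And>k. Ck_on k UNIV v"
begin

lemma egrad_supp: "egrad v x \<noteq> 0 \<Longrightarrow> norm x \<le> R"
proof (rule ccontr)
  assume *: "egrad v x \<noteq> 0" "\<not> norm x \<le> R"
  have "egrad v x = 0"
    by (rule egrad_zero_annulus[of v "-1" R])
      (use supp *(2) in \<open>auto intro: order_trans[OF _ norm_ge_zero]\<close>)
  with * show False by simp
qed

lemma cont_v: "continuous_on S v"
  using smooth[of 0] by (auto intro: continuous_on_subset)

lemma cont_c: "continuous_on (cball 0 R) (conf_factor :: real ^ 'n \<Rightarrow> real)"
  by (rule continuous_on_conf_factor) (use R in auto)

lemma integrable_energy: "integrable lborel (energy v)"
proof (rule integrable_cball)
  show "continuous_on (cball 0 R) (energy v)"
    by (rule continuous_on_energy[OF smooth]) (use R in auto)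
  show "energy v x = 0" if "R < norm x" for x
  proof -
    have "v x = 0" "egrad v x = 0" using supp[of x] egrad_supp[of x] that by fastforce+
    then show ?thesis by (simp add: energy_def)
  qed
qed

lemma hyp_energy:
  "(LINT x|hyp_volume. (hyp_grad_norm v x)\<^sup>2) - ((real CARD('n) - 1) / 2)\<^sup>2 * (LINT x|hyp_volume. (v x)\<^sup>2)
    = (LINT x|lborel. energy v x)"
proof -
  have n2: "2 \<le> CARD('n)" using n3 by simp
  let ?A = "\<lambda>x. conf_factor x ^ (CARD('n) - 2) * (norm (egrad v x))\<^sup>2"
  let ?B = "\<lambda>x. conf_factor x ^ CARD('n) * (v x)\<^sup>2"
  have iA: "integrable lborel ?A"
    by (rule integrable_cball[of R]) (use egrad_supp in \<open>force intro!: continuous_intros cont_c continuous_on_egrad[OF smooth]\<close>)+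
  have iB: "integrable lborel ?B"
    by (rule integrable_cball[of R]) (use supp in \<open>force intro!: continuous_intros cont_c cont_v\<close>)+
  have "(LINT x|hyp_volume. (hyp_grad_norm v x)\<^sup>2) = (LINT x|lborel. ?A x)"
  proof (subst integral_hyp_volume)
    show "(LINT x|lborel. indicator hyp_space x * (conf_factor x ^ CARD('n) * (hyp_grad_norm v x)\<^sup>2)) = (LINT x|lborel. ?A x)"
    proof (rule Bochner_Integration.integral_cong)
      fix x
      show "indicator hyp_space x * (conf_factor x ^ CARD('n) * (hyp_grad_norm v x)\<^sup>2) = ?A x"
      proof (cases "norm x < 1")
        case True
        have "conf_factor x ^ CARD('n) = conf_factor x ^ (CARD('n) - 2) * (conf_factor x)\<^sup>2"
          using n2 by (metis le_add_diff_inverse2 power_add)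
        then show ?thesis using True conf_factor_pos[OF True] by (simp add: hyp_grad_norm_sq)
      next
        case False
        then have "egrad v x = 0" using egrad_supp[of x] R by fastforce
        then show ?thesis using False by simp
      qed
    qed simp
  qed (use measurable_test(2)[OF smooth] in measurable)
  moreover have "(LINT x|hyp_volume. (v x)\<^sup>2) = (LINT x|lborel. ?B x)"
  proof (subst integral_hyp_volume)
    show "(LINT x|lborel. indicator hyp_space x * (conf_factor x ^ CARD('n) * (v x)\<^sup>2)) = (LINT x|lborel. ?B x)"
      by (rule Bochner_Integration.integral_cong) (use supp R in \<open>force simp: indicator_def\<close>)+
  qed (use measurable_test(1)[OF smooth] in measurable)
  moreover have "(LINT x|lborel. energy v x) = (LINT x|lborel. ?A x) - ((real CARD('n) - 1) / 2)\<^sup>2 * (LINT x|lborel. ?B x)"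
    unfolding energy_def mult.assoc using iA iB by simp
  ultimately show ?thesis by simp
qed

text \<open>Complete the square \<open>\<bar>grad v + k c v x\<bar>^2\<close>, where \<open>c\<close> is the conformal factor and \<open>k = (n - 1) / 2\<close>.\<close>
lemma poincare: "0 \<le> (LINT x|lborel. energy v x)"
proof -
  define k where "k = (real CARD('n) - 1) / 2"
  have kn: "real CARD('n) = 2 * k + 1" by (simp add: k_def field_simps)
  have k0: "0 \<le> k" using n3 by (simp add: k_def)
  \<comment> \<open>The divergence of the field \<open>k c^(n - 1) v^2 x\<close> supplies the cross
    term of the square.\<close>
  define F where "F i x = k * (conf_factor x ^ (CARD('n) - 1) * (x $ i * (v x * v x)))" for i x
  have cpos: "1 - x \<bullet> x \<noteq> 0" if "norm x < 1" for x :: "real ^ 'n"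
    using that abs_square_less_1[of "norm x"] by (simp add: power2_norm_eq_inner)
  have Cc: "Ck_on j (ball 0 1) (conf_factor :: real ^ 'n \<Rightarrow> real)" for j
    unfolding conf_factor_def power2_norm_eq_inner using cpos
    by (intro Ck_on_divide Ck_on_diff Ck_on_const Ck_on_inner_self) auto
  have Cpow: "Ck_on j (ball 0 1) (\<lambda>x::real^'n. conf_factor x ^ l)" for j l
    by (induction l) (auto intro!: Ck_on_const Ck_on_mult Cc)
  have CF: "Ck_on 1 UNIV (F i)" for i
  proof (rule Ck_on_UNIV_extend[where U = "ball 0 1" and V = "{x. R < norm x}"])
    show "Ck_on 1 (ball 0 1) (F i)" unfolding F_def
      by (intro Ck_on_mult Ck_on_const Cpow Ck_on_nth Ck_on_subset[OF smooth]) auto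
    show "open {x::real^'n. R < norm x}" by (intro open_Collect_less continuous_intros)
    show "F i x = 0" if "x \<in> {x. R < norm x}" for x using supp[of x] that by (fastforce simp: F_def)
    show "ball 0 1 \<union> {x::real^'n. R < norm x} = UNIV" using R by auto
  qed simp
  have dc: "(conf_factor has_derivative (\<lambda>h. (conf_factor x)\<^sup>2 * (x \<bullet> h))) (at x)" if x: "norm x < 1" for x :: "real ^ 'n"
  proof -
    have "((\<lambda>x::real^'n. 2 / (1 - x \<bullet> x)) has_derivative (\<lambda>h. (2 / (1 - x \<bullet> x))\<^sup>2 * (x \<bullet> h))) (at x)"
      using cpos[OF x] by (auto intro!: derivative_eq_intros simp: fun_eq_iff power2_eq_square inner_commute field_simps)
    then show ?thesis by (simp add: conf_factor_def[abs_def] power2_norm_eq_inner)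
  qed
  have part: "(\<Sum>i\<in>UNIV. partial (F i) i x) = k * (conf_factor x ^ (CARD('n) - 1) * (2 * v x * (x \<bullet> egrad v x) + real CARD('n) * (v x)\<^sup>2)
      + 2 * k * conf_factor x ^ CARD('n) * (norm x)\<^sup>2 * (v x)\<^sup>2)" if x: "norm x < 1" for x
  proof -
    have dv: "v differentiable (at x)" using smooth[of 1] by simp
    have cn: "conf_factor x ^ CARD('n) = conf_factor x ^ (CARD('n) - 1 - 1) * (conf_factor x)\<^sup>2"
    proof -
      have "CARD('n) = (CARD('n) - 1 - 1) + 2" using n3 by simp
      then show ?thesis by (metis power_add)
    qed
    have "((\<lambda>x. conf_factor x ^ (CARD('n) - 1)) has_derivative
        (\<lambda>h. real (CARD('n) - 1) * conf_factor x ^ (CARD('n) - 1 - 1) * ((conf_factor x)\<^sup>2 * (x \<bullet> h)))) (at x)"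
      by (rule has_derivative_eq_rhs[OF has_derivative_power[OF dc[OF x]]]) (simp add: fun_eq_iff mult_ac)
    moreover have "real (CARD('n) - 1) = 2 * k" using n3 by (simp add: k_def of_nat_diff)
    ultimately have dp: "((\<lambda>x. conf_factor x ^ (CARD('n) - 1)) has_derivative
        (\<lambda>h. 2 * k * conf_factor x ^ CARD('n) * (x \<bullet> h))) (at x)"
      unfolding cn by (simp only: mult.assoc)
    have "(F i has_derivative (\<lambda>h. k * (conf_factor x ^ (CARD('n) - 1) * (x $ i * (v x * (egrad v x \<bullet> h) + (egrad v x \<bullet> h) * v x) + h $ i * (v x * v x))
        + (2 * k * conf_factor x ^ CARD('n) * (x \<bullet> h)) * (x $ i * (v x * v x))))) (at x)" for i
      unfolding F_def
      by (intro has_derivative_mult_right has_derivative_mult dp has_derivative_egrad[OF dv]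
        bounded_linear_imp_has_derivative bounded_linear_vec_nth)
    from partial_eq[OF this] have p: "partial (F i) i x = k * (conf_factor x ^ (CARD('n) - 1) * (2 * v x) * (x $ i * partial v i x)
        + conf_factor x ^ (CARD('n) - 1) * (v x)\<^sup>2 + 2 * k * conf_factor x ^ CARD('n) * (v x)\<^sup>2 * (x $ i * x $ i))" for i
      by (simp add: inner_axis power2_eq_square algebra_simps)
    have "(\<Sum>i\<in>UNIV. partial (F i) i x) = k * (conf_factor x ^ (CARD('n) - 1) * (2 * v x) * (\<Sum>i\<in>UNIV. x $ i * partial v i x)
        + real CARD('n) * (conf_factor x ^ (CARD('n) - 1) * (v x)\<^sup>2)
        + 2 * k * conf_factor x ^ CARD('n) * (v x)\<^sup>2 * (\<Sum>i\<in>UNIV. x $ i * x $ i))"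
      unfolding p by (simp add: sum.distrib flip: sum_distrib_left)
    also have "(\<Sum>i\<in>UNIV. x $ i * x $ i) = (norm x)\<^sup>2"
      by (simp add: power2_norm_eq_inner inner_vec_def)
    also have "(\<Sum>i\<in>UNIV. x $ i * partial v i x) = x \<bullet> egrad v x" by (simp add: inner_vec_def)
    finally show ?thesis by (simp add: algebra_simps)
  qed
  have div: "integrable lborel (\<lambda>x. \<Sum>i\<in>UNIV. partial (F i) i x)" "(LINT x|lborel. (\<Sum>i\<in>UNIV. partial (F i) i x)) = 0"
  proof -
    have "F i x = 0" if "R < norm x" for i x using supp[of x] that by (fastforce simp: F_def)
    with integral_divergence_eq_0[of F R, OF CF]
    show "integrable lborel (\<lambda>x. \<Sum>i\<in>UNIV. partial (F i) i x)" "(LINT x|lborel. (\<Sum>i\<in>UNIV. partial (F i) i x)) = 0"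
      by blast+
  qed
  have "0 \<le> energy v x + (\<Sum>i\<in>UNIV. partial (F i) i x)" for x
  proof (cases "norm x < 1")
    case True
    define c a g w W where "c = conf_factor x" and "a = x \<bullet> x" and "g = x \<bullet> egrad v x" and "w = v x"
      and "W = c ^ (CARD('n) - 2)"
    have c0: "0 < c" using conf_factor_pos[OF True] by (simp add: c_def)
    have ca: "c * (1 - a) = 2" using cpos[OF True] unfolding c_def a_def conf_factor_def power2_norm_eq_inner
      by (metis nonzero_eq_divide_eq)
    have p1: "c ^ (CARD('n) - 1) = W * c"
    proof -
      have "CARD('n) - 1 = Suc (CARD('n) - 2)" using n3 by simp
      then show ?thesis by (simp add: W_def mult.commute)
    qed
    have p2: "c ^ CARD('n) = W * c\<^sup>2"
    proof -
      have "CARD('n) = (CARD('n) - 2) + 2" using n3 by simp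
      then show ?thesis unfolding W_def by (metis power_add)
    qed
    \<comment> \<open>The square is completed up to the nonnegative remainder
      \<open>k W c w^2\<close>. The terms quadratic in \<open>c\<close> are matched with the linear
      ones by \<open>c (1 - a) = 2\<close>, which is the definition of the conformal factor.\<close>
    have "0 \<le> W * (norm (egrad v x + (k * c * w) *\<^sub>R x))\<^sup>2 + k * W * c * w\<^sup>2"
      using c0 k0 by (auto simp: W_def)
    also have "(norm (egrad v x + (k * c * w) *\<^sub>R x))\<^sup>2 = (norm (egrad v x))\<^sup>2 + 2 * k * c * w * g + k\<^sup>2 * c\<^sup>2 * w\<^sup>2 * a"
      unfolding power2_norm_eq_inner a_def g_def
      by (simp add: inner_add_left inner_add_right inner_commute power2_eq_square algebra_simps)
    also have "W * ((norm (egrad v x))\<^sup>2 + 2 * k * c * w * g + k\<^sup>2 * c\<^sup>2 * w\<^sup>2 * a) + k * W * c * w\<^sup>2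
      = W * (norm (egrad v x))\<^sup>2 - k\<^sup>2 * (W * c\<^sup>2) * w\<^sup>2
        + k * (W * c * (2 * w * g + (2 * k + 1) * w\<^sup>2) + 2 * k * (W * c\<^sup>2) * a * w\<^sup>2)"
    proof -
      have "k\<^sup>2 * W * w\<^sup>2 * c * (c * (1 - a)) = k\<^sup>2 * W * w\<^sup>2 * c * 2" unfolding ca ..
      then show ?thesis by (simp add: power2_eq_square algebra_simps)
    qed
    also have "\<dots> = energy v x + (\<Sum>i\<in>UNIV. partial (F i) i x)"
      unfolding part[OF True] energy_def k_def[symmetric] kn
      unfolding c_def[symmetric] w_def[symmetric] g_def[symmetric] p1 p2 W_def[symmetric]
      by (simp add: a_def power2_norm_eq_inner)
    finally show ?thesis .
  next
    case False
    then have x: "R < norm x" using R by simp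
    have "partial (F i) i x = 0" for i
    proof (rule partial_zero)
      show "open {x::real^'n. R < norm x}" by (intro open_Collect_less continuous_intros)
      show "F i y = 0" if "y \<in> {x. R < norm x}" for y using supp[of y] that by (fastforce simp: F_def)
    qed (use x in simp)
    moreover have "v x = 0" "egrad v x = 0" using supp[of x] egrad_supp[of x] x by fastforce+
    ultimately show ?thesis by (simp add: energy_def)
  qed
  then have "0 \<le> (LINT x|lborel. energy v x + (\<Sum>i\<in>UNIV. partial (F i) i x))" by (intro integral_nonneg_AE) auto
  then show ?thesis using div integrable_energy by simp
qed

lemma hyp_hardy:
  "(LINT x|hyp_volume. (v x)\<^sup>2 / (sinh (hyp_dist 0 x))\<^sup>2)
    = (LINT x|lborel. indicator pball x * (conf_factor x ^ (CARD('n) - 2) * (v x)\<^sup>2 / (norm x)\<^sup>2))"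
proof (subst integral_hyp_volume)
  show "(LINT x|lborel. indicator hyp_space x * (conf_factor x ^ CARD('n) * ((v x)\<^sup>2 / (sinh (hyp_dist 0 x))\<^sup>2)))
    = (LINT x|lborel. indicator pball x * (conf_factor x ^ (CARD('n) - 2) * (v x)\<^sup>2 / (norm x)\<^sup>2))"
  proof (rule integral_cong_AE)
    show "AE x in lborel. indicator hyp_space x * (conf_factor x ^ CARD('n) * ((v x)\<^sup>2 / (sinh (hyp_dist 0 x))\<^sup>2))
      = indicator pball x * (conf_factor x ^ (CARD('n) - 2) * (v x)\<^sup>2 / (norm x)\<^sup>2)"
      using AE_lborel_singleton[of "0 :: real ^ 'n"]
    proof eventually_elim
      case (elim x)
      show ?case
      proof (cases "x \<in> pball")
        case True
        have "CARD('n) = (CARD('n) - 2) + 2" using n3 by simp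
        then have "conf_factor x ^ CARD('n) = conf_factor x ^ (CARD('n) - 2) * (conf_factor x)\<^sup>2" by (metis power_add)
        moreover have "0 < conf_factor x" "x \<in> hyp_space" using True conf_factor_pos[of x] by (auto simp: pball_iff)
        ultimately show ?thesis using True by (simp add: sinh_hyp_dist_origin(2) power_mult_distrib)
      next
        case False
        then show ?thesis using elim by (auto simp: pball_iff indicator_def)
      qed
    qed
  qed (use measurable_test(1)[OF smooth] in \<open>measurable, simp_all add: conf_factor_def\<close>)
qed (use measurable_test(1)[OF smooth] in measurable)

end

section \<open>Functions that do not vanish near the origin\<close>

text \<open>Dyadic decomposition: a point with \<open>2^-(k + 1) <= |x| < 2^-k\<close> has
  \<open>1 / |x|^2 <= 4^(k + 1)\<close>, and the ball of radius \<open>2^-k\<close> has volume at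
  most \<open>8^-k\<close> times that of the unit ball when \<open>n >= 3\<close>. The bounds form a
  geometric series of ratio \<open>1 / 2\<close>.\<close>

lemma integrable_inverse_norm_sq:
  assumes n3: "3 \<le> CARD('n)"
  shows "integrable lborel (\<lambda>x::real^'n. indicator (ball 0 1) x * (1 / (norm x)\<^sup>2))"
proof (rule integrableI_bounded)
  show "(\<lambda>x::real^'n. indicator (ball 0 1) x * (1 / (norm x)\<^sup>2)) \<in> borel_measurable lborel"
    by (intro borel_measurable_times borel_measurable_indicator) auto
  define C where "C = measure lborel (ball 0 1 :: (real ^ 'n) set)"
  define g :: "nat \<Rightarrow> real ^ 'n \<Rightarrow> ennreal" where "g k x = ennreal (4 ^ Suc k) * indicator (ball 0 ((1 / 2) ^ k)) x" for k x
  have bound: "ennreal (norm (indicator (ball 0 1) x * (1 / (norm x)\<^sup>2))) \<le> (\<Sum>k. g k x)" for x :: "real ^ 'n"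
  proof (cases "x \<in> ball 0 1 - {0}")
    case True
    then have x: "0 < norm x" "norm x < 1" by auto
    obtain n0 where n0: "(1 / 2 :: real) ^ n0 < norm x"
      using real_arch_pow_inv[OF x(1), of "1 / 2"] by auto
    \<comment> \<open>The index of the dyadic shell that contains \<open>x\<close>; it is not 0
      because \<open>norm x < 1\<close>.\<close>
    define N where "N = (LEAST n. (1 / 2 :: real) ^ n \<le> norm x)"
    have N: "(1 / 2 :: real) ^ N \<le> norm x"
      unfolding N_def by (rule LeastI[of _ n0]) (use n0 in simp)
    have "N \<noteq> 0"
    proof
      assume "N = 0"
      then show False using N x by simp
    qed
    then obtain k where k: "N = Suc k" by (cases N) auto
    have "norm x < (1 / 2) ^ k"
      using not_less_Least[of k "\<lambda>n. (1 / 2 :: real) ^ n \<le> norm x"] k unfolding N_def by simp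
    moreover have "1 / (norm x)\<^sup>2 \<le> 4 ^ Suc k"
    proof -
      have "((1 / 2 :: real) ^ Suc k)\<^sup>2 \<le> (norm x)\<^sup>2" using N k by (intro power_mono) auto
      moreover have "((1 / 2 :: real) ^ Suc k)\<^sup>2 = 1 / 4 ^ Suc k"
        by (simp add: power2_eq_square power_one_over flip: power_mult_distrib)
      ultimately have "1 / 4 ^ Suc k \<le> (norm x)\<^sup>2" by metis
      then show ?thesis using x by (simp add: field_simps)
    qed
    ultimately have "ennreal (norm (indicator (ball 0 1) x * (1 / (norm x)\<^sup>2))) \<le> g k x"
      using True by (simp add: g_def ennreal_leI del: power_Suc)
    also have "g k x = sum (\<lambda>k. g k x) {k}" by simp
    also have "\<dots> \<le> (\<Sum>k. g k x)" by (rule sum_le_suminf) auto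
    finally show ?thesis .
  qed (auto simp: indicator_def)
  have int_g: "(\<integral>\<^sup>+x. g k x \<partial>lborel) \<le> ennreal (4 * C * (1 / 2) ^ k)" for k
  proof -
    have "emeasure lborel (ball (0::real^'n) ((1 / 2) ^ k)) = ennreal (measure lborel (ball (0::real^'n) ((1 / 2) ^ k)))"
      using emeasure_bounded_finite[OF bounded_ball, of "0::real^'n" "(1 / 2) ^ k"]
      by (intro emeasure_eq_ennreal_measure) (auto simp: infinity_ennreal_def)
    also have "measure lborel (ball (0::real^'n) ((1 / 2) ^ k)) = ((1 / 2) ^ k) ^ CARD('n) * C"
      using content_ball_conv_unit_ball[of "(1 / 2) ^ k" "0::real^'n"] by (simp add: C_def)
    finally have e: "emeasure lborel (ball (0::real^'n) ((1 / 2) ^ k)) = ennreal (((1 / 2) ^ k) ^ CARD('n) * C)" .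
    have "(\<integral>\<^sup>+x. g k x \<partial>lborel) = ennreal (4 ^ Suc k) * emeasure lborel (ball (0::real^'n) ((1 / 2) ^ k))"
      unfolding g_def by (subst nn_integral_cmult_indicator) auto
    also have "\<dots> = ennreal (4 ^ Suc k * (((1 / 2) ^ k) ^ CARD('n) * C))"
      unfolding e by (simp add: ennreal_mult' C_def)
    also have "\<dots> \<le> ennreal (4 * C * (1 / 2) ^ k)"
    proof (rule ennreal_leI)
      have "((1 / 2 :: real) ^ k) ^ CARD('n) \<le> ((1 / 2) ^ k) ^ 3"
        using n3 by (intro power_decreasing) (auto simp: power_le_one)
      also have "\<dots> = (1 / 4) ^ k * (1 / 2) ^ k"
      proof -
        have "((1 / 2 :: real) ^ k) ^ 3 = ((1/2) ^ 3) ^ k" by (simp add: mult.commute flip: power_mult)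
        then show ?thesis by (simp add: power_divide flip: power_mult_distrib)
      qed
      finally have "4 ^ Suc k * (((1 / 2) ^ k) ^ CARD('n) * C) \<le> 4 ^ Suc k * ((1 / 4) ^ k * (1 / 2) ^ k * C)"
        by (intro mult_left_mono mult_right_mono) (auto simp: C_def)
      also have "\<dots> = 4 * C * (1 / 2) ^ k"
      proof -
        have "(4::real) ^ k * (1 / 4) ^ k = 1" by (simp flip: power_mult_distrib)
        then show ?thesis by (simp add: mult_ac)
      qed
      finally show "4 ^ Suc k * (((1 / 2) ^ k) ^ CARD('n) * C) \<le> 4 * C * (1 / 2) ^ k" .
    qed
    finally show ?thesis .
  qed
  have "(\<integral>\<^sup>+x. ennreal (norm (indicator (ball (0::real^'n) 1) x * (1 / (norm x)\<^sup>2))) \<partial>lborel) \<le> (\<integral>\<^sup>+x. (\<Sum>k. g k x) \<partial>lborel)"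
    by (intro nn_integral_mono bound)
  also have "\<dots> = (\<Sum>k. \<integral>\<^sup>+x. g k x \<partial>lborel)"
    unfolding g_def
    by (intro nn_integral_suminf borel_measurable_times_ennreal borel_measurable_const borel_measurable_indicator) simp
  also have "\<dots> \<le> (\<Sum>k. ennreal (4 * C * (1 / 2) ^ k))"
    by (intro suminf_le int_g) auto
  also have "\<dots> = ennreal (\<Sum>k. 4 * C * (1 / 2) ^ k)"
    by (intro suminf_ennreal2 summable_mult summable_geometric) (auto simp: C_def)
  also have "\<dots> < \<infinity>" by simp
  finally show "(\<integral>\<^sup>+x. ennreal (norm (indicator (ball (0::real^'n) 1) x * (1 / (norm x)\<^sup>2))) \<partial>lborel) < \<infinity>" .
qed

text \<open>For \<open>z = (j + 2)^2 |x|^2 - 1\<close> the gradient of the cut-off factor is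
  \<open>flat 2 z * (z + 1)\<close> times \<open>2 x / |x|^2\<close>. In this combination
  \<open>j\<close> occurs only through \<open>z\<close>, so pointwise convergence and a uniform
  bound follow from the behaviour of one function of \<open>z\<close>.\<close>

lemma flat_limits:
  "(flat 0 \<longlongrightarrow> 1) at_top" "((\<lambda>z. flat 2 z * (z + 1)) \<longlongrightarrow> 0) at_top"
proof -
  have i: "((\<lambda>z::real. inverse z) \<longlongrightarrow> 0) at_top"
    by (rule tendsto_inverse_0_at_top[OF filterlim_ident])
  have "((\<lambda>z::real. exp (- inverse z)) \<longlongrightarrow> exp (- 0)) at_top"
    by (intro tendsto_intros i)
  moreover have "eventually (\<lambda>z. exp (- inverse z) = flat 0 z) at_top"
    using eventually_gt_at_top[of 0] by eventually_elim (simp add: flat_def inverse_eq_divide)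
  ultimately show "(flat 0 \<longlongrightarrow> 1) at_top" by (simp add: tendsto_cong)
  have "((\<lambda>z::real. exp (- inverse z) * (inverse z + inverse z * inverse z)) \<longlongrightarrow> exp (- 0) * (0 + 0 * 0)) at_top"
    by (intro tendsto_intros i)
  moreover have "eventually (\<lambda>z. exp (- inverse z) * (inverse z + inverse z * inverse z) = flat 2 z * (z + 1)) at_top"
    using eventually_gt_at_top[of 0]
    by eventually_elim (simp add: flat_def inverse_eq_divide field_simps power2_eq_square)
  ultimately show "((\<lambda>z. flat 2 z * (z + 1)) \<longlongrightarrow> 0) at_top" by (simp add: tendsto_cong)
qed

lemma flat_bounds: "0 \<le> flat j z" "flat 0 z \<le> 1" "0 \<le> flat 2 z * (z + 1)" "flat 2 z * (z + 1) \<le> 2"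
proof -
  show "0 \<le> flat j z" by (simp add: flat_def)
  show "flat 0 z \<le> 1" by (simp add: flat_def)
  show "0 \<le> flat 2 z * (z + 1)" by (simp add: flat_def)
  show "flat 2 z * (z + 1) \<le> 2"
  proof (cases "z \<le> 0")
    case False
    define y where "y = 1 / z"
    have y: "0 < y" using False by (simp add: y_def)
    have "1 + y + y\<^sup>2 / 2 \<le> exp y" using exp_lower_Taylor_quadratic[of y] y by simp
    then have "y + y\<^sup>2 \<le> 2 * exp y" using y by linarith
    then have "exp (- y) * (y + y\<^sup>2) \<le> 2" by (simp add: exp_minus field_simps)
    moreover have "flat 2 z * (z + 1) = exp (- y) * (y + y\<^sup>2)"
      using False by (simp add: flat_def y_def field_simps power2_eq_square)
    ultimately show ?thesis by simp
  qed (simp add: flat_def)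
qed

text \<open>No cut-off with logarithmic scale is needed, since \<open>v\<close> is bounded and \<open>n \<ge> 3\<close>.\<close>
definition cut :: "nat \<Rightarrow> (real ^ 'n \<Rightarrow> real) \<Rightarrow> real ^ 'n \<Rightarrow> real"
  where "cut j v x = flat 0 ((real j + 2)\<^sup>2 * (x \<bullet> x) - 1) * v x"

locale cutoff =
  fixes v :: "real ^ 'n \<Rightarrow> real" and R m p L :: real
  assumes n3: "3 \<le> CARD('n)" and R: "0 < R" "R < 1" and supp: "\<And>x. v x \<noteq> 0 \<Longrightarrow> norm x \<le> R"
    and smooth: "\<And>k. Ck_on k UNIV v" and m_def: "m = real CARD('n) - 2"
    and p: "2 < p" "p * m / 2 \<le> real CARD('n)" and L: "200 \<le> L"
begin

text \<open>The factor vanishes once \<open>norm x\<close> is at most \<open>1 / (j + 2)\<close>.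
  The shift by 2 keeps this inner radius strictly below 1 from the start of the sequence.\<close>

lemma annular_cut: "annular (cut j v) (1 / (real j + 2)) R m"
proof
  show "Ck_on k UNIV (cut j v)" for k
    unfolding cut_def
    by (intro Ck_on_mult Ck_on_flat Ck_on_diff Ck_on_const Ck_on_inner_self smooth) auto
  show "1 / (real j + 2) \<le> norm x \<and> norm x \<le> R" if "cut j v x \<noteq> 0" for x
  proof
    show "norm x \<le> R" using that supp by (auto simp: cut_def)
    have "flat 0 ((real j + 2)\<^sup>2 * (x \<bullet> x) - 1) \<noteq> 0" using that by (auto simp: cut_def)
    then have "1 < ((real j + 2) * norm x)\<^sup>2"
      by (auto simp: flat_def power_mult_distrib power2_norm_eq_inner split: if_splits)
    then have "1 < (real j + 2) * norm x"
      using power2_le_imp_le[of "(real j + 2) * norm x" 1] by (auto simp: not_le[symmetric] power_le_one)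
    then show "1 / (real j + 2) \<le> norm x" by (simp add: field_simps)
  qed
qed (use n3 R m_def in auto)

lemma egrad_cut:
  "egrad (cut j v) x = flat 0 ((real j + 2)\<^sup>2 * (x \<bullet> x) - 1) *\<^sub>R egrad v x
    + (v x * (flat 2 ((real j + 2)\<^sup>2 * (x \<bullet> x) - 1) * (2 * (real j + 2)\<^sup>2))) *\<^sub>R x"
proof (rule egrad_eq)
  let ?z = "\<lambda>x::real^'n. (real j + 2)\<^sup>2 * (x \<bullet> x) - 1"
  have z: "(?z has_derivative (\<lambda>h. (real j + 2)\<^sup>2 * (x \<bullet> h + h \<bullet> x))) (at x)"
    by (auto intro!: derivative_eq_intros)
  have "(flat 0 has_real_derivative flat 2 (?z x)) (at (?z x))"
    using DERIV_flat[of 0 "?z x"] by (simp add: numeral_2_eq_2)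
  from DERIV_compose_FDERIV[OF this z]
  have "((\<lambda>x. flat 0 (?z x)) has_derivative (\<lambda>h. ((real j + 2)\<^sup>2 * (x \<bullet> h + h \<bullet> x)) * flat 2 (?z x))) (at x)" .
  moreover have "v differentiable (at x)" using smooth[of 1] by simp
  ultimately have "((\<lambda>x. flat 0 (?z x) * v x) has_derivative (\<lambda>h. flat 0 (?z x) * (egrad v x \<bullet> h)
      + ((real j + 2)\<^sup>2 * (x \<bullet> h + h \<bullet> x)) * flat 2 (?z x) * v x)) (at x)"
    by (intro has_derivative_mult has_derivative_egrad)
  then show "(cut j v has_derivative (\<lambda>h. (flat 0 (?z x) *\<^sub>R egrad v x
    + (v x * (flat 2 (?z x) * (2 * (real j + 2)\<^sup>2))) *\<^sub>R x) \<bullet> h)) (at x)"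
    unfolding cut_def[abs_def]
    by (rule has_derivative_eq_rhs) (simp add: fun_eq_iff inner_add_left inner_commute algebra_simps)
qed

lemma cut_arg_at_top:
  assumes "x \<noteq> 0" shows "filterlim (\<lambda>j. (real j + 2)\<^sup>2 * (x \<bullet> x) - 1) at_top sequentially"
proof (rule filterlim_at_top_mono)
  have "filterlim (\<lambda>j. (x \<bullet> x) * real j) at_top sequentially"
    using assms by (intro filterlim_tendsto_pos_mult_at_top[OF tendsto_const] filterlim_real_sequentially) auto
  then show "filterlim (\<lambda>j. - 1 + (x \<bullet> x) * real j) at_top sequentially"
    by (intro filterlim_tendsto_add_at_top[OF tendsto_const])
  show "\<forall>\<^sub>F j in sequentially. - 1 + (x \<bullet> x) * real j \<le> (real j + 2)\<^sup>2 * (x \<bullet> x) - 1"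
  proof (intro always_eventually allI)
    fix j
    have "real j * (x \<bullet> x) \<le> (real j + 2)\<^sup>2 * (x \<bullet> x)"
      by (intro mult_right_mono) (auto simp: power2_eq_square algebra_simps)
    then show "- 1 + (x \<bullet> x) * real j \<le> (real j + 2)\<^sup>2 * (x \<bullet> x) - 1" by (simp add: mult.commute)
  qed
qed

lemma cut_tendsto:
  assumes "x \<noteq> 0"
  shows "(\<lambda>j. cut j v x) \<longlonglongrightarrow> v x" "(\<lambda>j. egrad (cut j v) x) \<longlonglongrightarrow> egrad v x"
proof -
  let ?z = "\<lambda>j. (real j + 2)\<^sup>2 * (x \<bullet> x) - 1"
  have f0: "(\<lambda>j. flat 0 (?z j)) \<longlonglongrightarrow> 1"
    by (rule filterlim_compose[OF flat_limits(1) cut_arg_at_top[OF assms]])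
  have f2: "(\<lambda>j. flat 2 (?z j) * (?z j + 1)) \<longlonglongrightarrow> 0"
    by (rule filterlim_compose[OF flat_limits(2) cut_arg_at_top[OF assms]])
  have "(\<lambda>j. flat 0 (?z j) * v x) \<longlonglongrightarrow> 1 * v x" by (intro tendsto_intros f0)
  then show "(\<lambda>j. cut j v x) \<longlonglongrightarrow> v x" by (simp add: cut_def)
  have "(\<lambda>j. flat 0 (?z j) *\<^sub>R egrad v x + (v x * (flat 2 (?z j) * (?z j + 1) * (2 / (x \<bullet> x)))) *\<^sub>R x)
    \<longlonglongrightarrow> 1 *\<^sub>R egrad v x + (v x * (0 * (2 / (x \<bullet> x)))) *\<^sub>R x"
    by (intro tendsto_intros f0 f2)
  moreover have "flat 2 (?z j) * (?z j + 1) * (2 / (x \<bullet> x)) = flat 2 (?z j) * (2 * (real j + 2)\<^sup>2)" for j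
    using assms by simp
  ultimately show "(\<lambda>j. egrad (cut j v) x) \<longlonglongrightarrow> egrad v x" by (simp add: egrad_cut)
qed

text \<open>Uniform in \<open>j\<close>: the gradient of the cut-off factor has norm at most
  \<open>4 / norm x\<close> at every scale. The constant 32 is \<open>2 * 4^2\<close>, from
  \<open>(a + b)^2 <= 2 a^2 + 2 b^2\<close>.\<close>

lemma cut_bounds:
  shows "\<bar>cut j v x\<bar> \<le> \<bar>v x\<bar>"
    and "x \<noteq> 0 \<Longrightarrow> (norm (egrad (cut j v) x))\<^sup>2 \<le> 2 * (norm (egrad v x))\<^sup>2 + 32 * (v x)\<^sup>2 / (norm x)\<^sup>2"
proof -
  let ?z = "(real j + 2)\<^sup>2 * (x \<bullet> x) - 1"
  show "\<bar>cut j v x\<bar> \<le> \<bar>v x\<bar>"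
    using flat_bounds(1)[of 0 ?z] flat_bounds(2)[of ?z] by (simp add: cut_def abs_mult mult_left_le_one_le)
  assume x: "x \<noteq> 0"
  let ?a = "flat 0 ?z *\<^sub>R egrad v x" and ?b = "(v x * (flat 2 ?z * (2 * (real j + 2)\<^sup>2))) *\<^sub>R x"
  have a: "norm ?a \<le> norm (egrad v x)"
    using flat_bounds(1)[of 0 ?z] flat_bounds(2)[of ?z] by (simp add: mult_left_le_one_le)
  have b: "norm ?b \<le> 4 * \<bar>v x\<bar> / norm x"
  proof -
    have "norm ?b = \<bar>v x\<bar> * (flat 2 ?z * (2 * (real j + 2)\<^sup>2)) * norm x"
      using flat_bounds(1)[of 2 ?z] by (simp add: abs_mult)
    also have "\<dots> = \<bar>v x\<bar> * (2 * (flat 2 ?z * (?z + 1))) / norm x"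
      using x by (simp add: power2_norm_eq_inner[symmetric] power2_eq_square)
    also have "\<dots> \<le> \<bar>v x\<bar> * (2 * 2) / norm x"
      using flat_bounds(4)[of ?z] by (intro divide_right_mono mult_left_mono) auto
    finally show ?thesis by (simp add: mult.commute)
  qed
  have "(norm (?a + ?b))\<^sup>2 \<le> (norm (egrad v x) + 4 * \<bar>v x\<bar> / norm x)\<^sup>2"
    using a b norm_triangle_ineq[of ?a ?b] by (intro power_mono) auto
  also have "\<dots> \<le> 2 * (norm (egrad v x))\<^sup>2 + 2 * (4 * \<bar>v x\<bar> / norm x)\<^sup>2"
    using sum_squares_bound[of "norm (egrad v x)" "4 * \<bar>v x\<bar> / norm x"] by (simp add: power2_sum)
  finally show "(norm (egrad (cut j v) x))\<^sup>2 \<le> 2 * (norm (egrad v x))\<^sup>2 + 32 * (v x)\<^sup>2 / (norm x)\<^sup>2"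
    unfolding egrad_cut by (simp add: power_divide power_mult_distrib)
qed

lemma local_bounds:
  obtains C B where "1 \<le> C" "0 \<le> B" "\<And>x::real^'n. norm x \<le> R \<Longrightarrow> 0 < conf_factor x \<and> conf_factor x \<le> C"
    "\<And>x. \<bar>v x\<bar> \<le> B" "\<And>x. norm (egrad v x) \<le> B"
proof -
  have bd: "\<exists>B. \<forall>x\<in>cball (0::real^'n) R. \<bar>f x\<bar> \<le> B" if "continuous_on (cball 0 R) f" for f :: "real ^ 'n \<Rightarrow> real"
  proof -
    have "compact (f ` cball 0 R)" by (intro compact_continuous_image that) auto
    then show ?thesis using compact_imp_bounded bounded_real by (metis image_eqI)
  qed
  obtain C where C: "\<And>x::real^'n. x \<in> cball 0 R \<Longrightarrow> \<bar>conf_factor x\<bar> \<le> C"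
    using bd[OF cont_c[OF n3 R supp smooth]] by blast
  obtain B1 where B1: "\<And>x. x \<in> cball 0 R \<Longrightarrow> \<bar>v x\<bar> \<le> B1"
    using bd[OF cont_v[OF n3 R supp smooth]] by blast
  obtain B2 where B2: "\<And>x. x \<in> cball 0 R \<Longrightarrow> \<bar>norm (egrad v x)\<bar> \<le> B2"
    using bd[OF continuous_on_norm[OF continuous_on_egrad[OF smooth]]] by blast
  show ?thesis
  proof (rule that[of "max C 1" "max 0 (max B1 B2)"])
    show "0 < conf_factor x \<and> conf_factor x \<le> max C 1" if "norm x \<le> R" for x :: "real ^ 'n"
      using C[of x] conf_factor_pos[of x] that R by auto
    show "\<bar>v x\<bar> \<le> max 0 (max B1 B2)" for x
      using B1[of x] supp[of x] by (cases "v x = 0") auto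
    show "norm (egrad v x) \<le> max 0 (max B1 B2)" for x
      using B2[of x] egrad_supp[OF n3 R supp smooth, of x] by (cases "egrad v x = 0") auto
  qed auto
qed

lemma integrable_dominating: "integrable lborel (\<lambda>x::real^'n. C * (indicator (ball 0 1) x * (1 + 1 / (norm x)\<^sup>2)))"
proof -
  have "integrable lborel (\<lambda>x::real^'n. indicator (ball 0 1) x :: real)"
    by (intro integrable_real_indicator emeasure_bounded_finite) auto
  with integrable_inverse_norm_sq[OF n3]
  have "integrable lborel (\<lambda>x::real^'n. C * (indicator (ball 0 1) x + indicator (ball 0 1) x * (1 / (norm x)\<^sup>2)))"
    by (intro integrable_mult_right Bochner_Integration.integrable_add)
  then show ?thesis by (simp add: distrib_left)
qed

text \<open>One majorant, integrable because \<open>n >= 3\<close>, serves for the energy, the Hardy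
  term and the weighted norm. The origin, where the cut-off functions need not converge to
  \<open>v\<close>, is a null set.\<close>

lemma dominated_limit:
  fixes F :: "nat \<Rightarrow> real ^ 'n \<Rightarrow> real"
  assumes "\<And>j. F j \<in> borel_measurable borel" "f \<in> borel_measurable borel"
    and lim: "\<And>x. x \<noteq> 0 \<Longrightarrow> (\<lambda>j. F j x) \<longlonglongrightarrow> f x"
    and bd: "\<And>j x. x \<noteq> 0 \<Longrightarrow> norm x \<le> R \<Longrightarrow> \<bar>F j x\<bar> \<le> C * (1 + 1 / (norm x)\<^sup>2)"
    and z: "\<And>j x. R < norm x \<Longrightarrow> F j x = 0" and C: "0 \<le> C"
  shows "(\<lambda>j. LINT x|lborel. F j x) \<longlonglongrightarrow> (LINT x|lborel. f x)"
proof (rule integral_dominated_convergence)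
  show "integrable lborel (\<lambda>x::real^'n. C * (indicator (ball 0 1) x * (1 + 1 / (norm x)\<^sup>2)))"
    by (rule integrable_dominating)
  show "AE x in lborel. (\<lambda>j. F j x) \<longlonglongrightarrow> f x"
    using AE_lborel_singleton[of "0 :: real ^ 'n"] by eventually_elim (rule lim)
  show "AE x in lborel. norm (F j x) \<le> C * (indicator (ball 0 1) x * (1 + 1 / (norm x)\<^sup>2))" for j
    using AE_lborel_singleton[of "0 :: real ^ 'n"]
  proof eventually_elim
    case (elim x)
    show ?case
    proof (cases "norm x \<le> R")
      case True
      then show ?thesis using bd[OF elim True, of j] R by simp
    next
      case False
      then show ?thesis using z[of x j] C by (auto intro!: mult_nonneg_nonneg)
    qed
  qed
qed (use assms in auto)

end

lemma indicator_times_measurable: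
  fixes f :: "real ^ 'n \<Rightarrow> real"
  assumes "A \<in> sets borel" "f \<in> borel_measurable borel"
  shows "(\<lambda>x. indicator A x * f x) \<in> borel_measurable borel"
    and "(\<lambda>x. indicator A x * f x) \<in> borel_measurable lborel"
proof -
  show "(\<lambda>x. indicator A x * f x) \<in> borel_measurable borel"
    using assms by (intro borel_measurable_times borel_measurable_indicator)
  then show "(\<lambda>x. indicator A x * f x) \<in> borel_measurable lborel"
    by (subst measurable_cong_sets[OF sets_lborel refl])
qed

text \<open>With \<open>sinh \<rho> = 1 / sinh t\<close> the power \<open>- n\<close> of
  \<open>sinh t\<close> in the volume cancels against the exponent \<open>- n\<close> of
  \<open>sinh \<rho>\<close>. The factor \<open>norm x powr - n\<close> turns Lebesgue measure into
  that of the flat cylinder.\<close>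

lemma hyp_weighted:
  fixes g :: "real ^ 'n \<Rightarrow> real"
  assumes [measurable]: "g \<in> borel_measurable borel" and m: "m = real CARD('n) - 2"
  shows "(LINT x|hyp_volume. sinh (hyp_dist 0 x) powr (p * m / 2 - real CARD('n)) * g x)
    = (LINT x|lborel. indicator pball x * (norm x powr - real CARD('n) * sinh (depth x) powr - (p * m / 2) * g x))"
proof (subst integral_hyp_volume)
  show "(LINT x|lborel. indicator hyp_space x * (conf_factor x ^ CARD('n) *
      (sinh (hyp_dist 0 x) powr (p * m / 2 - real CARD('n)) * g x)))
    = (LINT x|lborel. indicator pball x * (norm x powr - real CARD('n) * sinh (depth x) powr - (p * m / 2) * g x))"
  proof (rule integral_cong_AE)
    show "AE x in lborel. indicator hyp_space x * (conf_factor x ^ CARD('n) *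
        (sinh (hyp_dist 0 x) powr (p * m / 2 - real CARD('n)) * g x))
      = indicator pball x * (norm x powr - real CARD('n) * sinh (depth x) powr - (p * m / 2) * g x)"
      using AE_lborel_singleton[of "0 :: real ^ 'n"]
    proof eventually_elim
      case (elim x)
      show ?case
      proof (cases "x \<in> pball")
        case True
        then have s: "0 < sinh (depth x)" "0 < norm x" "x \<in> hyp_space" using depth_pos[of x] by (auto simp: pball_iff)
        have "conf_factor x ^ CARD('n) = conf_factor x powr real CARD('n)"
          using conf_factor_pos[of x] s by (simp add: powr_realpow)
        also have "\<dots> = norm x powr - real CARD('n) * sinh (depth x) powr - real CARD('n)"
          unfolding conf_factor_depth[OF True] using s by (simp add: powr_divide powr_mult powr_minus_divide)
        finally have c: "conf_factor x ^ CARD('n) = norm x powr - real CARD('n) * sinh (depth x) powr - real CARD('n)" .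
        have d: "sinh (hyp_dist 0 x) powr (p * m / 2 - real CARD('n)) = sinh (depth x) powr (real CARD('n) - p * m / 2)"
          unfolding sinh_hyp_dist_origin(1)[OF True] using s
          by (simp add: powr_divide) (simp add: powr_diff)
        have "sinh (depth x) powr - real CARD('n) * sinh (depth x) powr (real CARD('n) - p * m / 2) = sinh (depth x) powr - (p * m / 2)"
          by (simp flip: powr_add)
        then have "conf_factor x ^ CARD('n) * sinh (hyp_dist 0 x) powr (p * m / 2 - real CARD('n))
          = norm x powr - real CARD('n) * sinh (depth x) powr - (p * m / 2)"
          unfolding c d by (simp only: mult.assoc)
        then show ?thesis using True s by (simp add: mult.assoc[symmetric])
      next
        case False
        then show ?thesis using elim by (auto simp: pball_iff indicator_def)
      qed
    qed
    have [measurable]: "(conf_factor :: real ^ 'n \<Rightarrow> real) \<in> borel_measurable borel"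
      unfolding conf_factor_def[abs_def] by measurable
    have [measurable]: "(depth :: real ^ 'n \<Rightarrow> real) \<in> borel_measurable borel"
      unfolding depth_def[abs_def] by measurable
    show "(\<lambda>x. indicator hyp_space x * (conf_factor x ^ CARD('n) *
        (sinh (hyp_dist 0 x) powr (p * m / 2 - real CARD('n)) * g x))) \<in> borel_measurable lborel"
      by (rule indicator_times_measurable(2)) (simp, measurable)
    show "(\<lambda>x. indicator pball x * (norm x powr - real CARD('n) * sinh (depth x) powr - (p * m / 2) * g x)) \<in> borel_measurable lborel"
      by (rule indicator_times_measurable(2)[OF pball_borel]) measurable
  qed
qed measurable

lemma X_tanh:
  assumes "x \<in> pball" "0 < \<alpha>" shows "X (\<alpha> * tanh (hyp_dist 0 x / 2)) = 1 / (1 - ln \<alpha> + depth x)"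
proof -
  have "0 < norm x" using assms by (simp add: pball_iff)
  then show ?thesis using assms by (simp add: X_def sinh_hyp_dist_origin(3) depth_def ln_mult)
qed

definition wnorm :: "real \<Rightarrow> real \<Rightarrow> (real ^ 'n \<Rightarrow> real) \<Rightarrow> real"
  where "wnorm p m v = (LINT x|lborel. indicator pball x * (norm x powr - real CARD('n)
      * sinh (depth x) powr - (p * m / 2) * \<bar>v x\<bar> powr p))"

definition wnormX :: "real \<Rightarrow> real \<Rightarrow> real \<Rightarrow> (real ^ 'n \<Rightarrow> real) \<Rightarrow> real"
  where "wnormX p m L v = (LINT x|lborel. indicator pball x * (norm x powr - real CARD('n) * sinh (depth x) powr - (p * m / 2)
      * (1 / (L + depth x)) powr ((p + 2) / 2) * \<bar>v x\<bar> powr p))"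

lemma hyp_wnorm:
  fixes v :: "real ^ 'n \<Rightarrow> real"
  assumes [measurable]: "v \<in> borel_measurable borel" and m: "m = real CARD('n) - 2"
  shows "(LINT x|hyp_volume. sinh (hyp_dist 0 x) powr (p * (real CARD('n) - 2) / 2 - real CARD('n)) * \<bar>v x\<bar> powr p)
    = wnorm p m v"
  unfolding wnorm_def m[symmetric] by (rule hyp_weighted[OF _ m]) measurable

lemma hyp_wnormX:
  fixes v :: "real ^ 'n \<Rightarrow> real"
  assumes [measurable]: "v \<in> borel_measurable borel" and m: "m = real CARD('n) - 2" and \<alpha>: "0 < \<alpha>"
  shows "(LINT x|hyp_volume. sinh (hyp_dist 0 x) powr (p * (real CARD('n) - 2) / 2 - real CARD('n))
      * X (\<alpha> * tanh (hyp_dist 0 x / 2)) powr ((p + 2) / 2) * \<bar>v x\<bar> powr p) = wnormX p m (1 - ln \<alpha>) v"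
proof -
  have "(LINT x|hyp_volume. sinh (hyp_dist 0 x) powr (p * m / 2 - real CARD('n))
      * (X (\<alpha> * tanh (hyp_dist 0 x / 2)) powr ((p + 2) / 2) * \<bar>v x\<bar> powr p))
    = (LINT x|lborel. indicator pball x * (norm x powr - real CARD('n) * sinh (depth x) powr - (p * m / 2)
      * (X (\<alpha> * tanh (hyp_dist 0 x / 2)) powr ((p + 2) / 2) * \<bar>v x\<bar> powr p)))"
    by (rule hyp_weighted[OF _ m]) (unfold X_def, measurable)
  also have "\<dots> = wnormX p m (1 - ln \<alpha>) v"
    unfolding wnormX_def
    by (rule Bochner_Integration.integral_cong) (auto simp: indicator_def X_tanh[OF _ \<alpha>] mult.assoc)
  finally show ?thesis by (simp add: m mult.assoc)
qed

text \<open>Only non-emptiness of the set of admissible constants (by the Poincare inequality) and its boundedness by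
  the quotient of \<open>u\<close> matter, so no extremal function or a priori Sobolev inequality is involved.\<close>
lemma best_const_origin:
  fixes u :: "real ^ 'n \<Rightarrow> real"
  assumes n3: "3 \<le> CARD('n)" and m: "m = real CARD('n) - 2" and u: "u \<in> test_functions" and pos: "0 < wnorm p m u"
  shows "0 \<le> best_const (0 :: real ^ 'n) p"
    and "best_const (0 :: real ^ 'n) p * wnorm p m u powr (2 / p) \<le> (LINT x|lborel. energy u x)"
proof -
  define A where "A = {S. \<forall>v \<in> (test_functions :: (real ^ 'n \<Rightarrow> real) set).
      (LINT x|hyp_volume. (hyp_grad_norm v x)\<^sup>2)
        \<ge> ((real CARD('n) - 1) / 2)\<^sup>2 * (LINT x|hyp_volume. (v x)\<^sup>2)
          + S * (LINT x|hyp_volume.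
                   sinh (hyp_dist 0 x) powr (p * (real CARD('n) - 2) / 2 - real CARD('n))
                   * \<bar>v x\<bar> powr p) powr (2 / p)}"
  have b: "best_const (0 :: real ^ 'n) p = Sup A" by (simp add: best_const_def A_def)
  have iff: "(LINT x|hyp_volume. (hyp_grad_norm v x)\<^sup>2)
        \<ge> ((real CARD('n) - 1) / 2)\<^sup>2 * (LINT x|hyp_volume. (v x)\<^sup>2)
          + S * (LINT x|hyp_volume.
                   sinh (hyp_dist 0 x) powr (p * (real CARD('n) - 2) / 2 - real CARD('n))
                   * \<bar>v x\<bar> powr p) powr (2 / p)
     \<longleftrightarrow> S * wnorm p m v powr (2 / p) \<le> (LINT x|lborel. energy v x)"
    and nn: "0 \<le> (LINT x|lborel. energy v x)" if v: "v \<in> test_functions" for v :: "real ^ 'n \<Rightarrow> real" and S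
  proof -
    obtain R where R: "0 < R" "R < 1" "\<And>x. v x \<noteq> 0 \<Longrightarrow> norm x \<le> R" "\<And>k. Ck_on k UNIV v"
      using test_functionsE[OF v] by metis
    show "0 \<le> (LINT x|lborel. energy v x)" by (rule poincare[OF n3 R])
    have "v \<in> borel_measurable borel" by (rule measurable_test(1)[OF R(4)])
    from hyp_wnorm[OF this m] hyp_energy[OF n3 R]
    show "(LINT x|hyp_volume. (hyp_grad_norm v x)\<^sup>2)
        \<ge> ((real CARD('n) - 1) / 2)\<^sup>2 * (LINT x|hyp_volume. (v x)\<^sup>2)
          + S * (LINT x|hyp_volume.
                   sinh (hyp_dist 0 x) powr (p * (real CARD('n) - 2) / 2 - real CARD('n))
                   * \<bar>v x\<bar> powr p) powr (2 / p)
     \<longleftrightarrow> S * wnorm p m v powr (2 / p) \<le> (LINT x|lborel. energy v x)" by auto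
  qed
  have A: "A = {S. \<forall>v \<in> (test_functions :: (real ^ 'n \<Rightarrow> real) set). S * wnorm p m v powr (2 / p) \<le> (LINT x|lborel. energy v x)}"
    unfolding A_def using iff by blast
  have 0: "0 \<in> A" unfolding A using nn by simp
  have N: "0 < wnorm p m u powr (2 / p)" using pos by simp
  have le: "S \<le> (LINT x|lborel. energy u x) / wnorm p m u powr (2 / p)" if "S \<in> A" for S
    using that u N unfolding A by (auto simp: field_simps)
  then have "bdd_above A" by (rule bdd_aboveI)
  then show "0 \<le> best_const (0 :: real ^ 'n) p" unfolding b using 0 by (rule cSup_upper[rotated])
  have "best_const (0 :: real ^ 'n) p \<le> (LINT x|lborel. energy u x) / wnorm p m u powr (2 / p)"
    unfolding b using 0 le by (intro cSup_least) auto
  then show "best_const (0 :: real ^ 'n) p * wnorm p m u powr (2 / p) \<le> (LINT x|lborel. energy u x)"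
    using N by (simp add: field_simps)
qed

lemma wnormX_nonneg: "0 \<le> wnormX p m L v"
  unfolding wnormX_def by (intro integral_nonneg_AE always_eventually allI mult_nonneg_nonneg) auto

lemma wnorm_nonneg: "0 \<le> wnorm p m v"
  unfolding wnorm_def by (intro integral_nonneg_AE always_eventually allI mult_nonneg_nonneg) auto

text \<open>Three comparisons are chained: the weighted norm of \<open>v\<close> with that of
  \<open>u\<close>, the norm of \<open>u\<close> with its energy through the best constant, and the
  energy of \<open>u\<close> with that of \<open>v\<close> minus the Hardy term.\<close>

lemma (in annular) improved_inequality:
  assumes p: "2 < p" and L: "200 \<le> L"
  shows "(m / 2)\<^sup>2 * (LINT x|lborel. hardy x)
      + m powr (- (p + 2) / p) * best_const (0 :: real ^ 'n) p * wnormX p m L v powr (2 / p) \<le> (LINT x|lborel. energy v x)"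
proof -
  have le: "wnormX p m L v \<le> m powr ((p + 2) / 2) * wnorm p m u"
    using weighted_norm_le[OF p L] by (simp add: wnormX_def wnorm_def)
  have E: "m powr (- (p + 2) / p) * best_const (0 :: real ^ 'n) p * wnormX p m L v powr (2 / p) \<le> (LINT x|lborel. energy u x)"
  \<comment> \<open>The sign of the best constant and its bound by \<open>u\<close> are obtained
    only when the norm of \<open>u\<close> is positive. In the degenerate case the term is
    \<open>0 powr (2 / p) = 0\<close>, and the Poincare inequality for \<open>u\<close>
    suffices.\<close>
  proof (cases "wnormX p m L v = 0")
    case True
    obtain R where R: "0 < R" "R < 1" "\<And>x. u x \<noteq> 0 \<Longrightarrow> norm x \<le> R" "\<And>k. Ck_on k UNIV u"
      using test_functionsE[OF u_test] by metis
    have "0 \<le> (LINT x|lborel. energy u x)" by (rule poincare[OF n3 R])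
    then show ?thesis using True by simp
  next
    case False
    then have X: "0 < wnormX p m L v" using wnormX_nonneg[of p m L v] by simp
    have mp: "0 < m powr ((p + 2) / 2)" using m1 by simp
    have W: "0 < wnorm p m u"
      using X le mp wnorm_nonneg[of p m u] by (cases "wnorm p m u = 0") auto
    note B = best_const_origin[OF n3 m_def u_test W]
    have "wnormX p m L v powr (2 / p) \<le> (m powr ((p + 2) / 2) * wnorm p m u) powr (2 / p)"
      using le X p by (intro powr_mono2) auto
    also have "\<dots> = m powr ((p + 2) / p) * wnorm p m u powr (2 / p)"
    proof -
      have e: "(p + 2) / 2 * (2 / p) = (p + 2) / p" using p by (simp add: field_simps)
      show ?thesis using W mp by (subst powr_mult) (auto simp only: powr_powr e)
    qed
    finally have "m powr (- (p + 2) / p) * best_const (0 :: real ^ 'n) p * wnormX p m L v powr (2 / p)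
      \<le> m powr (- (p + 2) / p) * best_const (0 :: real ^ 'n) p * (m powr ((p + 2) / p) * wnorm p m u powr (2 / p))"
      using B(1) by (intro mult_left_mono mult_nonneg_nonneg) auto
    also have "\<dots> = (m powr (- (p + 2) / p) * m powr ((p + 2) / p)) * (best_const (0 :: real ^ 'n) p * wnorm p m u powr (2 / p))"
      by (simp only: mult_ac)
    also have "m powr (- (p + 2) / p) * m powr ((p + 2) / p) = 1"
    proof -
      have "m powr (- (p + 2) / p) * m powr ((p + 2) / p) = m powr (- (p + 2) / p + (p + 2) / p)"
        by (rule powr_add[symmetric])
      also have "- (p + 2) / p + (p + 2) / p = 0" by (simp only: minus_divide_left[symmetric] add.left_inverse)
      finally show ?thesis using m1 by simp
    qed
    finally show ?thesis using B(2) by simp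
  qed
  show ?thesis using E energy_u_le by linarith
qed

section \<open>Limits along the cut-off sequence\<close>

context cutoff
begin

lemma cut_supp: "cut j v x \<noteq> 0 \<Longrightarrow> norm x \<le> R"
  using supp by (auto simp: cut_def)

lemma cut_smooth: "Ck_on k UNIV (cut j v)"
  by (rule annular.smooth[OF annular_cut])

lemma energy_limit: "(\<lambda>j. LINT x|lborel. energy (cut j v) x) \<longlonglongrightarrow> (LINT x|lborel. energy v x)"
proof -
  obtain C B where CB: "1 \<le> C" "0 \<le> B" "\<And>x::real^'n. norm x \<le> R \<Longrightarrow> 0 < conf_factor x \<and> conf_factor x \<le> C"
    "\<And>x. \<bar>v x\<bar> \<le> B" "\<And>x. norm (egrad v x) \<le> B" using local_bounds by metis
  define k where "k = ((real CARD('n) - 1) / 2)\<^sup>2"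
  have k: "0 \<le> k" by (simp add: k_def)
  show ?thesis
  proof (rule dominated_limit)
    show "energy (cut j v) \<in> borel_measurable borel" for j
      using borel_measurable_integrable[OF integrable_energy[OF n3 R cut_supp[where j = j] cut_smooth[where j = j]]] by simp
    show "energy v \<in> borel_measurable borel"
      using borel_measurable_integrable[OF integrable_energy[OF n3 R supp smooth]] by simp
    show "(\<lambda>j. energy (cut j v) x) \<longlonglongrightarrow> energy v x" if "x \<noteq> 0" for x
      unfolding energy_def by (intro tendsto_intros cut_tendsto that)
    show "energy (cut j v) x = 0" if "R < norm x" for j x
    proof -
      have "cut j v x = 0" "egrad (cut j v) x = 0"
        using cut_supp[where j = j and x = x] egrad_supp[OF n3 R cut_supp[where j = j] cut_smooth[where j = j], of x] that by fastforce+
      then show ?thesis by (simp add: energy_def)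
    qed
    show "0 \<le> C ^ CARD('n) * (32 + k) * B\<^sup>2" using CB k by simp
    show "\<bar>energy (cut j v) x\<bar> \<le> C ^ CARD('n) * (32 + k) * B\<^sup>2 * (1 + 1 / (norm x)\<^sup>2)"
      if x: "x \<noteq> 0" "norm x \<le> R" for j x
    proof -
      have c: "0 < conf_factor x" "conf_factor x \<le> C" using CB(3) x by auto
      have v2: "(v x)\<^sup>2 \<le> B\<^sup>2" using CB(2) CB(4)[of x] by (metis abs_le_square_iff abs_of_nonneg)
      have g2: "(norm (egrad v x))\<^sup>2 \<le> B\<^sup>2" using CB(5) by (intro power_mono) auto
      have u2: "(cut j v x)\<^sup>2 \<le> B\<^sup>2"
        using cut_bounds(1)[where j = j and x = x] CB(2) CB(4)[of x] by (metis abs_le_square_iff abs_of_nonneg order_trans)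
      have "(norm (egrad (cut j v) x))\<^sup>2 \<le> 2 * B\<^sup>2 + 32 * B\<^sup>2 / (norm x)\<^sup>2"
        using cut_bounds(2)[where j = j, OF x(1)] g2 v2
        by (meson add_mono divide_right_mono mult_left_mono order_trans zero_le_numeral zero_le_power2)
      also have "\<dots> \<le> 32 * B\<^sup>2 * (1 + 1 / (norm x)\<^sup>2)" by (simp add: distrib_left)
      finally have G: "(norm (egrad (cut j v) x))\<^sup>2 \<le> 32 * B\<^sup>2 * (1 + 1 / (norm x)\<^sup>2)" .
      have c1: "conf_factor x ^ (CARD('n) - 2) \<le> C ^ CARD('n)"
        using c CB(1) by (meson diff_le_self order_trans power_increasing power_mono less_imp_le)
      have c2: "conf_factor x ^ CARD('n) \<le> C ^ CARD('n)" using c by (intro power_mono) auto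
      have 1: "conf_factor x ^ (CARD('n) - 2) * (norm (egrad (cut j v) x))\<^sup>2 \<le> C ^ CARD('n) * (32 * B\<^sup>2 * (1 + 1 / (norm x)\<^sup>2))"
        using c1 G c CB by (intro mult_mono) auto
      have 2: "k * conf_factor x ^ CARD('n) * (cut j v x)\<^sup>2 \<le> k * C ^ CARD('n) * (B\<^sup>2 * (1 + 1 / (norm x)\<^sup>2))"
      proof (intro mult_mono)
        have "B\<^sup>2 * 1 \<le> B\<^sup>2 * (1 + 1 / (norm x)\<^sup>2)" by (intro mult_left_mono) auto
        then show "(cut j v x)\<^sup>2 \<le> B\<^sup>2 * (1 + 1 / (norm x)\<^sup>2)" using u2 by simp
      qed (use c c2 k CB in auto)
      have 3: "0 \<le> conf_factor x ^ (CARD('n) - 2) * (norm (egrad (cut j v) x))\<^sup>2"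
        "0 \<le> k * conf_factor x ^ CARD('n) * (cut j v x)\<^sup>2" using c k by auto
      have "\<bar>energy (cut j v) x\<bar> \<le> conf_factor x ^ (CARD('n) - 2) * (norm (egrad (cut j v) x))\<^sup>2
          + k * conf_factor x ^ CARD('n) * (cut j v x)\<^sup>2"
        using 3 unfolding energy_def k_def[symmetric] by linarith
      also have "\<dots> \<le> C ^ CARD('n) * (32 * B\<^sup>2 * (1 + 1 / (norm x)\<^sup>2)) + k * C ^ CARD('n) * (B\<^sup>2 * (1 + 1 / (norm x)\<^sup>2))"
        using 1 2 by linarith
      also have "\<dots> = C ^ CARD('n) * (32 + k) * B\<^sup>2 * (1 + 1 / (norm x)\<^sup>2)" by (simp only: distrib_left distrib_right mult_ac)
      finally show ?thesis .
    qed
  qed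
qed

lemma hardy_limit: "(\<lambda>j. LINT x|lborel. annular.hardy (cut j v) x) \<longlonglongrightarrow>
  (LINT x|lborel. indicator pball x * (conf_factor x ^ (CARD('n) - 2) * (v x)\<^sup>2 / (norm x)\<^sup>2))"
proof -
  obtain C B where CB: "1 \<le> C" "0 \<le> B" "\<And>x::real^'n. norm x \<le> R \<Longrightarrow> 0 < conf_factor x \<and> conf_factor x \<le> C"
    "\<And>x. \<bar>v x\<bar> \<le> B" "\<And>x. norm (egrad v x) \<le> B" using local_bounds by metis
  note h = annular.hardy_def[OF annular_cut]
  show ?thesis
  proof (rule dominated_limit)
    show "annular.hardy (cut j v) \<in> borel_measurable borel" for j
      using borel_measurable_integrable[OF annular.integrable_energy_hardy(2)[OF annular_cut]] by simp
    show "(\<lambda>x. indicator pball x * (conf_factor x ^ (CARD('n) - 2) * (v x)\<^sup>2 / (norm x)\<^sup>2)) \<in> borel_measurable borel"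
      by (rule indicator_continuous_borel[OF pball_borel])
        (intro continuous_intros continuous_on_conf_factor cont_v[OF n3 R supp smooth], auto simp: pball_iff)
    show "(\<lambda>j. annular.hardy (cut j v) x) \<longlonglongrightarrow> indicator pball x * (conf_factor x ^ (CARD('n) - 2) * (v x)\<^sup>2 / (norm x)\<^sup>2)"
      if "x \<noteq> 0" for x
    proof -
      have "(\<lambda>j. annular.hardy (cut j v) x) \<longlonglongrightarrow> conf_factor x ^ (CARD('n) - 2) * (v x)\<^sup>2 / (norm x)\<^sup>2"
        unfolding h using that by (intro tendsto_intros cut_tendsto that) auto
      moreover have "x \<in> pball \<or> v x = 0" using supp[of x] R that by (force simp: pball_iff)
      ultimately show ?thesis by (auto simp: indicator_def)
    qed
    show "annular.hardy (cut j v) x = 0" if "R < norm x" for j x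
      using cut_supp[where j = j and x = x] that by (fastforce simp: h)
    show "0 \<le> C ^ CARD('n) * B\<^sup>2" using CB by simp
    show "\<bar>annular.hardy (cut j v) x\<bar> \<le> C ^ CARD('n) * B\<^sup>2 * (1 + 1 / (norm x)\<^sup>2)"
      if x: "x \<noteq> 0" "norm x \<le> R" for j x
    proof -
      have c: "0 < conf_factor x" "conf_factor x \<le> C" using CB(3) x by auto
      have u2: "(cut j v x)\<^sup>2 \<le> B\<^sup>2"
        using cut_bounds(1)[where j = j and x = x] CB(2) CB(4)[of x] by (metis abs_le_square_iff abs_of_nonneg order_trans)
      have c1: "conf_factor x ^ (CARD('n) - 2) \<le> C ^ CARD('n)"
        using c CB(1) by (meson diff_le_self order_trans power_increasing power_mono less_imp_le)
      have "conf_factor x ^ (CARD('n) - 2) * (cut j v x)\<^sup>2 * (1 / (norm x)\<^sup>2) \<le> C ^ CARD('n) * B\<^sup>2 * (1 + 1 / (norm x)\<^sup>2)"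
        using c1 u2 c CB by (intro mult_mono) auto
      moreover have "0 \<le> conf_factor x ^ (CARD('n) - 2) * (cut j v x)\<^sup>2 / (norm x)\<^sup>2" using c by simp
      ultimately show ?thesis by (simp add: h)
    qed
  qed
qed

lemma wnormX_limit: "(\<lambda>j. wnormX p m L (cut j v)) \<longlonglongrightarrow> wnormX p m L v"
proof -
  obtain C B where CB: "1 \<le> C" "0 \<le> B" "\<And>x::real^'n. norm x \<le> R \<Longrightarrow> 0 < conf_factor x \<and> conf_factor x \<le> C"
    "\<And>x. \<bar>v x\<bar> \<le> B" "\<And>x. norm (egrad v x) \<le> B" using local_bounds by metis
  have [measurable]: "(depth :: real ^ 'n \<Rightarrow> real) \<in> borel_measurable borel"
    unfolding depth_def[abs_def] by measurable
  have meas: "(\<lambda>x. indicator pball x * (norm x powr - real CARD('n) * sinh (depth x) powr - (p * m / 2)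
      * (1 / (L + depth x)) powr ((p + 2) / 2) * \<bar>w x\<bar> powr p)) \<in> borel_measurable borel"
    if "\<And>k. Ck_on k UNIV w" for w :: "real ^ 'n \<Rightarrow> real"
  proof -
    have [measurable]: "w \<in> borel_measurable borel" using measurable_test(1)[OF that] .
    show ?thesis by (rule indicator_times_measurable(1)[OF pball_borel]) measurable
  qed
  show ?thesis unfolding wnormX_def
  proof (rule dominated_limit)
    show "(\<lambda>j. indicator pball x * (norm x powr - real CARD('n) * sinh (depth x) powr - (p * m / 2)
      * (1 / (L + depth x)) powr ((p + 2) / 2) * \<bar>cut j v x\<bar> powr p))
      \<longlonglongrightarrow> indicator pball x * (norm x powr - real CARD('n) * sinh (depth x) powr - (p * m / 2)
      * (1 / (L + depth x)) powr ((p + 2) / 2) * \<bar>v x\<bar> powr p)" if "x \<noteq> 0" for x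
    proof -
      have "(\<lambda>j. \<bar>cut j v x\<bar> powr p) \<longlonglongrightarrow> \<bar>v x\<bar> powr p"
        using p by (intro tendsto_powr' tendsto_intros cut_tendsto that) auto
      then show ?thesis by (intro tendsto_mult_left)
    qed
    show "indicator pball x * (norm x powr - real CARD('n) * sinh (depth x) powr - (p * m / 2)
      * (1 / (L + depth x)) powr ((p + 2) / 2) * \<bar>cut j v x\<bar> powr p) = 0" if "R < norm x" for j x
      using cut_supp[where j = j and x = x] that p by (cases "cut j v x = 0") auto
    show "0 \<le> C ^ CARD('n) * B powr p" using CB by simp
    show "\<bar>indicator pball x * (norm x powr - real CARD('n) * sinh (depth x) powr - (p * m / 2)
      * (1 / (L + depth x)) powr ((p + 2) / 2) * \<bar>cut j v x\<bar> powr p)\<bar> \<le> C ^ CARD('n) * B powr p * (1 + 1 / (norm x)\<^sup>2)"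
      if x: "x \<noteq> 0" "norm x \<le> R" for j x
    proof -
      have xp: "x \<in> pball" using x R by (simp add: pball_iff)
      define t where "t = norm x * conf_factor x"
      have c: "0 < conf_factor x" "conf_factor x \<le> C" using CB(3) x by auto
      have S: "0 < sinh (depth x)" "0 < depth x" "0 < norm x" using depth_pos[OF xp] x by auto
      have t: "t = 1 / sinh (depth x)" "0 < t" using S x unfolding t_def conf_factor_depth[OF xp] by auto
      have w: "norm x powr - real CARD('n) * sinh (depth x) powr - (p * m / 2) = conf_factor x ^ CARD('n) * t powr (p * m / 2 - real CARD('n))"
      proof -
        have "sinh (depth x) powr - (p * m / 2) = t powr (p * m / 2)"
          unfolding t(1) using S by (simp add: powr_divide powr_minus_divide)
        moreover have "conf_factor x ^ CARD('n) * t powr - real CARD('n) = norm x powr - real CARD('n)"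
          unfolding t_def using c S by (simp add: powr_mult powr_minus powr_realpow field_simps)
        moreover have "t powr (p * m / 2 - real CARD('n)) = t powr - real CARD('n) * t powr (p * m / 2)"
          by (simp flip: powr_add)
        ultimately show ?thesis by simp
      qed
      have "m \<ge> 1" using n3 m_def by simp
      then have "2 * m < p * m" using p by (intro mult_strict_right_mono) auto
      \<comment> \<open>The exponent of \<open>sinh \<rho>\<close> lies between \<open>- 2\<close>,
        because \<open>p > 2\<close>, and 0, because \<open>p\<close> is at most the critical
        exponent. The weight is thus no more singular than \<open>1 + 1 / t^2\<close>, which fits
        the common majorant.\<close>
      then have a: "- 2 \<le> p * m / 2 - real CARD('n)" "p * m / 2 - real CARD('n) \<le> 0" using p m_def by auto
      have tp: "t powr (p * m / 2 - real CARD('n)) \<le> 1 + 1 / t\<^sup>2"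
      proof (cases "1 \<le> t")
        case True
        then have "t powr (p * m / 2 - real CARD('n)) \<le> t powr 0" using a by (intro powr_mono) auto
        then show ?thesis using t by (smt (verit) powr_zero_eq_one zero_le_divide_1_iff zero_le_power2)
      next
        case False
        then have "t powr (p * m / 2 - real CARD('n)) \<le> t powr - 2" using a t by (intro powr_mono') auto
        also have "\<dots> = 1 / t\<^sup>2" using t by (simp add: powr_minus_divide)
        finally show ?thesis by simp
      qed
      have nC: "conf_factor x ^ CARD('n) * t powr (p * m / 2 - real CARD('n)) \<le> C ^ CARD('n) * (1 + 1 / (norm x)\<^sup>2)"
      proof -
        have pw: "conf_factor x ^ CARD('n) = conf_factor x ^ (CARD('n) - 2) * (conf_factor x)\<^sup>2"
        proof -
          have "CARD('n) = (CARD('n) - 2) + 2" using n3 by simp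
          then show ?thesis by (metis power_add)
        qed
        have "conf_factor x ^ CARD('n) * t powr (p * m / 2 - real CARD('n)) \<le> conf_factor x ^ CARD('n) * (1 + 1 / t\<^sup>2)"
          using tp c by (intro mult_left_mono) auto
        also have "\<dots> = conf_factor x ^ CARD('n) + conf_factor x ^ (CARD('n) - 2) * (1 / (norm x)\<^sup>2)"
          using c x unfolding t_def by (simp add: distrib_left power_mult_distrib pw)
        also have "\<dots> \<le> C ^ CARD('n) + C ^ CARD('n) * (1 / (norm x)\<^sup>2)"
        proof (intro add_mono mult_right_mono)
          show "conf_factor x ^ CARD('n) \<le> C ^ CARD('n)" using c by (intro power_mono) auto
          show "conf_factor x ^ (CARD('n) - 2) \<le> C ^ CARD('n)"
            using c CB(1) by (meson diff_le_self order_trans power_increasing power_mono less_imp_le)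
        qed simp
        finally show ?thesis by (simp add: distrib_left)
      qed
      have X1: "(1 / (L + depth x)) powr ((p + 2) / 2) \<le> 1"
        using L S p by (intro powr_le1) (auto simp: divide_le_eq)
      have V: "\<bar>cut j v x\<bar> powr p \<le> B powr p"
        using cut_bounds(1)[where j = j and x = x] CB(4)[of x] p by (intro powr_mono2) auto
      have "norm x powr - real CARD('n) * sinh (depth x) powr - (p * m / 2)
        * (1 / (L + depth x)) powr ((p + 2) / 2) * \<bar>cut j v x\<bar> powr p \<le> (C ^ CARD('n) * (1 + 1 / (norm x)\<^sup>2)) * 1 * B powr p"
        unfolding w by (rule mult_mono[OF mult_mono[OF nC X1] V]) (use c CB in auto)
      then show ?thesis using xp by (simp add: mult_ac)
    qed
  qed (rule meas cut_smooth smooth)+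
qed

theorem improved_inequality_origin:
  "(m / 2)\<^sup>2 * (LINT x|lborel. indicator pball x * (conf_factor x ^ (CARD('n) - 2) * (v x)\<^sup>2 / (norm x)\<^sup>2))
    + m powr (- (p + 2) / p) * best_const (0 :: real ^ 'n) p * wnormX p m L v powr (2 / p)
  \<le> (LINT x|lborel. energy v x)"
proof (rule LIMSEQ_le)
  show "(\<lambda>j. (m / 2)\<^sup>2 * (LINT x|lborel. annular.hardy (cut j v) x)
      + m powr (- (p + 2) / p) * best_const (0 :: real ^ 'n) p * wnormX p m L (cut j v) powr (2 / p))
    \<longlonglongrightarrow> (m / 2)\<^sup>2 * (LINT x|lborel. indicator pball x * (conf_factor x ^ (CARD('n) - 2) * (v x)\<^sup>2 / (norm x)\<^sup>2))
    + m powr (- (p + 2) / p) * best_const (0 :: real ^ 'n) p * wnormX p m L v powr (2 / p)"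
    using p by (intro tendsto_intros hardy_limit tendsto_powr' wnormX_limit)
      (auto simp: wnormX_nonneg intro!: always_eventually)
  show "\<exists>N. \<forall>j\<ge>N. (m / 2)\<^sup>2 * (LINT x|lborel. annular.hardy (cut j v) x)
      + m powr (- (p + 2) / p) * best_const (0 :: real ^ 'n) p * wnormX p m L (cut j v) powr (2 / p)
      \<le> (LINT x|lborel. energy (cut j v) x)"
    using annular.improved_inequality[OF annular_cut p(1) L] by blast
qed (rule energy_limit)

end

section \<open>Moving the base point\<close>

lemma improved_origin:
  fixes v :: "real ^ 'n \<Rightarrow> real"
  assumes n3: "3 \<le> CARD('n)" and v: "v \<in> test_functions"
    and p: "2 < p" "p \<le> 2 * real CARD('n) / (real CARD('n) - 2)" and \<alpha>: "0 < \<alpha>" "\<alpha> \<le> exp (- 199)"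
  shows "((real CARD('n) - 1) / 2)\<^sup>2 * (LINT x|hyp_volume. (v x)\<^sup>2)
      + ((real CARD('n) - 2) / 2)\<^sup>2 * (LINT x|hyp_volume. (v x)\<^sup>2 / (sinh (hyp_dist 0 x))\<^sup>2)
      + (real CARD('n) - 2) powr (- (p + 2) / p) * best_const (0 :: real ^ 'n) p
        * (LINT x|hyp_volume. sinh (hyp_dist 0 x) powr (p * (real CARD('n) - 2) / 2 - real CARD('n))
           * X (\<alpha> * tanh (hyp_dist 0 x / 2)) powr ((p + 2) / 2) * \<bar>v x\<bar> powr p) powr (2 / p)
    \<le> (LINT x|hyp_volume. (hyp_grad_norm v x)\<^sup>2)"
proof -
  define m where "m = real CARD('n) - 2"
  have m0: "0 < m" using n3 by (simp add: m_def)
  obtain R where RR: "0 < R" "R < 1" "\<And>x. v x \<noteq> 0 \<Longrightarrow> norm x \<le> R" "\<And>k. Ck_on k UNIV v"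
    using test_functionsE[OF v] by metis
  \<comment> \<open>With \<open>\<alpha> <= exp (- 199)\<close> the shift
    \<open>L = 1 - ln \<alpha>\<close> is at least the 200 that the growth of the stretching
    requires.\<close>
  have "ln \<alpha> \<le> ln (exp (- 199))" using \<alpha> by (subst ln_le_cancel_iff) auto
  then have L: "200 \<le> 1 - ln \<alpha>" by simp
  have pm: "p * m / 2 \<le> real CARD('n)" using p(2) m0 unfolding m_def[symmetric] by (simp add: field_simps)
  have vm: "v \<in> borel_measurable borel" by (rule measurable_test(1)[OF RR(4)])
  interpret cutoff v R m p "1 - ln \<alpha>"
    by standard (use n3 RR m_def p(1) pm L in auto)
  have en: "(LINT x|hyp_volume. (hyp_grad_norm v x)\<^sup>2) - ((real CARD('n) - 1) / 2)\<^sup>2 * (LINT x|hyp_volume. (v x)\<^sup>2)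
      = (LINT x|lborel. energy v x)"
    by (rule hyp_energy[OF n3 RR])
  have hd: "(LINT x|hyp_volume. (v x)\<^sup>2 / (sinh (hyp_dist 0 x))\<^sup>2)
    = (LINT x|lborel. indicator pball x * (conf_factor x ^ (CARD('n) - 2) * (v x)\<^sup>2 / (norm x)\<^sup>2))"
    by (rule hyp_hardy[OF n3 RR])
  show ?thesis
    unfolding hd hyp_wnormX[OF vm m_def \<alpha>(1)] unfolding m_def[symmetric]
    using improved_inequality_origin en by linarith
qed

section \<open>Hyperbolic reflections of the ball\<close>

lemma conformal_inverse:
  fixes a b :: "'a :: real_inner"
  assumes "a \<noteq> 0" "b \<noteq> 0"
  shows "(norm ((1 / (norm a)\<^sup>2) *\<^sub>R a - (1 / (norm b)\<^sup>2) *\<^sub>R b))\<^sup>2 = (norm (a - b))\<^sup>2 / ((norm a)\<^sup>2 * (norm b)\<^sup>2)"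
proof -
  have n: "a \<bullet> a \<noteq> 0" "b \<bullet> b \<noteq> 0" using assms by auto
  have "(norm ((1 / (norm a)\<^sup>2) *\<^sub>R a - (1 / (norm b)\<^sup>2) *\<^sub>R b))\<^sup>2
    = (1 / (a \<bullet> a)) - 2 * (a \<bullet> b) / ((a \<bullet> a) * (b \<bullet> b)) + 1 / (b \<bullet> b)"
    unfolding power2_norm_eq_inner using n
    by (simp add: inner_diff_left inner_diff_right inner_commute[of b a] field_simps)
  also have "\<dots> = (norm (a - b))\<^sup>2 / ((norm a)\<^sup>2 * (norm b)\<^sup>2)"
    unfolding power2_norm_eq_inner using n
    by (simp add: inner_diff_left inner_diff_right inner_commute[of b a] field_simps)
  finally show ?thesis .
qed

text \<open>The map \<open>\<sigma>\<close> is inversion in the sphere about \<open>c\<close> with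
  squared radius \<open>\<kappa> = |c|^2 - 1\<close>. This sphere is orthogonal to the unit sphere,
  so the inversion maps the ball onto itself and is a hyperbolic reflection.\<close>

locale inversion =
  fixes c :: "real ^ 'n"
  assumes c1: "1 < norm c"
begin

definition \<kappa> :: real where "\<kappa> = (norm c)\<^sup>2 - 1"

definition \<sigma> :: "real ^ 'n \<Rightarrow> real ^ 'n"
  where "\<sigma> y = c + (\<kappa> / (norm (y - c))\<^sup>2) *\<^sub>R (y - c)"

lemma \<kappa>_pos: "0 < \<kappa>" using c1 by (simp add: \<kappa>_def one_less_power)

lemma away: assumes "norm y < 1" shows "y \<noteq> c" "norm c - 1 < norm (y - c)" "0 < norm (y - c)"
proof -
  show "norm c - 1 < norm (y - c)" using assms norm_triangle_ineq2[of c y] by (simp add: norm_minus_commute)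
  then show "0 < norm (y - c)" using c1 by linarith
  then show "y \<noteq> c" by auto
qed

text \<open>The central identity for \<open>\<sigma>\<close>: invariance of the ball, the scaling of
  the conformal factor, and the denominators in \<open>hyp_dist\<close> all follow from it.\<close>

lemma one_minus_norm_\<sigma>:
  assumes "norm y < 1" shows "1 - (norm (\<sigma> y))\<^sup>2 = \<kappa> * (1 - (norm y)\<^sup>2) / (norm (y - c))\<^sup>2"
proof -
  define d where "d = (norm (y - c))\<^sup>2"
  have d: "0 < d" "d = (y - c) \<bullet> (y - c)" using away[OF assms] by (auto simp: d_def power2_norm_eq_inner)
  have dd: "d = y \<bullet> y - 2 * (c \<bullet> y) + c \<bullet> c" unfolding d(2) by (simp add: inner_diff_left inner_diff_right inner_commute)
  have "(norm (\<sigma> y))\<^sup>2 = c \<bullet> c + 2 * (\<kappa> / d) * (c \<bullet> (y - c)) + (\<kappa> / d)\<^sup>2 * d"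
    unfolding \<sigma>_def d_def[symmetric] unfolding power2_norm_eq_inner
    by (simp add: inner_add_left inner_add_right inner_commute power2_eq_square d(2))
  also have "(\<kappa> / d)\<^sup>2 * d = \<kappa> * \<kappa> / d" using d by (simp add: power2_eq_square)
  also have "c \<bullet> c = \<kappa> + 1" by (simp add: \<kappa>_def power2_norm_eq_inner)
  finally have "1 - (norm (\<sigma> y))\<^sup>2 = (- \<kappa> * d - 2 * \<kappa> * (c \<bullet> (y - c)) - \<kappa> * \<kappa>) / d"
    using d(1) by (simp add: field_simps)
  also have "- \<kappa> * d - 2 * \<kappa> * (c \<bullet> (y - c)) - \<kappa> * \<kappa> = \<kappa> * (1 - y \<bullet> y)"
  proof -
    have "- d - 2 * (c \<bullet> (y - c)) - \<kappa> = 1 - y \<bullet> y"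
      unfolding dd by (simp add: \<kappa>_def power2_norm_eq_inner inner_diff_right)
    then have "\<kappa> * (- d - 2 * (c \<bullet> (y - c)) - \<kappa>) = \<kappa> * (1 - y \<bullet> y)" by simp
    then show ?thesis by (simp add: algebra_simps)
  qed
  finally show ?thesis by (simp add: d_def power2_norm_eq_inner)
qed

lemma \<sigma>_ball: assumes "norm y < 1" shows "norm (\<sigma> y) < 1"
proof -
  have "0 < 1 - (norm y)\<^sup>2" using assms by (simp add: abs_square_less_1)
  then have "0 < 1 - (norm (\<sigma> y))\<^sup>2"
    unfolding one_minus_norm_\<sigma>[OF assms] using \<kappa>_pos away[OF assms] by simp
  then show ?thesis using abs_square_less_1[of "norm (\<sigma> y)"] by simp
qed

lemma \<sigma>_\<sigma>: assumes "norm y < 1" shows "\<sigma> (\<sigma> y) = y"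
proof -
  have d: "norm (y - c) \<noteq> 0" using away[OF assms] by simp
  have s: "\<sigma> y - c = (\<kappa> / (norm (y - c))\<^sup>2) *\<^sub>R (y - c)" by (simp add: \<sigma>_def)
  have "norm (\<sigma> y - c) = \<kappa> / norm (y - c)"
    unfolding s norm_scaleR using d \<kappa>_pos by (simp add: power2_eq_square)
  then have n: "(norm (\<sigma> y - c))\<^sup>2 = \<kappa>\<^sup>2 / (norm (y - c))\<^sup>2" by (simp add: power_divide)
  have "\<sigma> (\<sigma> y) = c + (\<kappa> / (norm (\<sigma> y - c))\<^sup>2) *\<^sub>R (\<sigma> y - c)" by (simp only: \<sigma>_def[of "\<sigma> y"])
  also have "\<dots> = c + (\<kappa> / (\<kappa>\<^sup>2 / (norm (y - c))\<^sup>2) * (\<kappa> / (norm (y - c))\<^sup>2)) *\<^sub>R (y - c)"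
    by (simp only: n) (simp only: s scaleR_scaleR)
  also have "\<kappa> / (\<kappa>\<^sup>2 / (norm (y - c))\<^sup>2) * (\<kappa> / (norm (y - c))\<^sup>2) = 1"
    using d \<kappa>_pos by (simp add: power2_eq_square)
  finally show ?thesis by simp
qed

lemma conf_factor_\<sigma>:
  assumes "norm y < 1" shows "\<kappa> / (norm (y - c))\<^sup>2 * conf_factor (\<sigma> y) = conf_factor y"
  using away[OF assms] \<kappa>_pos unfolding conf_factor_def one_minus_norm_\<sigma>[OF assms] by simp

lemma hyp_dist_\<sigma>:
  assumes x: "norm x < 1" and y: "norm y < 1" shows "hyp_dist (\<sigma> x) (\<sigma> y) = hyp_dist x y"
proof -
  have d: "0 < norm (x - c)" "0 < norm (y - c)" using away x y by auto
  have "\<sigma> x - \<sigma> y = \<kappa> *\<^sub>R ((1 / (norm (x - c))\<^sup>2) *\<^sub>R (x - c) - (1 / (norm (y - c))\<^sup>2) *\<^sub>R (y - c))"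
    by (simp add: \<sigma>_def scaleR_diff_right)
  then have "(norm (\<sigma> x - \<sigma> y))\<^sup>2 = \<kappa>\<^sup>2 * ((norm (x - y))\<^sup>2 / ((norm (x - c))\<^sup>2 * (norm (y - c))\<^sup>2))"
    using conformal_inverse[of "x - c" "y - c"] away(1) x y by (simp add: power_mult_distrib)
  then have "(norm (\<sigma> x - \<sigma> y))\<^sup>2 / ((1 - (norm (\<sigma> x))\<^sup>2) * (1 - (norm (\<sigma> y))\<^sup>2))
    = (norm (x - y))\<^sup>2 / ((1 - (norm x)\<^sup>2) * (1 - (norm y)\<^sup>2))"
    unfolding one_minus_norm_\<sigma>[OF x] one_minus_norm_\<sigma>[OF y]
    using d \<kappa>_pos by (simp add: power2_eq_square)
  then show ?thesis by (simp only: hyp_dist_def times_divide_eq_right[symmetric])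
qed

text \<open>The derivative is a Euclidean reflection times the conformal ratio, the rank-one form
  with \<open>b = - 2\<close>, for which \<open>|1 + b| = 1\<close>.\<close>

lemma has_derivative_\<sigma>:
  assumes "norm y < 1"
  shows "(\<sigma> has_derivative (\<lambda>h. (\<kappa> / (norm (y - c))\<^sup>2) *\<^sub>R (h + (- 2 * (sgn (y - c) \<bullet> h)) *\<^sub>R sgn (y - c)))) (at y)"
proof -
  have d: "(y - c) \<bullet> (y - c) \<noteq> 0" using away[OF assms] by auto
  have "((\<lambda>y. c + (\<kappa> / ((y - c) \<bullet> (y - c))) *\<^sub>R (y - c)) has_derivative
    (\<lambda>h. (\<kappa> / ((y - c) \<bullet> (y - c))) *\<^sub>R h + (- (\<kappa> * (2 * ((y - c) \<bullet> h)) / ((y - c) \<bullet> (y - c))\<^sup>2)) *\<^sub>R (y - c))) (at y)"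
    using d by (auto intro!: derivative_eq_intros simp: fun_eq_iff inner_commute power2_eq_square)
  then show ?thesis
    unfolding \<sigma>_def[abs_def] power2_norm_eq_inner
  proof (rule has_derivative_eq_rhs, intro ext)
    fix h
    have "(sgn (y - c) \<bullet> h) *\<^sub>R sgn (y - c) = (((y - c) \<bullet> h) / ((y - c) \<bullet> (y - c))) *\<^sub>R (y - c)"
      by (simp add: sgn_div_norm divide_inverse flip: power2_norm_eq_inner) (simp add: power2_eq_square mult_ac)
    then have t: "(- 2 * (sgn (y - c) \<bullet> h)) *\<^sub>R sgn (y - c) = (- 2 * (((y - c) \<bullet> h) / ((y - c) \<bullet> (y - c)))) *\<^sub>R (y - c)"
      by (simp only: scaleR_scaleR[symmetric])
    show "(\<kappa> / ((y - c) \<bullet> (y - c))) *\<^sub>R h + (- (\<kappa> * (2 * ((y - c) \<bullet> h)) / ((y - c) \<bullet> (y - c))\<^sup>2)) *\<^sub>R (y - c)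
      = (\<kappa> / ((y - c) \<bullet> (y - c))) *\<^sub>R (h + (- 2 * (sgn (y - c) \<bullet> h)) *\<^sub>R sgn (y - c))"
    proof -
      have "(\<kappa> / D) *\<^sub>R h + (- (\<kappa> * (2 * q) / D\<^sup>2)) *\<^sub>R w = (\<kappa> / D) *\<^sub>R (h + (- 2 * (q / D)) *\<^sub>R w)" for D q and w :: "real ^ 'n"
        by (simp add: scaleR_diff_right power2_eq_square)
      then show ?thesis using t by (simp only:)
    qed
  qed
qed

lemma \<sigma>_measurable [measurable]: "\<sigma> \<in> borel_measurable borel"
  unfolding \<sigma>_def[abs_def] by measurable

text \<open>The Jacobian is the \<open>n\<close>-th power of the conformal ratio, and
  \<open>conf_factor_\<sigma>\<close> converts it together with the volume density at
  \<open>\<sigma> x\<close> into the density at \<open>x\<close>.\<close>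

lemma integral_hyp_volume_\<sigma>:
  fixes F :: "real ^ 'n \<Rightarrow> real"
  assumes [measurable]: "F \<in> borel_measurable borel"
  shows "(LINT x|hyp_volume. F x) = (LINT x|hyp_volume. F (\<sigma> x))"
proof -
  have [measurable]: "(conf_factor :: real ^ 'n \<Rightarrow> real) \<in> borel_measurable borel"
    unfolding conf_factor_def[abs_def] by measurable
  have inj: "inj_on \<sigma> (ball 0 1)" using \<sigma>_\<sigma> by (metis inj_on_inverseI mem_ball_0)
  have img: "\<sigma> ` ball 0 1 = ball 0 1"
  proof
    show "\<sigma> ` ball 0 1 \<subseteq> ball 0 1" using \<sigma>_ball by auto
    show "ball 0 1 \<subseteq> \<sigma> ` ball 0 1"
    proof
      fix y :: "real ^ 'n" assume "y \<in> ball 0 1"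
      then show "y \<in> \<sigma> ` ball 0 1" using \<sigma>_\<sigma>[of y] \<sigma>_ball[of y] by (intro image_eqI[of _ _ "\<sigma> y"]) auto
    qed
  qed
  have "(LINT x|lborel. indicator (\<sigma> ` ball 0 1) x * (conf_factor x ^ CARD('n) * F x))
    = (LINT x|lborel. indicator (ball 0 1) x * ((\<bar>\<kappa> / (norm (x - c))\<^sup>2\<bar> ^ CARD('n) * \<bar>1 + (- 2)\<bar>)
        * (conf_factor (\<sigma> x) ^ CARD('n) * F (\<sigma> x))))"
  proof (rule change_of_variables_rank_one[where e = "\<lambda>x. sgn (x - c)"])
    show "(\<sigma> has_derivative (\<lambda>h. (\<kappa> / (norm (x - c))\<^sup>2) *\<^sub>R (h + (- 2 * (sgn (x - c) \<bullet> h)) *\<^sub>R sgn (x - c)))) (at x)"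
      if "x \<in> ball 0 1" for x using has_derivative_\<sigma> that by simp
    show "norm (sgn (x - c)) = 1" if "x \<in> ball 0 1" for x using away(1)[of x] that by (auto simp: norm_sgn)
    show "(\<lambda>x. indicator (\<sigma> ` ball 0 1) x * (conf_factor x ^ CARD('n) * F x)) \<in> borel_measurable borel"
      unfolding img by (rule indicator_times_measurable(1)) (simp, measurable)
    show "(\<lambda>x. indicator (ball 0 1) x * ((\<bar>\<kappa> / (norm (x - c))\<^sup>2\<bar> ^ CARD('n) * \<bar>1 + (- 2)\<bar>)
        * (conf_factor (\<sigma> x) ^ CARD('n) * F (\<sigma> x)))) \<in> borel_measurable borel"
      by (rule indicator_times_measurable(1)) (simp, measurable)
  qed (simp_all add: inj img)
  also have "\<dots> = (LINT x|lborel. indicator (ball 0 1) x * (conf_factor x ^ CARD('n) * F (\<sigma> x)))"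
  proof (rule Bochner_Integration.integral_cong)
    fix x :: "real ^ 'n"
    show "indicator (ball 0 1) x * ((\<bar>\<kappa> / (norm (x - c))\<^sup>2\<bar> ^ CARD('n) * \<bar>1 + (- 2)\<bar>)
        * (conf_factor (\<sigma> x) ^ CARD('n) * F (\<sigma> x))) = indicator (ball 0 1) x * (conf_factor x ^ CARD('n) * F (\<sigma> x))"
    proof (cases "norm x < 1")
      case True
      have "\<bar>\<kappa> / (norm (x - c))\<^sup>2\<bar> ^ CARD('n) * conf_factor (\<sigma> x) ^ CARD('n) = conf_factor x ^ CARD('n)"
        using conf_factor_\<sigma>[OF True] \<kappa>_pos by (simp flip: power_mult_distrib)
      then show ?thesis by (simp add: mult.assoc[symmetric])
    qed simp
  qed simp
  finally show ?thesis by (simp add: integral_hyp_volume img)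
qed

definition pull :: "(real ^ 'n \<Rightarrow> real) \<Rightarrow> real ^ 'n \<Rightarrow> real"
  where "pull v y = (if norm y < 1 then v (\<sigma> y) else 0)"

lemma Ck_on_\<sigma>: "Ck_on k (ball 0 1) (\<lambda>y. \<sigma> y $ i)"
proof -
  have "Ck_on k (ball 0 1) (\<lambda>y::real^'n. c $ i + \<kappa> * (y $ i - c $ i) / (y \<bullet> y - 2 * (\<Sum>j\<in>UNIV. c $ j * y $ j) + c \<bullet> c))"
  proof (intro Ck_on_add Ck_on_divide Ck_on_mult Ck_on_diff Ck_on_const Ck_on_nth Ck_on_inner_self Ck_on_sum)
    show "y \<bullet> y - 2 * (\<Sum>j\<in>UNIV. c $ j * y $ j) + c \<bullet> c \<noteq> 0" if "y \<in> ball 0 1" for y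
    proof -
      have "y \<bullet> y - 2 * (\<Sum>j\<in>UNIV. c $ j * y $ j) + c \<bullet> c = (y - c) \<bullet> (y - c)"
        by (simp add: inner_diff_left inner_diff_right inner_commute inner_vec_def[of c y])
      then show ?thesis using away(1)[of y] that by auto
    qed
  qed auto
  then show ?thesis
  proof (rule Ck_on_cong_imp[rotated 2])
    show "c $ i + \<kappa> * (y $ i - c $ i) / (y \<bullet> y - 2 * (\<Sum>j\<in>UNIV. c $ j * y $ j) + c \<bullet> c) = \<sigma> y $ i" for y
      by (simp add: \<sigma>_def power2_norm_eq_inner inner_diff_left inner_diff_right inner_commute inner_vec_def[of c y])
  qed simp
qed

lemma pull_test: assumes "v \<in> test_functions" shows "pull v \<in> test_functions"
proof -
  obtain R where R: "0 < R" "R < 1" "\<And>x. v x \<noteq> 0 \<Longrightarrow> norm x \<le> R" "\<And>k. Ck_on k UNIV v"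
    using test_functionsE[OF assms] by metis
  \<comment> \<open>On the support \<open>1 - R^2 <= \<kappa> (1 - |y|^2) / |y - c|^2\<close>, and
    \<open>|y - c| > |c| - 1\<close>; hence \<open>1 - |y|^2 >= \<delta>\<close>. If
    \<open>\<delta> > 1\<close> no such \<open>y\<close> exists, a case covered by the
    \<open>max\<close> in \<open>R'\<close>.\<close>
  define \<delta> where "\<delta> = (1 - R\<^sup>2) * (norm c - 1)\<^sup>2 / \<kappa>"
  have R2: "R\<^sup>2 < 1" using R by (simp add: abs_square_less_1)
  have \<delta>: "0 < \<delta>" unfolding \<delta>_def using R2 \<kappa>_pos c1 by simp
  define R' where "R' = sqrt (max 0 (1 - \<delta>))"
  have R': "R' < 1" "0 \<le> R'" using \<delta> by (auto simp: R'_def real_sqrt_lt_1_iff)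
  have supp: "norm y \<le> R'" if "pull v y \<noteq> 0" for y
  proof -
    have y: "norm y < 1" "v (\<sigma> y) \<noteq> 0" using that by (auto simp: pull_def split: if_splits)
    have "(norm (\<sigma> y))\<^sup>2 \<le> R\<^sup>2" using R(3)[OF y(2)] by (intro power_mono) auto
    then have "1 - R\<^sup>2 \<le> \<kappa> * (1 - (norm y)\<^sup>2) / (norm (y - c))\<^sup>2" using one_minus_norm_\<sigma>[OF y(1)] by simp
    then have "(1 - R\<^sup>2) * (norm (y - c))\<^sup>2 \<le> \<kappa> * (1 - (norm y)\<^sup>2)"
      using away[OF y(1)] by (simp add: le_divide_eq)
    moreover have "(1 - R\<^sup>2) * (norm c - 1)\<^sup>2 \<le> (1 - R\<^sup>2) * (norm (y - c))\<^sup>2"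
      using away(2)[OF y(1)] c1 R2 by (intro mult_left_mono power_mono) auto
    ultimately have "\<delta> \<le> 1 - (norm y)\<^sup>2"
      unfolding \<delta>_def using \<kappa>_pos by (simp add: divide_le_eq mult.commute)
    then have "(norm y)\<^sup>2 \<le> max 0 (1 - \<delta>)" by simp
    then show ?thesis unfolding R'_def by (rule real_le_rsqrt)
  qed
  have "Ck_on k UNIV (pull v)" for k
  proof (rule Ck_on_UNIV_extend[where U = "ball 0 1" and V = "{y. R' < norm y}"])
    have "Ck_on k (ball 0 1) (\<lambda>y. v (\<sigma> y))"
      by (rule Ck_on_compose[OF _ open_UNIV Ck_on_\<sigma> _ R(4)]) auto
    then show "Ck_on k (ball 0 1) (pull v)"
      by (rule Ck_on_cong_imp[rotated 2]) (auto simp: pull_def)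
    show "open {y::real^'n. R' < norm y}" by (intro open_Collect_less continuous_intros)
    show "pull v y = 0" if "y \<in> {y. R' < norm y}" for y using supp[of y] that by (cases "pull v y = 0") auto
    show "ball 0 1 \<union> {y::real^'n. R' < norm y} = UNIV" using R' by auto
  qed simp
  then show ?thesis using test_functionsI[of R' "pull v"] R'(1) supp by blast
qed

lemma pull_pull: assumes "v \<in> test_functions" shows "pull (pull v) = v"
proof
  fix y
  obtain R where R: "R < 1" "\<And>x. v x \<noteq> 0 \<Longrightarrow> norm x \<le> R"
    using test_functionsE[OF assms] by metis
  show "pull (pull v) y = v y"
  proof (cases "norm y < 1")
    case True
    then show ?thesis using \<sigma>_ball[of y] \<sigma>_\<sigma>[of y] by (simp add: pull_def)
  next
    case False
    then have "v y = 0" using R(2)[of y] R(1) by (cases "v y = 0") auto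
    then show ?thesis using False by (simp add: pull_def)
  qed
qed

text \<open>The reflection in the derivative preserves Euclidean length, and the conformal ratio
  cancels against the two conformal factors.\<close>

lemma hyp_grad_norm_pull:
  assumes v: "v \<in> test_functions" and y: "norm y < 1"
  shows "(hyp_grad_norm (pull v) y)\<^sup>2 = (hyp_grad_norm v (\<sigma> y))\<^sup>2"
proof -
  obtain R where R: "\<And>k. Ck_on k UNIV v" using test_functionsE[OF v] by metis
  define e where "e = sgn (y - c)"
  define g where "g = egrad v (\<sigma> y)"
  define l where "l = \<kappa> / (norm (y - c))\<^sup>2"
  have ee: "e \<bullet> e = 1" using away[OF y] by (simp add: e_def norm_sgn flip: power2_norm_eq_inner)
  have l0: "0 < l" using away[OF y] \<kappa>_pos by (simp add: l_def)
  have "v differentiable (at (\<sigma> y))" using R[of 1] by simp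
  from has_derivative_compose[OF has_derivative_\<sigma>[OF y] has_derivative_egrad[OF this]]
  have "((\<lambda>y. v (\<sigma> y)) has_derivative (\<lambda>h. (l *\<^sub>R (g - (2 * (e \<bullet> g)) *\<^sub>R e)) \<bullet> h)) (at y)"
    unfolding e_def[symmetric] g_def[symmetric] l_def[symmetric]
    by (rule has_derivative_eq_rhs) (simp add: fun_eq_iff inner_diff_left inner_diff_right inner_commute algebra_simps)
  then have "(pull v has_derivative (\<lambda>h. (l *\<^sub>R (g - (2 * (e \<bullet> g)) *\<^sub>R e)) \<bullet> h)) (at y)"
  proof (rule has_derivative_transform_within_open[OF _ open_ball])
    show "y \<in> ball 0 1" using y by simp
  qed (simp add: pull_def)
  then have ge: "egrad (pull v) y = l *\<^sub>R (g - (2 * (e \<bullet> g)) *\<^sub>R e)" by (rule egrad_eq)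
  have "(norm (egrad (pull v) y))\<^sup>2 = l\<^sup>2 * (norm g)\<^sup>2"
    unfolding ge power2_norm_eq_inner using ee
    by (simp add: inner_diff_left inner_diff_right inner_commute power2_eq_square algebra_simps)
  then show ?thesis
    unfolding hyp_grad_norm_sq[OF y] hyp_grad_norm_sq[OF \<sigma>_ball[OF y]] g_def[symmetric]
  proof -
    have "conf_factor y = l * conf_factor (\<sigma> y)" using conf_factor_\<sigma>[OF y] by (simp add: l_def)
    then show "(norm (egrad (pull v) y))\<^sup>2 / (conf_factor y)\<^sup>2 = (norm g)\<^sup>2 / (conf_factor (\<sigma> y))\<^sup>2"
      using l0 \<open>(norm (egrad (pull v) y))\<^sup>2 = l\<^sup>2 * (norm g)\<^sup>2\<close> by (simp add: power_mult_distrib)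
  qed
qed

lemma test_borel: "v \<in> test_functions \<Longrightarrow> (v :: real ^ 'n \<Rightarrow> real) \<in> borel_measurable borel"
  "v \<in> test_functions \<Longrightarrow> hyp_grad_norm (v :: real ^ 'n \<Rightarrow> real) \<in> borel_measurable borel"
  using measurable_test test_functionsE by metis+

lemma integral_hyp_cong:
  fixes F G :: "real ^ 'n \<Rightarrow> real"
  assumes "F \<in> borel_measurable borel" "G \<in> borel_measurable borel" "\<And>x. norm x < 1 \<Longrightarrow> F x = G x"
  shows "(LINT x|hyp_volume. F x) = (LINT x|hyp_volume. G x)"
  unfolding integral_hyp_volume[OF assms(1)] integral_hyp_volume[OF assms(2)]
  by (rule Bochner_Integration.integral_cong) (auto simp: assms(3) indicator_def)

lemma energy_pull:
  assumes v: "v \<in> test_functions"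
  shows "(LINT x|hyp_volume. (hyp_grad_norm v x)\<^sup>2) = (LINT x|hyp_volume. (hyp_grad_norm (pull v) x)\<^sup>2)"
proof -
  note [measurable] = test_borel[OF v] test_borel[OF pull_test[OF v]]
  have "(LINT x|hyp_volume. (hyp_grad_norm v x)\<^sup>2) = (LINT x|hyp_volume. (hyp_grad_norm v (\<sigma> x))\<^sup>2)"
    by (rule integral_hyp_volume_\<sigma>) measurable
  also have "\<dots> = (LINT x|hyp_volume. (hyp_grad_norm (pull v) x)\<^sup>2)"
    by (rule integral_hyp_cong) (simp_all add: hyp_grad_norm_pull[OF v])
  finally show ?thesis .
qed

text \<open>Taking distance and value as separate arguments of \<open>G\<close> lets one statement
  cover every integral in the theorem that contains no gradient.\<close>

lemma integral_pull:
  fixes G :: "real \<Rightarrow> real \<Rightarrow> real"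
  assumes v: "v \<in> test_functions" and x0: "norm x0 < 1" "\<sigma> x0 = 0"
    and G: "(\<lambda>x. G (hyp_dist x0 x) (v x)) \<in> borel_measurable borel"
      "(\<lambda>x. G (hyp_dist 0 x) (pull v x)) \<in> borel_measurable borel"
  shows "(LINT x|hyp_volume. G (hyp_dist x0 x) (v x)) = (LINT x|hyp_volume. G (hyp_dist 0 x) (pull v x))"
proof -
  have "(LINT x|hyp_volume. G (hyp_dist x0 x) (v x)) = (LINT x|hyp_volume. G (hyp_dist x0 (\<sigma> x)) (v (\<sigma> x)))"
    by (rule integral_hyp_volume_\<sigma>[OF G(1)])
  also have "\<dots> = (LINT x|hyp_volume. G (hyp_dist 0 x) (pull v x))"
  proof (rule integral_hyp_cong[OF measurable_compose[OF \<sigma>_measurable G(1)] G(2)])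
    fix x :: "real ^ 'n" assume x: "norm x < 1"
    have "hyp_dist x0 (\<sigma> x) = hyp_dist 0 x"
      using hyp_dist_\<sigma>[OF x0(1) \<sigma>_ball[OF x]] x0(2) \<sigma>_\<sigma>[OF x] by simp
    then show "G (hyp_dist x0 (\<sigma> x)) (v (\<sigma> x)) = G (hyp_dist 0 x) (pull v x)" using x by (simp add: pull_def)
  qed
  finally show ?thesis .
qed

context
  fixes x0 :: "real ^ 'n" assumes x0: "norm x0 < 1" "\<sigma> x0 = 0"
begin

lemma terms_pull:
  assumes v: "v \<in> test_functions"
  shows "(LINT x|hyp_volume. (v x)\<^sup>2) = (LINT x|hyp_volume. (pull v x)\<^sup>2)"
    and "(LINT x|hyp_volume. (v x)\<^sup>2 / (sinh (hyp_dist x0 x))\<^sup>2) = (LINT x|hyp_volume. (pull v x)\<^sup>2 / (sinh (hyp_dist 0 x))\<^sup>2)"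
    and "(LINT x|hyp_volume. sinh (hyp_dist x0 x) powr a * \<bar>v x\<bar> powr p)
      = (LINT x|hyp_volume. sinh (hyp_dist 0 x) powr a * \<bar>pull v x\<bar> powr p)"
    and "(LINT x|hyp_volume. sinh (hyp_dist x0 x) powr a * X (\<alpha> * tanh (hyp_dist x0 x / 2)) powr b * \<bar>v x\<bar> powr p)
      = (LINT x|hyp_volume. sinh (hyp_dist 0 x) powr a * X (\<alpha> * tanh (hyp_dist 0 x / 2)) powr b * \<bar>pull v x\<bar> powr p)"
proof -
  note [measurable] = test_borel(1)[OF v] test_borel(1)[OF pull_test[OF v]]
  have [measurable]: "X \<in> borel_measurable borel" unfolding X_def[abs_def] by measurable
  note I = integral_pull[OF v x0]
  show "(LINT x|hyp_volume. (v x)\<^sup>2) = (LINT x|hyp_volume. (pull v x)\<^sup>2)"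
    by (rule I[of "\<lambda>d w. w\<^sup>2"]) measurable
  show "(LINT x|hyp_volume. (v x)\<^sup>2 / (sinh (hyp_dist x0 x))\<^sup>2) = (LINT x|hyp_volume. (pull v x)\<^sup>2 / (sinh (hyp_dist 0 x))\<^sup>2)"
    by (rule I[of "\<lambda>d w. w\<^sup>2 / (sinh d)\<^sup>2"]) measurable
  show "(LINT x|hyp_volume. sinh (hyp_dist x0 x) powr a * \<bar>v x\<bar> powr p)
      = (LINT x|hyp_volume. sinh (hyp_dist 0 x) powr a * \<bar>pull v x\<bar> powr p)"
    by (rule I[of "\<lambda>d w. sinh d powr a * \<bar>w\<bar> powr p"]) measurable
  show "(LINT x|hyp_volume. sinh (hyp_dist x0 x) powr a * X (\<alpha> * tanh (hyp_dist x0 x / 2)) powr b * \<bar>v x\<bar> powr p)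
      = (LINT x|hyp_volume. sinh (hyp_dist 0 x) powr a * X (\<alpha> * tanh (hyp_dist 0 x / 2)) powr b * \<bar>pull v x\<bar> powr p)"
    by (rule I[of "\<lambda>d w. sinh d powr a * X (\<alpha> * tanh (d / 2)) powr b * \<bar>w\<bar> powr p"]) measurable
qed

text \<open>\<open>pull\<close> is an involution of \<open>test_functions\<close> that preserves
  every integral of the defining inequality while it moves the base point, so both base points have
  the same admissible constants.\<close>

lemma best_const_pull: "best_const x0 p = best_const (0 :: real ^ 'n) p"
proof -
  let ?P = "\<lambda>z (v :: real ^ 'n \<Rightarrow> real) S. (LINT x|hyp_volume. (hyp_grad_norm v x)\<^sup>2)
        \<ge> ((real CARD('n) - 1) / 2)\<^sup>2 * (LINT x|hyp_volume. (v x)\<^sup>2)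
          + S * (LINT x|hyp_volume. sinh (hyp_dist z x) powr (p * (real CARD('n) - 2) / 2 - real CARD('n))
                   * \<bar>v x\<bar> powr p) powr (2 / p)"
  have eq: "?P x0 v S \<longleftrightarrow> ?P 0 (pull v) S" if v: "v \<in> test_functions" for v S
    unfolding energy_pull[OF v] terms_pull(1)[OF v] terms_pull(3)[OF v] by (rule refl)
  have "(\<forall>v\<in>test_functions. ?P x0 v S) \<longleftrightarrow> (\<forall>v\<in>test_functions. ?P 0 v S)" for S
  proof (intro iffI ballI)
    fix v :: "real ^ 'n \<Rightarrow> real" assume *: "\<forall>v\<in>test_functions. ?P x0 v S" "v \<in> test_functions"
    have "?P x0 (pull v) S" by (rule bspec[OF *(1) pull_test[OF *(2)]])
    then show "?P 0 v S" by (rule eq[OF pull_test[OF *(2)], unfolded pull_pull[OF *(2)], THEN iffD1])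
  next
    fix v :: "real ^ 'n \<Rightarrow> real" assume *: "\<forall>v\<in>test_functions. ?P 0 v S" "v \<in> test_functions"
    show "?P x0 v S" by (rule eq[OF *(2), THEN iffD2, OF bspec[OF *(1) pull_test[OF *(2)]]])
  qed
  then show ?thesis unfolding best_const_def by (simp only:)
qed

end

end

theorem theorem12:
  assumes n: "CARD('n::finite) \<ge> 3"
  shows "\<exists>\<alpha>\<^sub>n::real. 0 < \<alpha>\<^sub>n \<and> \<alpha>\<^sub>n < exp 1 \<and>
    (\<forall>x0 \<in> (hyp_space :: (real ^ 'n) set).
     \<forall>p::real. 2 < p \<and> p \<le> 2 * real CARD('n) / (real CARD('n) - 2) \<longrightarrow>
      (\<forall>\<alpha>::real. 0 < \<alpha> \<and> \<alpha> \<le> \<alpha>\<^sub>n \<longrightarrow>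
        (\<forall>v \<in> (test_functions :: (real ^ 'n \<Rightarrow> real) set).
          (LINT x|hyp_volume. (hyp_grad_norm v x)\<^sup>2)
            \<ge> ((real CARD('n) - 1) / 2)\<^sup>2 * (LINT x|hyp_volume. (v x)\<^sup>2)
              + ((real CARD('n) - 2) / 2)\<^sup>2
                  * (LINT x|hyp_volume. (v x)\<^sup>2 / (sinh (hyp_dist x0 x))\<^sup>2)
              + (real CARD('n) - 2) powr (- (p + 2) / p) * best_const x0 p
                  * (LINT x|hyp_volume.
                       sinh (hyp_dist x0 x) powr (p * (real CARD('n) - 2) / 2 - real CARD('n))
                       * X (\<alpha> * tanh (hyp_dist x0 x / 2)) powr ((p + 2) / 2)
                       * \<bar>v x\<bar> powr p) powr (2 / p))))"
proof (intro exI[of _ "exp (- 199)"] conjI ballI allI impI)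
  fix x0 :: "real ^ 'n" and p \<alpha> :: real and v :: "real ^ 'n \<Rightarrow> real"
  assume x0: "x0 \<in> hyp_space" and p': "2 < p \<and> p \<le> 2 * real CARD('n) / (real CARD('n) - 2)"
    and \<alpha>': "0 < \<alpha> \<and> \<alpha> \<le> exp (- 199)" and v: "v \<in> test_functions"
  from p' \<alpha>' have p: "2 < p" "p \<le> 2 * real CARD('n) / (real CARD('n) - 2)" and \<alpha>: "0 < \<alpha>" "\<alpha> \<le> exp (- 199)"
    by blast+
  show "(LINT x|hyp_volume. (hyp_grad_norm v x)\<^sup>2)
            \<ge> ((real CARD('n) - 1) / 2)\<^sup>2 * (LINT x|hyp_volume. (v x)\<^sup>2)
              + ((real CARD('n) - 2) / 2)\<^sup>2
                  * (LINT x|hyp_volume. (v x)\<^sup>2 / (sinh (hyp_dist x0 x))\<^sup>2)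
              + (real CARD('n) - 2) powr (- (p + 2) / p) * best_const x0 p
                  * (LINT x|hyp_volume.
                       sinh (hyp_dist x0 x) powr (p * (real CARD('n) - 2) / 2 - real CARD('n))
                       * X (\<alpha> * tanh (hyp_dist x0 x / 2)) powr ((p + 2) / 2)
                       * \<bar>v x\<bar> powr p) powr (2 / p)"
  proof (cases "x0 = 0")
    case True
    show ?thesis unfolding True by (rule improved_origin[OF n v p \<alpha>])
  next
    case False
    have nx: "0 < norm x0" "norm x0 < 1" using False x0 by auto
    \<comment> \<open>The image of \<open>x0\<close> under inversion in the unit sphere. The
      hyperbolic reflection centred there exchanges \<open>x0\<close> and 0. For
      \<open>x0 = 0\<close> there is no such centre, hence the separate case.\<close>
    define c where "c = (1 / (norm x0)\<^sup>2) *\<^sub>R x0"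
    have nc: "norm c = 1 / norm x0" using nx by (simp add: c_def power2_eq_square)
    have c1: "1 < norm c" unfolding nc using nx by simp
    interpret inversion c by standard (rule c1)
    have "\<sigma> 0 = x0"
    proof -
      have "\<sigma> 0 = (1 - \<kappa> / (norm c)\<^sup>2) *\<^sub>R c" by (simp add: \<sigma>_def scaleR_diff_left)
      also have "1 - \<kappa> / (norm c)\<^sup>2 = (norm x0)\<^sup>2"
        unfolding \<kappa>_def nc using nx by (simp add: power_divide field_simps)
      finally show ?thesis using nx by (simp add: c_def)
    qed
    then have s0: "\<sigma> x0 = 0" using \<sigma>_\<sigma>[of 0] by simp
    show ?thesis
      unfolding energy_pull[OF v] terms_pull[OF nx(2) s0 v] best_const_pull[OF nx(2) s0]
      by (rule improved_origin[OF n pull_test[OF v] p \<alpha>])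
  qed
qed (auto intro: order_less_trans[of _ 1])

end
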